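(* Let $1<p<\infty$ and let $p'$ be its conjugate exponent, $\frac1p+\frac1{p'}=1$. Let $h:\mathbb{R}_+\to\mathbb{R}_+$ be a homeomorphism with $h(0)=0$, and suppose that $$\int_0^1 \left(\frac{t}{h^{-1}(t)}\right)^{p'}\,dt<\infty .$$ Then every Hölder $h$ graph $\Gamma\subset\mathbb{R}^2$ is $W^{1,p}$-removable for continuous functions in $\mathbb{R}^2$. In particular, if $\alpha>\frac{p}{2p-1}$, then every Hölder $\alpha$ graph is $W^{1,p}$-removable for continuous functions in $\mathbb{R}^2$. For $p=2$: if $\alpha>2/3$, then every Hölder $\alpha$ graph is $W^{1,2}$-removable for continuous functions in $\mathbb{R}^2$, and hence also quasiconformally removable in $\mathbb{R}^2$.
   Context: Here $\mathbb{R}_+=[0,\infty)$. A Hölder $h$ graph is the graph $\{(x,f(x)):x\in[0,1]\}\subset\mathbb{R}^2$ of a function $f:[0,1]\to\mathbb{R}$ satisfying $|f(x)-f(y)|\le h(|x-y|)$ for all $x,y\in[0,1]$. A Hölder $\alpha$ graph is the graph of a function $f:[0,1]\to\mathbb{R}$ satisfying $|f(x)-f(y)|\le C|x-y|^\alpha$ for all $x,y\in[0,1]$, for some constant $C$. For an open set $\Omega\subset\mathbb{R}^2$, $W^{1,p}(\Omega)$ is the set of functions $u\in L^p(\Omega)$ for which there are functions $\partial_j u\in L^p(\Omega)$, $j=1,2$, with $\int_\Omega u\,\partial_j\psi\,dx=-\int_\Omega \psi\,\partial_j u\,dx$ for all $\psi\in C_0^\infty(\Omega)$ and $j=1,2$.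 A compact set $K\subset\mathbb{R}^2$ is called $W^{1,p}$-removable for continuous functions in $\mathbb{R}^2$ if every function that is continuous in $\mathbb{R}^2$ and belongs to $W^{1,p}(\mathbb{R}^2\setminus K)$ belongs to $W^{1,p}(\mathbb{R}^2)$. A map $f:\Omega\to\tilde\Omega$ between open subsets of $\mathbb{R}^2$ is quasiconformal if it is a homeomorphism, is absolutely continuous on almost every line parallel to the coordinate axes (ACL; i.e. on almost every such line, absolutely continuous on each compact segment of the line contained in $\Omega$), is differentiable almost everywhere, and there is a constant $C$ such that $\max_\theta|\partial_\theta f(x)|\le C\min_\theta|\partial_\theta f(x)|$ for almost every $x\in\Omega$, where the max and min are over all directions $\theta$ and $\partial_\theta$ is the directional derivative. A compact set $K\subset\mathbb{R}^2$ is quasiconformally removable in $\mathbb{R}^2$ if every homeomorphism of $\mathbb{R}^2$ which is quasiconformal on $\mathbb{R}^2\setminus K$ (as a map onto its image) is quasiconformal on $\mathbb{R}^2$. *)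

theory Defs
  imports "HOL-Analysis.Analysis"
begin

section \<open>Sobolev spaces\<close>

text \<open>Functions of class \<open>C\<^sup>k\<close> on the whole space, by recursion on \<open>k\<close>: all directional
  derivatives of a \<open>C\<^sup>k\<^sup>+\<^sup>1\<close> function are \<open>C\<^sup>k\<close>.\<close>

primrec C_k :: "nat \<Rightarrow> ('a::euclidean_space \<Rightarrow> real) \<Rightarrow> bool" where
  "C_k 0 f \<longleftrightarrow> continuous_on UNIV f"
| "C_k (Suc k) f \<longleftrightarrow>
     (\<forall>x. f differentiable (at x)) \<and> (\<forall>v. C_k k (\<lambda>x. frechet_derivative f (at x) v))"

text \<open>\<open>C\<^sub>0\<^sup>\<infinity>(\<Omega>)\<close>; its elements are functions on the whole space, extended by zero outside \<open>\<Omega>\<close>.\<close>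

definition test_functions :: "'a::euclidean_space set \<Rightarrow> ('a \<Rightarrow> real) set" where
  "test_functions \<Omega> =
     {\<psi>. (\<forall>k. C_k k \<psi>) \<and> compact (closure {x. \<psi> x \<noteq> 0}) \<and> closure {x. \<psi> x \<noteq> 0} \<subseteq> \<Omega>}"

definition Lp :: "real \<Rightarrow> 'a::euclidean_space set \<Rightarrow> ('a \<Rightarrow> real) set" where
  "Lp p \<Omega> = {u \<in> borel_measurable (lebesgue_on \<Omega>).
               integrable (lebesgue_on \<Omega>) (\<lambda>x. \<bar>u x\<bar> powr p)}"

text \<open>Membership depends only on the values of \<open>u\<close> on \<open>\<Omega>\<close>, so a function on the whole space
  is identified with its restriction to \<open>\<Omega>\<close>.\<close>

definition W1p :: "real \<Rightarrow> 'a::euclidean_space set \<Rightarrow> ('a \<Rightarrow> real) set" where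
  "W1p p \<Omega> = {u \<in> Lp p \<Omega>. \<forall>b\<in>Basis. \<exists>g\<in>Lp p \<Omega>. \<forall>\<psi>\<in>test_functions \<Omega>.
      (LINT x|lebesgue_on \<Omega>. u x * frechet_derivative \<psi> (at x) b)
        = - (LINT x|lebesgue_on \<Omega>. \<psi> x * g x)}"

definition W1p_removable :: "real \<Rightarrow> (real \<times> real) set \<Rightarrow> bool" where
  "W1p_removable p K \<longleftrightarrow> compact K \<and>
     (\<forall>u. continuous_on UNIV u \<longrightarrow> u \<in> W1p p (- K) \<longrightarrow> u \<in> W1p p UNIV)"

section \<open>Quasiconformal maps\<close>

text \<open>The \<open>\<epsilon>\<close>-\<open>\<delta>\<close> definition; a finite family of non-overlapping compact subintervals of \<open>S\<close> is
  a division of its union.\<close>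

definition abs_continuous_on :: "real set \<Rightarrow> (real \<Rightarrow> 'a::metric_space) \<Rightarrow> bool" where
  "abs_continuous_on S f \<longleftrightarrow>
     (\<forall>\<epsilon>>0. \<exists>\<delta>>0. \<forall>D. D division_of (\<Union>D) \<longrightarrow> \<Union>D \<subseteq> S \<longrightarrow> (\<Sum>I\<in>D. measure lborel I) < \<delta> \<longrightarrow>
        (\<Sum>I\<in>D. dist (f (Inf I)) (f (Sup I))) < \<epsilon>)"

definition ACL :: "(real \<times> real) set \<Rightarrow> (real \<times> real \<Rightarrow> real \<times> real) \<Rightarrow> bool" where
  "ACL \<Omega> f \<longleftrightarrow>
     (AE y in lebesgue. \<forall>a b. {a..b} \<times> {y} \<subseteq> \<Omega> \<longrightarrow> abs_continuous_on {a..b} (\<lambda>x. f (x, y))) \<and>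
     (AE x in lebesgue. \<forall>a b. {x} \<times> {a..b} \<subseteq> \<Omega> \<longrightarrow> abs_continuous_on {a..b} (\<lambda>y. f (x, y)))"

definition dir_deriv :: "(real \<times> real \<Rightarrow> real \<times> real) \<Rightarrow> real \<times> real \<Rightarrow> real \<times> real \<Rightarrow> real \<times> real"
  where "dir_deriv f x v = vector_derivative (\<lambda>t. f (x + t *\<^sub>R v)) (at 0)"

text \<open>Where \<open>f\<close> is differentiable, \<open>v \<mapsto> dir_deriv f x v\<close> is linear, so supremum and infimum over the
  unit circle are a maximum and a minimum.\<close>

definition quasiconformal ::
  "(real \<times> real) set \<Rightarrow> (real \<times> real) set \<Rightarrow> (real \<times> real \<Rightarrow> real \<times> real) \<Rightarrow> bool" where
  "quasiconformal \<Omega> \<Omega>' f \<longleftrightarrow>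
     open \<Omega> \<and> open \<Omega>' \<and> (\<exists>g. homeomorphism \<Omega> \<Omega>' f g) \<and> ACL \<Omega> f \<and>
     (AE x\<in>\<Omega> in lebesgue. f differentiable (at x)) \<and>
     (\<exists>C. AE x\<in>\<Omega> in lebesgue.
        (SUP v\<in>sphere 0 1. norm (dir_deriv f x v)) \<le> C * (INF v\<in>sphere 0 1. norm (dir_deriv f x v)))"

definition qc_removable :: "(real \<times> real) set \<Rightarrow> bool" where
  "qc_removable K \<longleftrightarrow> compact K \<and>
     (\<forall>f. (\<exists>g. homeomorphism UNIV UNIV f g) \<longrightarrow> quasiconformal (- K) (f ` (- K)) f \<longrightarrow>
          quasiconformal UNIV UNIV f)"

section \<open>Hoelder graphs\<close>

definition unit_graph :: "(real \<Rightarrow> real) \<Rightarrow> (real \<times> real) set" where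
  "unit_graph f = {(x, f x) |x. x \<in> {0..1}}"

definition holder_fun_graph :: "(real \<Rightarrow> real) \<Rightarrow> (real \<times> real) set \<Rightarrow> bool" where
  "holder_fun_graph h \<Gamma> \<longleftrightarrow>
     (\<exists>f. \<Gamma> = unit_graph f \<and> (\<forall>x\<in>{0..1}. \<forall>y\<in>{0..1}. \<bar>f x - f y\<bar> \<le> h \<bar>x - y\<bar>))"

definition holder_graph :: "real \<Rightarrow> (real \<times> real) set \<Rightarrow> bool" where
  "holder_graph \<alpha> \<Gamma> \<longleftrightarrow>
     (\<exists>f C. \<Gamma> = unit_graph f \<and> (\<forall>x\<in>{0..1}. \<forall>y\<in>{0..1}. \<bar>f x - f y\<bar> \<le> C * \<bar>x - y\<bar> powr \<alpha>))"

end

theory Submission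
  imports Defs
begin

text \<open>The proof of removability is by cutoff functions. Let \<open>\<Gamma>\<close> be the graph of \<open>f\<close>, let \<open>u\<close> be continuous with weak
  partial derivatives \<open>g\<^sub>1, g\<^sub>2\<close> in \<open>L\<^sup>p\<close> off \<open>\<Gamma>\<close>, let \<open>F\<close> be a smooth function with \<open>\<bar>F - f\<bar> \<le> \<omega>\<close> and \<open>\<bar>F'\<bar> \<le> \<sigma>\<close>, and
  let \<open>\<kappa> (x, y) = \<eta> ((y - F x) / (2 \<omega>))\<close> with a smooth bump \<open>\<eta>\<close>. Then \<open>\<kappa>\<close> is 1 near \<open>\<Gamma>\<close>, and for a test
  function \<open>\<theta>\<close> on the plane \<open>\<theta> (1 - \<kappa>)\<close> may be used as a test function off \<open>\<Gamma>\<close>. The error made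
  is \<open>\<integral> u \<theta> \<partial>\<^sub>j\<kappa>\<close>, and it must be shown to vanish in the limit \<open>\<omega> \<rightarrow> 0\<close>.

  For \<open>j = 2\<close> this holds because \<open>\<partial>\<^sub>2\<kappa>\<close> has integral zero on each vertical line
  (\<open>weak_partial_vertical\<close>). For \<open>j = 1\<close> the point is that \<open>\<partial>\<^sub>1\<kappa> = - F' \<partial>\<^sub>2\<kappa>\<close>: the vertical identity,
  already known on the plane, moves the derivative from \<open>\<kappa>\<close> to \<open>u \<theta>\<close>, and the error becomes the integral
  of \<open>F' \<kappa> \<partial>\<^sub>2(u \<theta>)\<close> over a strip of height about \<open>\<omega>\<close>. As \<open>\<partial>\<^sub>2(u \<theta>)\<close> is in \<open>L\<^sup>p\<close>, this tends to zero if
  \<open>\<sigma>\<^sup>q \<omega> \<rightarrow> 0\<close> along some sequence, where \<open>q\<close> is the conjugate exponent (\<open>weak_partial_horizontal\<close>).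
  Interpolation of \<open>f\<close> with mesh \<open>\<delta>\<close> gives \<open>\<omega>\<close> about \<open>h \<delta>\<close> and \<open>\<sigma>\<close> about \<open>h \<delta> / \<delta>\<close>, so with \<open>t = h \<delta>\<close> the
  condition is that \<open>(t / h\<^sup>-\<^sup>1 t)\<^sup>q t\<close> has lower limit 0. This follows from the integrability of
  \<open>(t / h\<^sup>-\<^sup>1 t)\<^sup>q\<close>, because \<open>1 / t\<close> is not integrable at 0; for \<open>h t = C t\<^sup>\<alpha>\<close> it
  amounts to \<open>\<alpha> (1 + q) > q\<close>, that is, \<open>\<alpha> > p / (2 p - 1)\<close>.

  A homeomorphism that is quasiconformal off \<open>\<Gamma>\<close> satisfies all parts of the definition on the plane, \<open>\<Gamma>\<close>
  being null, except for absolute continuity on lines. Off \<open>\<Gamma>\<close> the square of its derivative is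
  dominated by the Jacobian, which is locally integrable by the change-of-variables theorem, and
  absolute continuity on lines gives weak derivatives (\<open>ACL_imp_weak_derivative\<close>). By the above with
  \<open>p = q = 2\<close> these are weak derivatives on the plane, and a continuous function with locally integrable
  weak derivatives is absolutely continuous on almost every line (\<open>weak_partial_imp_abs_continuous\<close>).\<close>

section \<open>Smooth functions\<close>

text \<open>Smooth functions on the whole space: those of class \<open>C\<^sup>k\<close> for every \<open>k\<close>.\<close>

definition smooth :: "('a::euclidean_space \<Rightarrow> real) \<Rightarrow> bool" where
  "smooth f \<longleftrightarrow> (\<forall>k. C_k k f)"

lemma C_k_SucI:
  fixes f :: "'a::euclidean_space \<Rightarrow> real"
  assumes "\<And>x. (f has_derivative f' x) (at x)" "\<And>v. C_k k (\<lambda>x. f' x v)"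
  shows "C_k (Suc k) f"
proof -
  have "frechet_derivative f (at x) = f' x" for x
    using frechet_derivative_at[OF assms(1)] by simp
  then show ?thesis
    using assms by (auto simp: differentiable_def)
qed

lemma C_k_SucD: "C_k (Suc k) f \<Longrightarrow> C_k k f"
proof (induction k arbitrary: f)
  case 0
  then show ?case
    by (auto simp: continuous_on_eq_continuous_at differentiable_imp_continuous_within)
next
  case (Suc k)
  then show ?case
    using C_k.simps(2) by blast
qed

lemma C_k_const: "C_k k (\<lambda>x. c)"
proof (induction k arbitrary: c)
  case (Suc k)
  show ?case
    by (rule C_k_SucI[OF has_derivative_const]) (rule Suc)
qed (simp add: continuous_on_const)

lemma C_k_add:
  assumes "C_k k f" "C_k k g"
  shows "C_k k (\<lambda>x. f x + g x)"
  using assms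
proof (induction k arbitrary: f g)
  case 0
  then show ?case by (simp add: continuous_on_add)
next
  case (Suc k)
  have d: "(f has_derivative frechet_derivative f (at x)) (at x)"
       "(g has_derivative frechet_derivative g (at x)) (at x)" for x
    using Suc.prems by (auto simp: frechet_derivative_works[symmetric])
  show ?case
    by (rule C_k_SucI[OF has_derivative_add[OF d]], rule Suc.IH) (use Suc.prems in auto)
qed

lemma C_k_mult:
  assumes "C_k k f" "C_k k g"
  shows "C_k k (\<lambda>x. f x * g x)"
  using assms
proof (induction k arbitrary: f g)
  case 0
  then show ?case by (simp add: continuous_on_mult)
next
  case (Suc k)
  have fg: "C_k k f" "C_k k g"
    using Suc.prems C_k_SucD by auto
  have d: "(f has_derivative frechet_derivative f (at x)) (at x)"
       "(g has_derivative frechet_derivative g (at x)) (at x)" for x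
    using Suc.prems by (auto simp: frechet_derivative_works[symmetric])
  show ?case
    by (rule C_k_SucI[OF has_derivative_mult[OF d]], intro C_k_add Suc.IH) (use Suc.prems fg in auto)
qed

lemma C_k_compose:
  fixes g :: "real \<Rightarrow> real" and f :: "'a::euclidean_space \<Rightarrow> real"
  assumes "C_k k g" "C_k k f"
  shows "C_k k (\<lambda>x. g (f x))"
  using assms
proof (induction k arbitrary: f g)
  case 0
  then show ?case using continuous_on_compose2[of UNIV g UNIV f] by simp
next
  case (Suc k)
  have f: "C_k k f"
    using Suc.prems C_k_SucD by auto
  have d: "(f has_derivative frechet_derivative f (at x)) (at x)" for x
    using Suc.prems by (auto simp: frechet_derivative_works[symmetric])
  have e: "(g has_derivative frechet_derivative g (at x)) (at x)" for x
    using Suc.prems by (auto simp: frechet_derivative_works[symmetric])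
  have e': "frechet_derivative g (at y) v = frechet_derivative g (at y) 1 * v" for y v
    using linear_scale[OF has_derivative_linear[OF e], of y v 1] by simp
  have "((\<lambda>x. g (f x)) has_derivative (\<lambda>v. frechet_derivative g (at (f x)) 1 * frechet_derivative f
      (at x) v)) (at x)" for x
    using has_derivative_compose[OF d e, of x] by (simp add: e'[symmetric])
  moreover have "C_k k (\<lambda>x. frechet_derivative g (at (f x)) 1 * frechet_derivative f (at x) v)" for v
    by (rule C_k_mult, rule Suc.IH[where g="\<lambda>y. frechet_derivative g (at y) 1"])
      (use Suc.prems f in auto)
  ultimately show ?case
    by (rule C_k_SucI)
qed

lemma smooth_const: "smooth (\<lambda>x. c)"
  by (simp add: smooth_def C_k_const)

lemma smooth_add: "smooth f \<Longrightarrow> smooth g \<Longrightarrow> smooth (\<lambda>x. f x + g x)"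
  by (simp add: smooth_def C_k_add)

lemma smooth_mult: "smooth f \<Longrightarrow> smooth g \<Longrightarrow> smooth (\<lambda>x. f x * g x)"
  by (simp add: smooth_def C_k_mult)

lemma smooth_diff: "smooth f \<Longrightarrow> smooth g \<Longrightarrow> smooth (\<lambda>x. f x - g x)"
  using smooth_add[of f "\<lambda>x. - 1 * g x"] smooth_mult[OF smooth_const[of "-1"], of g] by simp

lemma smooth_sum: "(\<And>i. i \<in> I \<Longrightarrow> smooth (f i)) \<Longrightarrow> smooth (\<lambda>x. \<Sum>i\<in>I. f i x)"
  by (induction I rule: infinite_finite_induct) (auto simp: smooth_const smooth_add)

lemma smooth_compose: "smooth g \<Longrightarrow> smooth f \<Longrightarrow> smooth (\<lambda>x. g (f x))"
  by (simp add: smooth_def C_k_compose)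

lemma smooth_linear:
  assumes "bounded_linear f"
  shows "smooth f"
  unfolding smooth_def
proof
  fix k
  show "C_k k f"
    using assms
    by (cases k) (auto intro!: C_k_SucI[where f'="\<lambda>x. f"] C_k_const bounded_linear_imp_has_derivative
        simp: linear_continuous_on simp del: C_k.simps(2))
qed

lemma smooth_frechet: "smooth f \<Longrightarrow> smooth (\<lambda>x. frechet_derivative f (at x) v)"
  unfolding smooth_def using C_k.simps(2) by blast

lemma smooth_has_derivative:
  "smooth f \<Longrightarrow> (f has_derivative frechet_derivative f (at x)) (at x)"
  unfolding smooth_def using C_k.simps(2) by (metis frechet_derivative_works)

lemma smooth_continuous: "smooth f \<Longrightarrow> continuous_on S f"
  unfolding smooth_def using C_k.simps(1) continuous_on_subset by blast

lemma smooth_realI: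
  assumes "\<And>x. (f has_real_derivative f' x) (at x)" "smooth f'"
  shows "smooth f"
  unfolding smooth_def
proof
  fix k
  have "C_k (Suc k) f"
    using assms by (intro C_k_SucI[where f'="\<lambda>x v. f' x * v"] C_k_mult C_k_const)
      (auto simp: has_field_derivative_def smooth_def)
  then show "C_k k f"
    by (rule C_k_SucD)
qed

lemma smooth_deriv:
  fixes f :: "real \<Rightarrow> real"
  assumes "smooth f"
  shows "smooth (deriv f)" "(f has_real_derivative deriv f x) (at x)"
proof -
  have e: "(f has_derivative frechet_derivative f (at x)) (at x)" for x
    by (rule smooth_has_derivative[OF assms])
  have e': "frechet_derivative f (at y) v = frechet_derivative f (at y) 1 * v" for y v
    using linear_scale[OF has_derivative_linear[OF e], of y v 1] by simp
  have *: "(f has_real_derivative frechet_derivative f (at x) 1) (at x)" for x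
    unfolding has_field_derivative_def
    by (rule has_derivative_eq_rhs[OF e]) (auto simp: e'[symmetric])
  then have "deriv f = (\<lambda>x. frechet_derivative f (at x) 1)"
    by (auto intro: DERIV_imp_deriv)
  with * smooth_frechet[OF assms] show "smooth (deriv f)" "(f has_real_derivative deriv f x) (at x)"
    by auto
qed

text \<open>The functions \<open>x\<^sup>-\<^sup>n exp (-1/x)\<close>, extended by zero to \<open>x \<le> 0\<close>. Their span is closed under
  differentiation, so each of them is smooth.\<close>

definition flat :: "nat \<Rightarrow> real \<Rightarrow> real" where
  "flat n x = (if x > 0 then (1 / x) ^ n * exp (- (1 / x)) else 0)"

lemma flat_tendsto_0: "(flat n \<longlongrightarrow> 0) (at_right 0)"
proof -
  have "((\<lambda>x::real. inverse x ^ n / exp (inverse x)) \<longlongrightarrow> 0) (at_right 0)"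
    using filterlim_compose[OF tendsto_power_div_exp_0 filterlim_inverse_at_top_right] by simp
  then show ?thesis
    by (rule Lim_transform_eventually)
      (auto simp: flat_def eventually_at_filter divide_inverse exp_minus)
qed

lemma flat_has_derivative:
  "(flat n has_real_derivative (flat (n + 2) x - n * flat (n + 1) x)) (at x)"
proof (cases x "0::real" rule: linorder_cases)
  case less
  have "((\<lambda>x::real. 0::real) has_real_derivative 0) (at x)"
    by simp
  then have "(flat n has_real_derivative 0) (at x)"
    by (rule has_field_derivative_transform_within_open[where S="{..<0}"])
      (use less in \<open>auto simp: flat_def\<close>)
  then show ?thesis
    using less by (simp add: flat_def)
next
  case equal
  have "((\<lambda>h. (flat n (0 + h) - flat n 0) / h) \<longlongrightarrow> 0) (at 0)"
    unfolding filterlim_at_split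
  proof
    have "\<forall>\<^sub>F h in at_left 0. 0 = (flat n (0 + h) - flat n 0) / h"
      by (auto simp: eventually_at_filter flat_def)
    then show "((\<lambda>h. (flat n (0 + h) - flat n 0) / h) \<longlongrightarrow> 0) (at_left 0)"
      by (rule Lim_transform_eventually[OF tendsto_const])
    have "\<forall>\<^sub>F h in at_right 0. flat (Suc n) h = (flat n (0 + h) - flat n 0) / h"
      by (auto simp: eventually_at_filter flat_def)
    then show "((\<lambda>h. (flat n (0 + h) - flat n 0) / h) \<longlongrightarrow> 0) (at_right 0)"
      by (rule Lim_transform_eventually[OF flat_tendsto_0])
  qed
  then have "(flat n has_real_derivative 0) (at 0)"
    by (simp add: DERIV_def)
  then show ?thesis
    using equal by (simp add: flat_def)
next
  case greater
  have "((\<lambda>x. (1 / x) ^ n * exp (- (1 / x))) has_real_derivative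
       (1 / x) ^ (n + 2) * exp (- (1 / x)) - n * ((1 / x) ^ (n + 1) * exp (- (1 / x)))) (at x)"
  proof -
    have 1: "((\<lambda>x::real. 1 / x) has_real_derivative - ((1 / x) * (1 / x))) (at x)"
      using greater by (auto intro!: derivative_eq_intros simp: divide_simps)
    have 2: "((\<lambda>x. exp (- (1 / x))) has_real_derivative exp (- (1 / x)) * - (- ((1 / x) * (1 / x)))) (at x)"
      by (rule DERIV_chain2[OF DERIV_exp DERIV_minus[OF 1]])
    show ?thesis
      by (rule DERIV_cong[OF DERIV_mult[OF DERIV_power[OF 1, of n] 2]]; cases n)
        (simp_all add: algebra_simps del: power_one_over)
  qed
  then have "(flat n has_real_derivative
      (1 / x) ^ (n + 2) * exp (- (1 / x)) - n * ((1 / x) ^ (n + 1) * exp (- (1 / x)))) (at x)"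
    by (rule has_field_derivative_transform_within_open[where S="{0<..}"])
      (use greater in \<open>auto simp: flat_def\<close>)
  then show ?thesis
    using greater by (simp add: flat_def)
qed

lemma smooth_flat: "smooth (flat n)"
  unfolding smooth_def
proof
  fix k
  show "C_k k (flat n)"
  proof (induction k arbitrary: n)
    case 0
    have "isCont (flat n) x" for x
      by (rule DERIV_isCont[OF flat_has_derivative])
    then show ?case
      by (simp add: continuous_on_eq_continuous_at)
  next
    case (Suc k)
    have "C_k k (\<lambda>x. flat (n + 2) x + (- n) * flat (n + 1) x)"
      by (intro C_k_add C_k_mult C_k_const Suc)
    then show ?case
      using flat_has_derivative
      by (intro C_k_SucI[where f'="\<lambda>x v. (flat (n + 2) x - n * flat (n + 1) x) * v"] C_k_mult C_k_const)
        (auto simp: has_field_derivative_def)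
  qed
qed

text \<open>A smooth step from 0 to 1 on the unit interval: the normalised primitive of
  \<open>flat 0 x * flat 0 (1 - x)\<close>.\<close>

lemma smooth_step:
  obtains S S' :: "real \<Rightarrow> real" and M where "smooth S"
    "\<And>x. x \<le> 0 \<Longrightarrow> S x = 0" "\<And>x. x \<ge> 1 \<Longrightarrow> S x = 1" "\<And>x. 0 \<le> S x" "\<And>x. S x \<le> 1"
    "\<And>x. (S has_real_derivative S' x) (at x)" "\<And>x. x \<le> 0 \<or> 1 \<le> x \<Longrightarrow> S' x = 0"
    "\<And>x. \<bar>S' x\<bar> \<le> M"
proof -
  define b where "b x = flat 0 x * flat 0 (1 - x)" for x
  have sb: "smooth b"
    unfolding b_def
    by (rule smooth_mult[OF smooth_flat
          smooth_compose[OF smooth_flat smooth_diff[OF smooth_const smooth_linear[OF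
              bounded_linear_ident]]]])
  have cb: "continuous_on A b" for A
    by (rule smooth_continuous[OF sb])
  have b0: "b x \<ge> 0" for x
    by (auto simp: b_def flat_def)
  have b1: "b x \<le> 1" for x
    by (auto simp: b_def flat_def mult_le_one simp flip: exp_add)
  have bz: "b x = 0" if "x \<le> 0 \<or> x \<ge> 1" for x
    using that by (auto simp: b_def flat_def)
  define P where "P x = integral {-1..x} b" for x
  have Pd: "(P has_real_derivative b x) (at x)" if "x > -1" for x
  proof -
    have "(P has_real_derivative b x) (at x within {-1..x+1})"
      unfolding P_def by (rule integral_has_real_derivative[OF cb]) (use that in auto)
    then show ?thesis
      using that by (subst (asm) at_within_interior) (auto simp: interior_atLeastAtMost_real)
  qed
  have P0: "P x = 0" if "x \<le> 0" for x
  proof -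
    have "integral {-1..x} b = integral {-1..x} (\<lambda>x. 0)"
      by (rule Henstock_Kurzweil_Integration.integral_cong) (use that in \<open>auto simp: bz\<close>)
    then show ?thesis by (simp add: P_def)
  qed
  have Pd: "(P has_real_derivative b x) (at x)" for x
  proof (cases "x > -1")
    case False
    have "((\<lambda>x::real. 0::real) has_real_derivative 0) (at x)" by simp
    then have "(P has_real_derivative 0) (at x)"
      by (rule has_field_derivative_transform_within_open[where S="{..<0}"])
        (use False in \<open>auto simp: P0\<close>)
    then show ?thesis using False by (simp add: bz)
  qed (rule Pd)
  have mono: "P x \<le> P y" if "x \<le> y" for x y
    using that by (rule DERIV_nonneg_imp_nondecreasing) (auto intro: Pd b0)
  have P1: "P x = P 1" if "x \<ge> 1" for x
  proof (cases "x = 1")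
    case False
    have "\<exists>z. 1 < z \<and> z < x \<and> P x - P 1 = (x - 1) * b z"
      by (rule MVT2) (use that False in \<open>auto intro: Pd\<close>)
    then show ?thesis using bz by fastforce
  qed auto
  have pos: "P 1 > 0"
  proof (rule ccontr)
    assume "\<not> P 1 > 0"
    then have "P x = 0" if "x \<le> 1" for x
      using mono[OF that] mono[of "min x 0" x] P0[of "min x 0"] by auto
    then have "P x = 0" for x
      using P1[of x] by (cases "x \<le> 1") auto
    then have "P = (\<lambda>x. 0)" by auto
    then have "b (1/2) = 0"
      using DERIV_unique[OF Pd[of "1/2"], of 0] by simp
    then show False
      by (simp add: b_def flat_def)
  qed
  define S where "S x = (1 / P 1) * P x" for x
  have "smooth S"
    unfolding S_def by (intro smooth_mult smooth_const smooth_realI[OF Pd sb])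
  moreover have "S x = 0" if "x \<le> 0" for x
    using that by (simp add: S_def P0)
  moreover have "S x = 1" if "x \<ge> 1" for x
    using P1[OF that] pos by (simp add: S_def)
  moreover have "0 \<le> S x \<and> S x \<le> 1" for x
    using mono[of "min x 0" x] P0[of "min x 0"] mono[of x "max x 1"] P1[of "max x 1"] pos
    by (auto simp: S_def)
  moreover have "(S has_real_derivative 1 / P 1 * b x) (at x)" for x
    unfolding S_def by (rule DERIV_cmult[OF Pd])
  moreover have "\<bar>1 / P 1 * b x\<bar> \<le> 1 / P 1" for x
    using pos b1[of x] b0[of x] by (simp add: divide_simps)
  moreover have "1 / P 1 * b x = 0" if "x \<le> 0 \<or> 1 \<le> x" for x
    using bz[OF that] by simp
  ultimately show ?thesis
    using that[of S "\<lambda>x. 1 / P 1 * b x" "1 / P 1"] by blast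
qed

lemma smooth_affine: "smooth (\<lambda>x::real. c * x + d)"
  by (intro smooth_add smooth_mult smooth_const smooth_linear bounded_linear_ident)

lemma smooth_bump:
  obtains \<eta> :: "real \<Rightarrow> real" where "smooth \<eta>"
    "\<And>s. \<bar>s\<bar> \<le> 1 \<Longrightarrow> \<eta> s = 1" "\<And>s. \<bar>s\<bar> \<ge> 2 \<Longrightarrow> \<eta> s = 0" "\<And>s. 0 \<le> \<eta> s" "\<And>s. \<eta> s \<le> 1"
proof -
  obtain S S' M where S: "smooth S" "\<And>x. x \<le> 0 \<Longrightarrow> S x = 0" "\<And>x. x \<ge> 1 \<Longrightarrow> S x = 1"
      "\<And>x. 0 \<le> S x" "\<And>x. S x \<le> (1::real)"
    and S': "\<And>x. (S has_real_derivative S' x) (at x)" "\<And>x. x \<le> 0 \<or> 1 \<le> x \<Longrightarrow> S' x = 0"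
      "\<And>x. \<bar>S' x\<bar> \<le> M"
    by (rule smooth_step) blast
  define \<eta> where "\<eta> s = S (1 * s + 2) * S (-1 * s + 2)" for s
  have "smooth \<eta>"
    unfolding \<eta>_def by (rule smooth_mult; rule smooth_compose[OF S(1) smooth_affine])
  moreover have "\<eta> s = 1" if "\<bar>s\<bar> \<le> 1" for s
    using that by (auto simp: \<eta>_def S abs_le_iff)
  moreover have "\<eta> s = 0" if "\<bar>s\<bar> \<ge> 2" for s
    using that by (auto simp: \<eta>_def S abs_if split: if_splits)
  moreover have "0 \<le> \<eta> s \<and> \<eta> s \<le> 1" for s
    by (auto simp: \<eta>_def S intro: mult_le_one)
  ultimately show ?thesis
    using that[of \<eta>] by blast
qed

text \<open>The nearest-point projection onto the unit interval; \<open>f (clamp01 x)\<close> extends a function \<open>f\<close> on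
  the unit interval to the line by constants.\<close>

definition clamp01 :: "real \<Rightarrow> real" where
  "clamp01 x = max 0 (min 1 x)"

text \<open>Interpolation of \<open>f\<close> at the points \<open>i/N\<close> by smooth steps. If \<open>f\<close> oscillates by at most \<open>\<omega>\<close> over
  distances up to \<open>1/N\<close>, the interpolant is within \<open>2\<omega>\<close> of \<open>f\<close> and has slope at most \<open>M N \<omega>\<close>, where
  \<open>M\<close> bounds the slope of the step.\<close>

lemma smooth_interpolation:
  "\<exists>M\<ge>0. \<forall>(f::real \<Rightarrow> real) (N::nat) \<omega>. N > 0 \<longrightarrow>
     (\<forall>x\<in>{0..1}. \<forall>y\<in>{0..1}. \<bar>x - y\<bar> \<le> 1 / N \<longrightarrow> \<bar>f x - f y\<bar> \<le> \<omega>) \<longrightarrow>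
     (\<exists>F F'. smooth F \<and> (\<forall>x. (F has_real_derivative F' x) (at x)) \<and>
        (\<forall>x. \<bar>F x - f (clamp01 x)\<bar> \<le> 2 * \<omega>) \<and> (\<forall>x. \<bar>F' x\<bar> \<le> M * N * \<omega>))"
proof -
  obtain S S' M where S: "smooth S" "\<And>x. x \<le> 0 \<Longrightarrow> S x = 0" "\<And>x. x \<ge> 1 \<Longrightarrow> S x = 1"
      "\<And>x. 0 \<le> S x" "\<And>x. S x \<le> (1::real)"
    and S': "\<And>x. (S has_real_derivative S' x) (at x)" "\<And>x. x \<le> 0 \<or> 1 \<le> x \<Longrightarrow> S' x = 0"
      "\<And>x. \<bar>S' x\<bar> \<le> M"
    by (rule smooth_step) blast
  have M: "M \<ge> 0"
    using S'(3)[of 0] by linarith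
  have *: "\<exists>F F'. smooth F \<and> (\<forall>x. (F has_real_derivative F' x) (at x)) \<and>
        (\<forall>x. \<bar>F x - f (clamp01 x)\<bar> \<le> 2 * \<omega>) \<and> (\<forall>x. \<bar>F' x\<bar> \<le> M * N * \<omega>)"
    if N: "N > 0" and f: "\<And>x y. x \<in> {0..1} \<Longrightarrow> y \<in> {0..1} \<Longrightarrow> \<bar>x - y\<bar> \<le> 1 / N \<Longrightarrow> \<bar>f x - f y\<bar> \<le> \<omega>"
    for f :: "real \<Rightarrow> real" and N :: nat and \<omega>
  proof -
    define \<Delta> where "\<Delta> i = f (Suc i / N) - f (i / N)" for i :: nat
    have \<Delta>: "\<bar>\<Delta> i\<bar> \<le> \<omega>" if "i < N" for i
      unfolding \<Delta>_def using that N by (intro f) (auto simp: field_simps)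
    have \<omega>: "\<omega> \<ge> 0"
      using \<Delta>[OF N] by linarith
    have tel: "(\<Sum>i<j. \<Delta> i) = f (j / N) - f 0" for j
      unfolding \<Delta>_def using sum_lessThan_telescope[of "\<lambda>i. f (real i / N)" j] by simp
    define F where "F x = f 0 + (\<Sum>i<N. \<Delta> i * S (N * x + (- real i)))" for x :: real
    define F' where "F' x = (\<Sum>i<N. \<Delta> i * (S' (N * x + (- real i)) * N))" for x :: real
    have "smooth F"
      unfolding F_def
      by (rule smooth_add[OF smooth_const], rule smooth_sum, rule smooth_mult[OF smooth_const],
          rule smooth_compose[OF S(1) smooth_affine])
    moreover have "(F has_real_derivative F' x) (at x)" for x
    proof -
      have "((\<lambda>x. S (N * x + (- real i))) has_real_derivative S' (N * x + (- real i)) * N) (at x)" for i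
        by (rule DERIV_chain2[OF S'(1)]) (auto intro!: derivative_eq_intros)
      then have "((\<lambda>x. \<Sum>i<N. \<Delta> i * S (N * x + (- real i))) has_real_derivative F' x) (at x)"
        unfolding F'_def by (intro DERIV_sum DERIV_cmult)
      from DERIV_add[OF DERIV_const[of "f 0"] this] show ?thesis
        unfolding F_def by simp
    qed
    moreover have "\<bar>F x - f (clamp01 x)\<bar> \<le> 2 * \<omega>" for x
    proof -
      consider "x < 0" | "x \<ge> 1" | "0 \<le> x" "x < 1" by linarith
      then show ?thesis
      proof cases
        case 1
        then have "S (N * x + (- real i)) = 0" for i
          using N by (intro S(2)) (smt (verit) mult_nonneg_nonpos of_nat_0_le_iff)
        with 1 \<omega> show ?thesis
          by (simp add: F_def clamp01_def)
      next
        case 2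
        have "S (N * x + (- real i)) = 1" if "i < N" for i
        proof (rule S(3))
          have "real N * 1 \<le> N * x"
            using 2 by (intro mult_left_mono) auto
          moreover have "real i + 1 \<le> N"
            using that by linarith
          ultimately show "1 \<le> N * x + (- real i)"
            by linarith
        qed
        with 2 \<omega> tel[of N] N show ?thesis
          by (simp add: F_def clamp01_def)
      next
        case 3
        \<comment> \<open>the steps before the cell of \<open>x\<close> are complete and those after it have not begun\<close>
        define j where "j = nat \<lfloor>N * x\<rfloor>"
        have j: "real j \<le> N * x" "N * x < real j + 1"
          using 3 by (auto simp: j_def)
        have "real N * x < real N * 1"
          using 3 N by (intro mult_strict_left_mono) auto
        then have jN: "j < N"
          using j by linarith
        have "{..<N} = {..<j} \<union> {j} \<union> {j<..<N}" "{..<j} \<inter> {j<..<N} = {}"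
          using jN by auto
        moreover have "(\<Sum>i\<in>{..<j}. \<Delta> i * S (N * x + (- real i))) = (\<Sum>i<j. \<Delta> i)"
          using j by (intro sum.cong) (auto simp: S)
        moreover have "(\<Sum>i\<in>{j<..<N}. \<Delta> i * S (N * x + (- real i))) = 0"
          using j by (intro sum.neutral) (auto simp: S)
        ultimately have "F x = f 0 + (\<Sum>i<j. \<Delta> i) + \<Delta> j * S (N * x + (- real j))"
          unfolding F_def by (simp add: sum.union_disjoint ivl_disj_int)
        then have "F x - f x = (f (j / N) - f x) + \<Delta> j * S (N * x + (- real j))"
          by (simp add: tel)
        moreover have "\<bar>f (j / N) - f x\<bar> \<le> \<omega>"
        proof (rule f)
          have "j / N \<le> x" "x \<le> j / N + 1 / N"
            using j N by (auto simp: field_simps)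
          then show "\<bar>j / N - x\<bar> \<le> 1 / N"
            by (simp add: abs_le_iff)
        qed (use 3 jN in auto)
        moreover have "\<bar>\<Delta> j * S (N * x + (- real j))\<bar> \<le> \<omega> * 1"
          unfolding abs_mult using \<Delta>[OF jN] S(4,5) \<omega> by (intro mult_mono) (auto simp: abs_le_iff)
        ultimately show ?thesis
          using 3 by (simp add: clamp01_def)
      qed
    qed
    moreover have "\<bar>F' x\<bar> \<le> M * N * \<omega>" for x
    proof -
      have "\<bar>F' x\<bar> \<le> (\<Sum>i<N. \<bar>\<Delta> i * (S' (N * x + (- real i)) * N)\<bar>)"
        unfolding F'_def by (rule sum_abs)
      \<comment> \<open>only the step of the cell that contains \<open>x\<close> has nonzero slope there\<close>
      also have "\<dots> \<le> (\<Sum>i<N. if i = nat \<lfloor>N * x\<rfloor> then \<omega> * (M * N) else 0)"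
      proof (rule sum_mono)
        fix i assume i: "i \<in> {..<N}"
        show "\<bar>\<Delta> i * (S' (N * x + (- real i)) * N)\<bar> \<le> (if i = nat \<lfloor>N * x\<rfloor> then \<omega> * (M * N) else 0)"
        proof (cases "i = nat \<lfloor>N * x\<rfloor>")
          case True
          then show ?thesis
            using \<Delta>[of i] i S'(3) \<omega> M by (auto simp: abs_mult intro!: mult_mono)
        next
          case False
          have "N * x + (- real i) \<le> 0 \<or> 1 \<le> N * x + (- real i)"
          proof (rule ccontr)
            assume "\<not> ?thesis"
            then have "\<lfloor>N * x\<rfloor> = int i"
              by (intro floor_unique) auto
            with False show False by simp
          qed
          with False show ?thesis
            by (simp add: S'(2))
        qed
      qed
      also have "\<dots> \<le> \<omega> * (M * N)"
        using \<omega> M by (simp add: sum.delta)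
      finally show ?thesis
        by (simp add: algebra_simps)
    qed
    ultimately show ?thesis by blast
  qed
  show ?thesis
  proof (intro exI[of _ M] conjI M allI impI, goal_cases)
    case (1 f N \<omega>)
    then show ?case
      by (intro *) auto
  qed
qed

section \<open>Test functions, weak derivatives and local integrability\<close>

lemma test_functions_UNIV_D:
  assumes "\<psi> \<in> test_functions UNIV"
  shows "smooth \<psi>" "\<exists>R\<ge>0. \<forall>z v. norm z > R \<longrightarrow> \<psi> z = 0 \<and> frechet_derivative \<psi> (at z) v = 0"
proof -
  show sm: "smooth \<psi>"
    using assms by (auto simp: test_functions_def smooth_def)
  have "bounded (closure {x. \<psi> x \<noteq> 0})"
    using assms by (auto simp: test_functions_def compact_imp_bounded)
  then have "bounded {x. \<psi> x \<noteq> 0}"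
    by (rule bounded_subset[OF _ closure_subset])
  then obtain R where R: "\<And>z. \<psi> z \<noteq> 0 \<Longrightarrow> norm z \<le> R"
    by (auto simp: bounded_iff)
  then have R0: "\<psi> z = 0" if "norm z > R" for z
    using that not_less by blast
  have "\<psi> z = 0 \<and> frechet_derivative \<psi> (at z) v = 0" if "norm z > max 0 R" for z v
  proof
    have z: "norm z > R"
      using that by simp
    then show "\<psi> z = 0"
      by (rule R0)
    have op: "open {z. R < norm z}"
      by (intro open_Collect_less continuous_intros)
    have "(\<psi> has_derivative (\<lambda>v. 0)) (at z)"
      by (rule has_derivative_transform_within_open[OF has_derivative_const op])
        (simp_all add: z R0)
    then show "frechet_derivative \<psi> (at z) v = 0"
      using frechet_derivative_at by metis
  qed
  then show "\<exists>R\<ge>0. \<forall>z v. norm z > R \<longrightarrow> \<psi> z = 0 \<and> frechet_derivative \<psi> (at z) v = 0"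
    by (intro exI[of _ "max 0 R"]) auto
qed

lemma test_functionsI:
  assumes "smooth \<psi>" "\<And>z. \<psi> z \<noteq> 0 \<Longrightarrow> norm z \<le> R \<and> z \<in> C" "closed C" "C \<subseteq> \<Omega>"
  shows "\<psi> \<in> test_functions \<Omega>"
proof -
  have "closure {x. \<psi> x \<noteq> 0} \<subseteq> cball 0 R \<inter> C"
    using assms by (intro closure_minimal closed_Int) auto
  moreover from this have "compact (closure {x. \<psi> x \<noteq> 0})"
    using bounded_subset[OF bounded_cball, of "closure {x. \<psi> x \<noteq> 0}" 0 R]
    by (simp add: compact_eq_bounded_closed)
  ultimately show ?thesis
    using assms by (auto simp: test_functions_def smooth_def)
qed

text \<open>Membership in \<open>L\<^sup>p\<close> on every ball, for functions on the whole space.\<close>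

definition locally_Lp :: "real \<Rightarrow> ('a::euclidean_space \<Rightarrow> real) \<Rightarrow> bool" where
  "locally_Lp p g \<longleftrightarrow> g \<in> borel_measurable lebesgue \<and>
     (\<forall>R. integrable lebesgue (\<lambda>z. indicator (cball 0 R) z * \<bar>g z\<bar> powr p))"

text \<open>The weak derivative of \<open>u\<close> in direction \<open>b\<close> on \<open>\<Omega>\<close> is \<open>g\<close>. Test functions vanish outside \<open>\<Omega>\<close>, so the
  integrals are taken over the whole space.\<close>

definition weak_partial :: "'a::euclidean_space set \<Rightarrow> 'a \<Rightarrow> ('a \<Rightarrow> real) \<Rightarrow> ('a \<Rightarrow> real) \<Rightarrow> bool" where
  "weak_partial \<Omega> b u g \<longleftrightarrow> (\<forall>\<psi>\<in>test_functions \<Omega>.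
     (\<integral>x. u x * frechet_derivative \<psi> (at x) b \<partial>lebesgue) = - (\<integral>x. \<psi> x * g x \<partial>lebesgue))"

lemma conjugate_exponent_gt_1:
  fixes p q :: real
  assumes p: "p > 1" "1 / p + 1 / q = 1"
  shows "q > 1"
proof -
  have "0 < 1 / p" "1 / p < 1"
    using p by auto
  then have "1 / q < 1" "0 < 1 / q"
    using p(2) by linarith+
  then show ?thesis
    by (simp add: divide_simps split: if_splits)
qed

lemma borel_measurable_lebesgueI:
  fixes f :: "'a::euclidean_space \<Rightarrow> real"
  shows "f \<in> borel_measurable borel \<Longrightarrow> f \<in> borel_measurable lebesgue"
  by (rule measurable_completion) simp

lemma cball_lborel_integrable: "integrable lebesgue (\<lambda>z::'a::euclidean_space. indicator (cball 0 R)
    z :: real)"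
  using emeasure_bounded_finite[OF bounded_cball, of 0 R]
  by (intro integrable_real_indicator) auto

lemma integrable_mult_locally_Lp:
  fixes g \<theta> :: "'a::euclidean_space \<Rightarrow> real"
  assumes g: "locally_Lp p g" and p: "p \<ge> 1"
    and \<theta>: "\<theta> \<in> borel_measurable borel" "\<And>z. \<bar>\<theta> z\<bar> \<le> B" "\<And>z. norm z > R \<Longrightarrow> \<theta> z = 0"
  shows "integrable lebesgue (\<lambda>z. \<theta> z * g z)"
proof (rule Bochner_Integration.integrable_bound)
  show "integrable lebesgue (\<lambda>z. B * (indicator (cball 0 R) z + indicator (cball 0 R) z * \<bar>g z\<bar> powr p))"
    using g cball_lborel_integrable
    by (intro integrable_mult_right Bochner_Integration.integrable_add) (auto simp: locally_Lp_def)
  show "(\<lambda>z. \<theta> z * g z) \<in> borel_measurable lebesgue"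
    using g borel_measurable_lebesgueI[OF \<theta>(1)] by (auto simp: locally_Lp_def)
  have "\<bar>\<theta> z\<bar> * \<bar>g z\<bar> \<le> B * (1 + \<bar>g z\<bar> powr p)" if "norm z \<le> R" for z
  proof -
    have "\<bar>g z\<bar> \<le> 1 + \<bar>g z\<bar> powr p"
    proof (cases "\<bar>g z\<bar> \<le> 1")
      case True
      then show ?thesis by (smt (verit) powr_ge_zero)
    next
      case False
      then have "\<bar>g z\<bar> powr 1 \<le> \<bar>g z\<bar> powr p"
        using p by (intro powr_mono) auto
      then show ?thesis using False by simp
    qed
    then show ?thesis
      using \<theta>(2)[of z] by (intro mult_mono) auto
  qed
  moreover have "B \<ge> 0"
    using \<theta>(2)[of 0] by linarith
  ultimately show "AE z in lebesgue. norm (\<theta> z * g z)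
      \<le> norm (B * (indicator (cball 0 R) z + indicator (cball 0 R) z * \<bar>g z\<bar> powr p))"
    using \<theta>(3) by (intro AE_I2) (auto simp: indicator_def abs_mult not_le)
qed

lemma continuous_bounded_support:
  fixes h :: "'a::euclidean_space \<Rightarrow> real"
  assumes "continuous_on UNIV h" "\<And>z. norm z > R \<Longrightarrow> h z = 0"
  shows "\<exists>B\<ge>0. \<forall>z. \<bar>h z\<bar> \<le> B" "integrable lborel h" "integrable lebesgue h"
proof -
  have "compact (h ` cball 0 R)"
    using assms by (intro compact_continuous_image continuous_on_subset[OF assms(1)]) auto
  from compact_imp_bounded[OF this] obtain B where "\<forall>x\<in>h ` cball 0 R. norm x \<le> B"
    unfolding bounded_iff by blast
  then have "norm (h z) \<le> B" if "norm z \<le> R" for z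
    using that by simp
  then have "\<bar>h z\<bar> \<le> max 0 B" for z
    using assms(2)[of z] by (cases "norm z > R") (auto simp: not_less le_max_iff_disj)
  then show "\<exists>B\<ge>0. \<forall>z. \<bar>h z\<bar> \<le> B"
    by (intro exI[of _ "max 0 B"]) auto
  have "integrable lborel (\<lambda>z. indicator (cball 0 R) z *\<^sub>R h z)"
    by (intro borel_integrable_compact continuous_on_subset[OF assms(1)]) auto
  also have "(\<lambda>z. indicator (cball 0 R) z *\<^sub>R h z) = h"
    using assms(2) by (auto simp: indicator_def fun_eq_iff not_le)
  finally show *: "integrable lborel h" .
  then show "integrable lebesgue h"
    by (subst integrable_completion) auto
qed

text \<open>A continuous graph is null by Fubini, since each vertical line meets it in one point.\<close>

lemma graph_null:
  fixes f :: "real \<Rightarrow> real"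
  assumes "continuous_on UNIV f"
  shows "AE z in lborel. snd z \<noteq> f (fst z)"
proof -
  have cl: "closed {z. snd z = f (fst z)}"
    by (intro closed_Collect_eq continuous_intros continuous_on_compose2[OF assms]) auto
  then have m: "{z. snd z = f (fst z)} \<in> sets (lborel \<Otimes>\<^sub>M lborel)"
    by (metis borel_closed lborel_prod sets_lborel)
  have "emeasure (lborel \<Otimes>\<^sub>M lborel) {z. snd z = f (fst z)} = 0"
    by (subst lborel.emeasure_pair_measure_alt[OF m]) (simp add: vimage_def)
  then have "{z. snd z = f (fst z)} \<in> null_sets lborel"
    using null_setsI[OF _ m] by (simp only: lborel_prod)
  then show ?thesis
    by (rule AE_I') auto
qed

section \<open>Cutoff functions along a graph\<close>

text \<open>A continuous function \<open>f\<close> on the line with smooth approximations \<open>F n\<close>, where \<open>\<omega> n\<close> bounds the error and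
  \<open>\<sigma> n\<close> the slope, and a smooth bump \<open>\<eta>\<close> that is 1 on \<open>[-1, 1]\<close> and 0 outside \<open>(-2, 2)\<close>.\<close>

locale graph_cutoff =
  fixes f :: "real \<Rightarrow> real" and F F' :: "nat \<Rightarrow> real \<Rightarrow> real" and \<omega> \<sigma> :: "nat \<Rightarrow> real"
    and \<eta> :: "real \<Rightarrow> real"
  assumes f_cont: "continuous_on UNIV f"
    and F_smooth: "\<And>n. smooth (F n)"
    and F_deriv: "\<And>n x. (F n has_real_derivative F' n x) (at x)"
    and F_close: "\<And>n x. \<bar>F n x - f x\<bar> \<le> \<omega> n"
    and F'_bound: "\<And>n x. \<bar>F' n x\<bar> \<le> \<sigma> n"
    and \<omega>_pos: "\<And>n. 0 < \<omega> n" and \<omega>_lim: "\<omega> \<longlonglongrightarrow> 0"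
    and \<eta>_smooth: "smooth \<eta>"
    and \<eta>: "\<And>s. \<bar>s\<bar> \<le> 1 \<Longrightarrow> \<eta> s = 1" "\<And>s. \<bar>s\<bar> \<ge> 2 \<Longrightarrow> \<eta> s = 0" "\<And>s. 0 \<le> \<eta> s" "\<And>s. \<eta> s \<le> 1"
begin

text \<open>The signed vertical distance to the graph of \<open>F n\<close> in units of \<open>2 \<omega> n\<close>. Points of the graph of \<open>f\<close>
  have value at most \<open>1/2\<close> in modulus, so \<open>\<kappa> n\<close> below is 1 near that graph.\<close>

definition strip :: "nat \<Rightarrow> real \<times> real \<Rightarrow> real" where
  "strip n z = 1 / (2 * \<omega> n) * (snd z - F n (fst z))"

text \<open>The cutoff function, 1 near the graph of \<open>f\<close> and supported in a strip of height comparable to \<open>\<omega> n\<close>.\<close>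

definition \<kappa> :: "nat \<Rightarrow> real \<times> real \<Rightarrow> real" where
  "\<kappa> n z = \<eta> (strip n z)"

text \<open>The vertical derivative of \<open>\<kappa> n\<close>; its horizontal derivative is \<open>- F' n x\<close> times this.\<close>

definition \<kappa>' :: "nat \<Rightarrow> real \<times> real \<Rightarrow> real" where
  "\<kappa>' n z = deriv \<eta> (strip n z) * (1 / (2 * \<omega> n))"

lemma smooth_strip: "smooth (strip n)"
  unfolding strip_def
  by (rule smooth_mult[OF smooth_const smooth_diff[OF smooth_linear[OF bounded_linear_snd]
        smooth_compose[OF F_smooth smooth_linear[OF bounded_linear_fst]]]])

lemma smooth_\<kappa>: "smooth (\<kappa> n)"
  unfolding \<kappa>_def by (rule smooth_compose[OF \<eta>_smooth smooth_strip])

lemma F'_smooth: "smooth (F' n)"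
proof -
  have "F' n = deriv (F n)"
    using DERIV_imp_deriv[OF F_deriv] by auto
  then show ?thesis
    using smooth_deriv(1)[OF F_smooth] by simp
qed

lemma \<kappa>_bounds: "0 \<le> \<kappa> n z" "\<kappa> n z \<le> 1"
  by (auto simp: \<kappa>_def \<eta>)

lemma \<kappa>_frechet:
  "frechet_derivative (\<kappa> n) (at z) v = \<kappa>' n z * (snd v - F' n (fst z) * fst v)"
proof -
  have "((\<lambda>z. F n (fst z)) has_derivative (\<lambda>v. F' n (fst z) * fst v)) (at z)"
    using has_derivative_compose[OF bounded_linear_imp_has_derivative[OF bounded_linear_fst]
      F_deriv[unfolded has_field_derivative_def], of n z] by simp
  then have a: "(strip n has_derivative (\<lambda>v. 1 / (2 * \<omega> n) * (snd v - F' n (fst z) * fst v))) (at z)"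
    unfolding strip_def
    by (intro has_derivative_mult_right has_derivative_diff bounded_linear_imp_has_derivative
        bounded_linear_snd)
  have "(\<kappa> n has_derivative (\<lambda>v. deriv \<eta> (strip n z) * (1 / (2 * \<omega> n) * (snd v - F' n (fst z) * fst
      v)))) (at z)"
    unfolding \<kappa>_def
    by (rule has_derivative_compose[OF a, of \<eta>, OF smooth_deriv(2)[OF \<eta>_smooth, unfolded
        has_field_derivative_def]])
  then show ?thesis
    by (subst frechet_derivative_at[symmetric]) (auto simp: \<kappa>'_def)
qed

lemma \<kappa>_eq_0:
  assumes "\<bar>snd z - f (fst z)\<bar> > 5 * \<omega> n"
  shows "\<kappa> n z = 0"
proof -
  have "\<bar>snd z - F n (fst z)\<bar> \<ge> 4 * \<omega> n"
    using assms F_close[of n "fst z"] by linarith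
  then have "\<bar>strip n z\<bar> \<ge> 2"
    using \<omega>_pos[of n] by (simp add: strip_def abs_mult field_simps)
  then show ?thesis
    by (simp add: \<kappa>_def \<eta>)
qed

lemma \<kappa>_tendsto_0:
  assumes "snd z \<noteq> f (fst z)"
  shows "(\<lambda>n. \<kappa> n z) \<longlonglongrightarrow> 0"
proof -
  have "(\<lambda>n. 5 * \<omega> n) \<longlonglongrightarrow> 0"
    using tendsto_mult_right_zero[OF \<omega>_lim] by simp
  then have "\<forall>\<^sub>F n in sequentially. 5 * \<omega> n < \<bar>snd z - f (fst z)\<bar>"
    by (rule order_tendstoD) (use assms in auto)
  then have "\<forall>\<^sub>F n in sequentially. 0 = \<kappa> n z"
    by eventually_elim (simp add: \<kappa>_eq_0)
  then show ?thesis
    by (rule Lim_transform_eventually[OF tendsto_const])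
qed

lemma AE_\<kappa>_tendsto_0: "AE z in lebesgue. (\<lambda>n. \<kappa> n z) \<longlonglongrightarrow> 0"
  unfolding AE_completion_iff using graph_null[OF f_cont] by eventually_elim (rule \<kappa>_tendsto_0)

lemma \<kappa>_measurable: "\<kappa> n \<in> borel_measurable borel"
  by (rule borel_measurable_continuous_onI[OF smooth_continuous[OF smooth_\<kappa>]])

lemma integral_\<kappa>_tendsto_0:
  assumes "integrable lebesgue H"
  shows "integrable lebesgue (\<lambda>z. \<kappa> n z * H z)" "(\<lambda>n. \<integral>z. \<kappa> n z * H z \<partial>lebesgue) \<longlonglongrightarrow> 0"
proof -
  have m: "(\<lambda>z. \<kappa> n z * H z) \<in> borel_measurable lebesgue" for n
    using borel_measurable_lebesgueI[OF \<kappa>_measurable] borel_measurable_integrable[OF assms] by simp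
  have b: "AE z in lebesgue. norm (\<kappa> n z * H z) \<le> norm (H z)" for n
    using \<kappa>_bounds by (intro AE_I2) (auto simp: abs_mult intro!: mult_left_le_one_le)
  show "integrable lebesgue (\<lambda>z. \<kappa> n z * H z)"
    by (rule Bochner_Integration.integrable_bound[OF assms m b])
  have "AE z in lebesgue. (\<lambda>n. \<kappa> n z * H z) \<longlonglongrightarrow> 0"
    using AE_\<kappa>_tendsto_0 by eventually_elim (rule tendsto_mult_left_zero)
  then have "(\<lambda>n. \<integral>z. \<kappa> n z * H z \<partial>lebesgue) \<longlonglongrightarrow> (\<integral>z. 0 \<partial>(lebesgue :: (real \<times> real) measure))"
    by (intro integral_dominated_convergence[where w="\<lambda>z. norm (H z)"] m b integrable_norm assms) auto
  then show "(\<lambda>n. \<integral>z. \<kappa> n z * H z \<partial>lebesgue) \<longlonglongrightarrow> 0"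
    by simp
qed

lemma integral_1_minus_\<kappa>_tendsto:
  assumes "integrable lebesgue H"
  shows "integrable lebesgue (\<lambda>z. (1 - \<kappa> n z) * H z)"
    "(\<lambda>n. \<integral>z. (1 - \<kappa> n z) * H z \<partial>lebesgue) \<longlonglongrightarrow> (\<integral>z. H z \<partial>lebesgue)"
proof -
  have eq: "(\<lambda>z. (1 - \<kappa> n z) * H z) = (\<lambda>z. H z - \<kappa> n z * H z)" for n
    by (simp add: algebra_simps)
  show "integrable lebesgue (\<lambda>z. (1 - \<kappa> n z) * H z)"
    unfolding eq by (intro Bochner_Integration.integrable_diff assms integral_\<kappa>_tendsto_0)
  show "(\<lambda>n. \<integral>z. (1 - \<kappa> n z) * H z \<partial>lebesgue) \<longlonglongrightarrow> (\<integral>z. H z \<partial>lebesgue)"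
    unfolding eq using tendsto_diff[OF tendsto_const integral_\<kappa>_tendsto_0(2)[OF assms]]
    by (simp add: assms integral_\<kappa>_tendsto_0(1))
qed

lemma cutoff_test_function:
  assumes "\<theta> \<in> test_functions UNIV" "\<Gamma> \<subseteq> {(x, f x) | x. True}"
  shows "(\<lambda>z. \<theta> z * (1 - \<kappa> n z)) \<in> test_functions (- \<Gamma>)"
    "frechet_derivative (\<lambda>z. \<theta> z * (1 - \<kappa> n z)) (at z) v =
      (1 - \<kappa> n z) * frechet_derivative \<theta> (at z) v - \<theta> z * (\<kappa>' n z * (snd v - F' n (fst z) * fst v))"
proof -
  note \<theta> = test_functions_UNIV_D[OF assms(1)]
  obtain R where R: "\<And>z. norm z > R \<Longrightarrow> \<theta> z = 0"
    using \<theta>(2) by blast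
  show "(\<lambda>z. \<theta> z * (1 - \<kappa> n z)) \<in> test_functions (- \<Gamma>)"
  proof (rule test_functionsI[where R=R and C="{z. 1 \<le> \<bar>strip n z\<bar>}"])
    show "smooth (\<lambda>z. \<theta> z * (1 - \<kappa> n z))"
      by (intro smooth_mult \<theta> smooth_diff smooth_const smooth_\<kappa>)
    show "closed {z. 1 \<le> \<bar>strip n z\<bar>}"
      by (intro closed_Collect_le continuous_intros smooth_continuous smooth_strip)
    show "norm z \<le> R \<and> z \<in> {z. 1 \<le> \<bar>strip n z\<bar>}" if "\<theta> z * (1 - \<kappa> n z) \<noteq> 0" for z
    proof -
      have "\<not> norm z > R" "\<not> \<bar>strip n z\<bar> \<le> 1"
        using that R[of z] \<eta>(1)[of "strip n z"] by (auto simp: \<kappa>_def)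
      then show ?thesis by simp
    qed
    show "{z. 1 \<le> \<bar>strip n z\<bar>} \<subseteq> - \<Gamma>"
    proof
      fix z assume "z \<in> {z. 1 \<le> \<bar>strip n z\<bar>}"
      then have "\<bar>snd z - F n (fst z)\<bar> \<ge> 2 * \<omega> n"
        using \<omega>_pos[of n] by (simp add: strip_def abs_mult field_simps)
      then have "snd z \<noteq> f (fst z)"
        using F_close[of n "fst z"] \<omega>_pos[of n] by auto
      then show "z \<in> - \<Gamma>"
        using assms(2) by auto
    qed
  qed
  have "((\<lambda>z. \<theta> z * (1 - \<kappa> n z)) has_derivative (\<lambda>v. \<theta> z * (0 - frechet_derivative (\<kappa> n) (at z) v)
      + frechet_derivative \<theta> (at z) v * (1 - \<kappa> n z))) (at z)"
    by (intro has_derivative_mult has_derivative_diff has_derivative_const smooth_has_derivative \<theta> smooth_\<kappa>)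
  then show "frechet_derivative (\<lambda>z. \<theta> z * (1 - \<kappa> n z)) (at z) v =
      (1 - \<kappa> n z) * frechet_derivative \<theta> (at z) v - \<theta> z * (\<kappa>' n z * (snd v - F' n (fst z) * fst v))"
    by (subst frechet_derivative_at[symmetric]) (auto simp: \<kappa>_frechet algebra_simps)
qed

lemma \<kappa>'_continuous: "continuous_on S (\<kappa>' n)"
  unfolding \<kappa>'_def
  by (intro continuous_intros continuous_on_compose2[OF smooth_continuous[OF smooth_deriv(1)[OF \<eta>_smooth]]]
     smooth_continuous smooth_strip) auto

lemma \<eta>'_support_integral: "\<bar>s\<bar> \<ge> 3 \<Longrightarrow> deriv \<eta> s = 0" "integrable lborel (deriv \<eta>)" "integral\<^sup>L
    lborel (deriv \<eta>) = 0"
proof -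
  have z: "deriv \<eta> s = 0" if "\<bar>s\<bar> \<ge> 3" for s
  proof -
    have "(\<eta> has_real_derivative 0) (at s)"
      by (rule has_field_derivative_transform_within_open[where S="{s. 2 < \<bar>s\<bar>}" and f="\<lambda>_. 0"])
        (use that in \<open>auto simp: \<eta> intro!: open_Collect_less continuous_intros\<close>)
    then show ?thesis
      by (rule DERIV_imp_deriv)
  qed
  then show "\<bar>s\<bar> \<ge> 3 \<Longrightarrow> deriv \<eta> s = 0" .
  have c: "continuous_on S (deriv \<eta>)" for S
    by (rule smooth_continuous[OF smooth_deriv(1)[OF \<eta>_smooth]])
  show "integrable lborel (deriv \<eta>)"
    using z by (intro continuous_bounded_support[where R=3] c) auto
  have "(\<integral>x. deriv \<eta> x * indicator {-3..3} x \<partial>lborel) = \<eta> 3 - \<eta> (-3)"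
    by (rule integral_FTC_Icc_real) (use smooth_deriv(2)[OF \<eta>_smooth] c[of UNIV] in
      \<open>auto simp: continuous_on_eq_continuous_at\<close>)
  moreover have "deriv \<eta> x * indicator {-3..3} x = deriv \<eta> x" for x
    using z[of x] by (cases "x \<in> {-3..3}") (auto simp: abs_if)
  ultimately show "integral\<^sup>L lborel (deriv \<eta>) = 0"
    by (simp add: \<eta>)
qed

text \<open>The functions \<open>\<kappa>' n\<close> have size \<open>1/\<omega> n\<close> on a strip of height \<open>\<omega> n\<close>, but on every vertical line their
  integral is zero. Hence they converge weakly to zero against continuous functions of
  compact support.\<close>

lemma integral_\<kappa>'_tendsto_0:
  fixes w :: "real \<times> real \<Rightarrow> real"
  assumes w: "continuous_on UNIV w" "\<And>z. norm z > R \<Longrightarrow> w z = 0"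
  shows "(\<lambda>n. \<integral>z. w z * \<kappa>' n z \<partial>lebesgue) \<longlonglongrightarrow> 0"
proof -
  obtain B where B: "B \<ge> 0" "\<And>z. \<bar>w z\<bar> \<le> B"
    using continuous_bounded_support(1)[OF w] by blast
  have c: "continuous_on UNIV (\<lambda>z. w z * \<kappa>' n z)" for n
    by (intro continuous_intros w \<kappa>'_continuous)
  have wm[measurable]: "w \<in> borel_measurable borel"
    by (rule borel_measurable_continuous_onI[OF w(1)])
  have Fm[measurable]: "F n \<in> borel_measurable borel" for n
    by (rule borel_measurable_continuous_onI[OF smooth_continuous[OF F_smooth]])
  have em[measurable]: "deriv \<eta> \<in> borel_measurable borel"
    by (rule borel_measurable_continuous_onI[OF smooth_continuous[OF smooth_deriv(1)[OF \<eta>_smooth]]])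
  have wc: "isCont w z" for z
    using w(1) continuous_on_eq_continuous_at[OF open_UNIV] by blast
  define I where "I n x = (\<integral>s. w (x, F n x + 2 * \<omega> n * s) * deriv \<eta> s \<partial>lborel)" for n x
  have eq: "(\<integral>z. w z * \<kappa>' n z \<partial>lebesgue) = (\<integral>x. I n x \<partial>lborel)" for n
  proof -
    have int: "integrable (lborel \<Otimes>\<^sub>M lborel) (\<lambda>z. w z * \<kappa>' n z)"
      unfolding lborel_prod by (rule continuous_bounded_support(2)[OF c]) (use w in auto)
    have "(\<integral>z. w z * \<kappa>' n z \<partial>lebesgue) = (\<integral>z. w z * \<kappa>' n z \<partial>lborel)"
      by (rule integral_completion) (use c in \<open>auto intro: borel_measurable_continuous_onI\<close>)
    also have "\<dots> = (\<integral>x. (\<integral>y. w (x, y) * \<kappa>' n (x, y) \<partial>lborel) \<partial>lborel)"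
      using lborel_pair.integral_fst'[OF int] by (simp add: lborel_prod)
    also have "(\<lambda>x. \<integral>y. w (x, y) * \<kappa>' n (x, y) \<partial>lborel) = I n"
    proof
      fix x
      show "(\<integral>y. w (x, y) * \<kappa>' n (x, y) \<partial>lborel) = I n x"
        \<comment> \<open>substitution of \<open>y = F n x + 2 \<omega> n s\<close>\<close>
        by (subst lborel_integral_real_affine[where c="2 * \<omega> n" and t="F n x"])
         (use \<omega>_pos[of n] in \<open>auto simp: I_def \<kappa>'_def strip_def abs_mult\<close>)
    qed
    finally show ?thesis .
  qed
  have lim: "(\<lambda>n. I n x) \<longlonglongrightarrow> 0" for x
  proof -
    have "(\<lambda>n. F n x - f x) \<longlonglongrightarrow> 0"
      by (rule Lim_null_comparison[OF _ \<omega>_lim]) (use F_close in auto)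
    then have F: "(\<lambda>n. F n x) \<longlonglongrightarrow> f x"
      by (simp add: LIM_zero_iff)
    have "(\<lambda>n. w (x, F n x + 2 * \<omega> n * s)) \<longlonglongrightarrow> w (x, f x + 2 * 0 * s)" for s
      by (rule isCont_tendsto_compose[OF wc]) (intro tendsto_intros F \<omega>_lim)
    then have l: "(\<lambda>n. w (x, F n x + 2 * \<omega> n * s)) \<longlonglongrightarrow> w (x, f x)" for s
      by simp
    have "(\<lambda>n. I n x) \<longlonglongrightarrow> (\<integral>s. w (x, f x) * deriv \<eta> s \<partial>lborel)"
      unfolding I_def
    proof (rule integral_dominated_convergence[where w="\<lambda>s. B * \<bar>deriv \<eta> s\<bar>"])
      show "integrable lborel (\<lambda>s. B * \<bar>deriv \<eta> s\<bar>)"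
        using \<eta>'_support_integral(2) by auto
      show "AE s in lborel. (\<lambda>n. w (x, F n x + 2 * \<omega> n * s) * deriv \<eta> s) \<longlonglongrightarrow> w (x, f x) * deriv \<eta> s"
        by (intro AE_I2 tendsto_intros l)
      show "AE s in lborel. norm (w (x, F n x + 2 * \<omega> n * s) * deriv \<eta> s) \<le> B * \<bar>deriv \<eta> s\<bar>" for n
        by (intro AE_I2) (auto simp: abs_mult intro!: mult_right_mono B)
    qed auto
    then show ?thesis
      by (simp add: \<eta>'_support_integral)
  qed
  define L where "L = (\<integral>s. \<bar>deriv \<eta> s\<bar> \<partial>lborel)"
  have bound: "norm (I n x) \<le> B * L * indicator {-R..R} x" for n x
  proof (cases "x \<in> {-R..R}")
    case True
    have "norm (I n x) \<le> (\<integral>s. norm (w (x, F n x + 2 * \<omega> n * s) * deriv \<eta> s) \<partial>lborel)"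
      unfolding I_def by (rule integral_norm_bound)
    also have "\<dots> \<le> (\<integral>s. B * \<bar>deriv \<eta> s\<bar> \<partial>lborel)"
      by (rule Bochner_Integration.integral_mono') (use \<eta>'_support_integral(2) B in \<open>auto simp:
          abs_mult intro!: mult_right_mono\<close>)
    finally show ?thesis
      using True by (simp add: L_def)
  next
    case False
    have "w (x, y) = 0" for y
      using norm_fst_le[of x y] False by (intro w) auto
    then show ?thesis
      using False by (simp add: I_def)
  qed
  have "(\<lambda>n. \<integral>x. I n x \<partial>lborel) \<longlonglongrightarrow> (\<integral>x. 0 \<partial>(lborel :: real measure))"
  proof (rule integral_dominated_convergence[where w="\<lambda>x. B * L * indicator {-R..R} x"])
    show "I n \<in> borel_measurable lborel" for n
      unfolding I_def by measurable
    show "integrable lborel (\<lambda>x. B * L * indicator {-R..R} x)"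
      by (intro integrable_mult_right integrable_real_indicator) (auto simp: emeasure_lborel_Icc_eq)
  qed (use lim bound in auto)
  then show ?thesis
    by (simp add: eq)
qed

text \<open>Removability for the vertical derivative needs continuity only: testing with \<open>\<theta> (1 - \<kappa> n)\<close> produces the
  error term \<open>\<integral> u \<theta> \<kappa>' n\<close>, which vanishes in the limit.\<close>

lemma weak_partial_vertical:
  assumes u: "continuous_on UNIV u" and g: "locally_Lp p g" "p \<ge> 1"
    and \<Gamma>: "\<Gamma> \<subseteq> {(x, f x) | x. True}" and wp: "weak_partial (- \<Gamma>) (0, 1) u g"
  shows "weak_partial UNIV (0, 1) u g"
  unfolding weak_partial_def
proof
  fix \<theta> :: "real \<times> real \<Rightarrow> real" assume \<theta>: "\<theta> \<in> test_functions UNIV"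
  note sm = test_functions_UNIV_D(1)[OF \<theta>]
  obtain R where R: "\<And>z. norm z > R \<Longrightarrow> \<theta> z = 0" "\<And>z v. norm z > R \<Longrightarrow> frechet_derivative \<theta> (at z) v = 0"
    using test_functions_UNIV_D(2)[OF \<theta>] by blast
  let ?D = "\<lambda>z. frechet_derivative \<theta> (at z) (0, 1)"
  obtain B where B: "\<And>z. \<bar>\<theta> z\<bar> \<le> B"
    using continuous_bounded_support(1)[OF smooth_continuous[OF sm] R(1)] by blast
  have iD: "integrable lebesgue (\<lambda>z. u z * ?D z)"
    using R by (intro continuous_bounded_support[where R=R] continuous_intros u smooth_continuous
        smooth_frechet sm) auto
  have ig: "integrable lebesgue (\<lambda>z. \<theta> z * g z)"
    by (rule integrable_mult_locally_Lp[OF g borel_measurable_continuous_onI[OF smooth_continuous[OF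
        sm]] B R(1)])
  have i\<kappa>: "integrable lebesgue (\<lambda>z. u z * \<theta> z * \<kappa>' n z)" for n
    using R by (intro continuous_bounded_support[where R=R] continuous_intros u smooth_continuous
        \<kappa>'_continuous sm) auto
  have eq: "(\<integral>z. (1 - \<kappa> n z) * (u z * ?D z) \<partial>lebesgue) - (\<integral>z. u z * \<theta> z * \<kappa>' n z \<partial>lebesgue)
      = - (\<integral>z. (1 - \<kappa> n z) * (\<theta> z * g z) \<partial>lebesgue)" for n
  proof -
    have "(\<integral>z. u z * frechet_derivative (\<lambda>z. \<theta> z * (1 - \<kappa> n z)) (at z) (0, 1) \<partial>lebesgue)
        = - (\<integral>z. (\<theta> z * (1 - \<kappa> n z)) * g z \<partial>lebesgue)"
      using wp cutoff_test_function(1)[OF \<theta> \<Gamma>, of n] by (auto simp: weak_partial_def)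
    then show ?thesis
      unfolding cutoff_test_function(2)[OF \<theta> \<Gamma>]
        Bochner_Integration.integral_diff[OF integral_1_minus_\<kappa>_tendsto(1)[OF iD] i\<kappa>, symmetric]
      by (simp add: algebra_simps)
  qed
  have "(\<lambda>n. (\<integral>z. (1 - \<kappa> n z) * (u z * ?D z) \<partial>lebesgue) - (\<integral>z. u z * \<theta> z * \<kappa>' n z \<partial>lebesgue))
     \<longlonglongrightarrow> (\<integral>z. u z * ?D z \<partial>lebesgue) - 0"
    using R by (intro tendsto_diff integral_1_minus_\<kappa>_tendsto iD integral_\<kappa>'_tendsto_0[where R=R]
        continuous_intros u smooth_continuous sm) auto
  moreover have "(\<lambda>n. - (\<integral>z. (1 - \<kappa> n z) * (\<theta> z * g z) \<partial>lebesgue)) \<longlonglongrightarrow> - (\<integral>z. \<theta> z * g z \<partial>lebesgue)"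
    by (intro tendsto_minus integral_1_minus_\<kappa>_tendsto ig)
  ultimately show "(\<integral>z. u z * ?D z \<partial>lebesgue) = - (\<integral>z. \<theta> z * g z \<partial>lebesgue)"
    unfolding eq using LIMSEQ_unique by fastforce
qed

lemma integral_\<kappa>_ball_le:
  assumes "R \<ge> 0"
  shows "(\<integral>z. \<kappa> n z * indicator (cball 0 R) z \<partial>lebesgue) \<le> 20 * R * \<omega> n"
proof -
  have km[measurable]: "\<kappa> n \<in> borel_measurable borel"
    by (rule \<kappa>_measurable)
  let ?h = "\<lambda>z. \<kappa> n z * indicator (cball 0 R) z"
  have hm: "?h \<in> borel_measurable lborel"
    using km by (intro borel_measurable_times borel_measurable_indicator) auto
  have "integrable lebesgue ?h"
    by (rule integral_\<kappa>_tendsto_0[OF cball_lborel_integrable])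
  then have "integrable lborel ?h"
    by (simp add: integrable_completion[OF hm])
  then have int: "integrable (lborel \<Otimes>\<^sub>M lborel) ?h"
    by (simp add: lborel_prod)
  have "(\<integral>z. ?h z \<partial>lebesgue) = (\<integral>z. ?h z \<partial>lborel)"
    by (rule integral_completion[OF hm])
  also have "\<dots> = (\<integral>x. (\<integral>y. ?h (x, y) \<partial>lborel) \<partial>lborel)"
    using lborel_pair.integral_fst'[OF int] by (simp add: lborel_prod)
  also have "\<dots> \<le> (\<integral>x. 10 * \<omega> n * indicator {-R..R} x \<partial>lborel)"
  proof (rule Bochner_Integration.integral_mono')
    show "integrable lborel (\<lambda>x. 10 * \<omega> n * indicator {-R..R} x)"
      by (intro integrable_mult_right integrable_real_indicator) (auto simp: emeasure_lborel_Icc_eq)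
    show "0 \<le> 10 * \<omega> n * indicator {-R..R} x" for x
      using \<omega>_pos[of n] by auto
    show "(\<integral>y. ?h (x, y) \<partial>lborel) \<le> 10 * \<omega> n * indicator {-R..R} x" for x
    proof (cases "x \<in> {-R..R}")
      case True
      have "(\<integral>y. ?h (x, y) \<partial>lborel) \<le> (\<integral>y. indicator {f x - 5 * \<omega> n..f x + 5 * \<omega> n} y \<partial>lborel)"
      proof (rule Bochner_Integration.integral_mono')
        show "?h (x, y) \<le> indicator {f x - 5 * \<omega> n..f x + 5 * \<omega> n} y" for y
          using \<kappa>_eq_0[of n "(x, y)"] \<kappa>_bounds[of n "(x, y)"]
          by (cases "\<bar>y - f x\<bar> > 5 * \<omega> n") (auto simp: indicator_def abs_le_iff)
        show "integrable lborel (indicator {f x - 5 * \<omega> n..f x + 5 * \<omega> n} :: real \<Rightarrow> real)"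
          by (intro integrable_real_indicator) (auto simp: emeasure_lborel_Icc_eq)
      qed auto
      also have "\<dots> = 10 * \<omega> n"
        using \<omega>_pos[of n] by simp
      finally show ?thesis using True by simp
    next
      case False
      have "(x, y) \<notin> cball 0 R" for y :: real
        using norm_fst_le[of x y] False by auto
      then show ?thesis using False by simp
    qed
  qed
  also have "\<dots> = 20 * R * \<omega> n"
    using assms by simp
  finally show ?thesis .
qed

text \<open>Removability for the horizontal derivative. The error term is now \<open>b n = \<integral> u \<theta> F' n \<kappa>' n\<close>, in which
  \<open>\<kappa>' n\<close> is a vertical derivative. The vertical identity for the test function \<open>\<theta> F' n \<kappa> n\<close> turns it
  into integrals of \<open>F' n \<kappa> n\<close> against \<open>\<theta> g2\<close> and \<open>u \<partial>\<^sub>2\<theta>\<close>. By Young's inequality these are at most a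
  constant times \<open>\<integral> \<kappa> n (\<bar>g2\<bar>\<^sup>p + 1)\<close>, taken over a ball, plus \<open>\<sigma> n\<^sup>q \<omega> n\<close>.\<close>

lemma weak_partial_horizontal:
  assumes u: "continuous_on UNIV u" and g1: "locally_Lp p g1" and g2: "locally_Lp p g2"
    and p: "p > 1" "1 / p + 1 / q = 1" and lim: "(\<lambda>n. \<sigma> n powr q * \<omega> n) \<longlonglongrightarrow> 0"
    and \<Gamma>: "\<Gamma> \<subseteq> {(x, f x) | x. True}"
    and wp1: "weak_partial (- \<Gamma>) (1, 0) u g1" and wp2: "weak_partial (- \<Gamma>) (0, 1) u g2"
  shows "weak_partial UNIV (1, 0) u g1"
  unfolding weak_partial_def
proof
  fix \<theta> :: "real \<times> real \<Rightarrow> real" assume \<theta>: "\<theta> \<in> test_functions UNIV"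
  note sm = test_functions_UNIV_D(1)[OF \<theta>]
  obtain R where R: "R \<ge> 0" "\<And>z. norm z > R \<Longrightarrow> \<theta> z = 0" "\<And>z v. norm z > R \<Longrightarrow> frechet_derivative \<theta> (at
      z) v = 0"
    using test_functions_UNIV_D(2)[OF \<theta>] by blast
  have p1: "p \<ge> 1"
    using p by simp
  note q = conjugate_exponent_gt_1[OF p]
  let ?D = "\<lambda>z. frechet_derivative \<theta> (at z) (1, 0)"
  let ?E = "\<lambda>z. frechet_derivative \<theta> (at z) (0, 1)"
  have F'c: "continuous_on UNIV (\<lambda>z::real\<times>real. F' n (fst z))" for n
    by (intro continuous_on_compose2[OF smooth_continuous[OF F'_smooth]] continuous_intros) auto
  have cD: "continuous_on UNIV ?D" and cE: "continuous_on UNIV ?E" and c\<theta>: "continuous_on UNIV \<theta>"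
    and c\<kappa>: "continuous_on UNIV (\<kappa> n)" for n
    by (intro smooth_continuous smooth_frechet sm smooth_\<kappa>)+
  obtain B1 where B1: "\<And>z. \<bar>\<theta> z\<bar> \<le> B1"
    using continuous_bounded_support(1)[OF c\<theta> R(2)] by blast
  have cuE: "continuous_on UNIV (\<lambda>z. u z * ?E z)"
    by (intro continuous_intros u cE)
  obtain B2 where B2: "\<And>z. \<bar>u z * ?E z\<bar> \<le> B2"
    using continuous_bounded_support(1)[OF cuE, of R] R(3) by (metis mult_zero_right)
  define B where "B = max B1 B2"
  have B: "\<bar>\<theta> z\<bar> \<le> B" "\<bar>u z * ?E z\<bar> \<le> B" for z
    using B1[of z] B2[of z] by (auto simp: B_def)
  have iD: "integrable lebesgue (\<lambda>z. u z * ?D z)"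
    using R by (intro continuous_bounded_support[where R=R] continuous_intros u cD) auto
  have ig1: "integrable lebesgue (\<lambda>z. \<theta> z * g1 z)"
    by (rule integrable_mult_locally_Lp[OF g1 p1 borel_measurable_continuous_onI[OF c\<theta>] B(1) R(2)])
  define b where "b n = (\<integral>z. u z * \<theta> z * (\<kappa>' n z * F' n (fst z)) \<partial>lebesgue)" for n
  have ib: "integrable lebesgue (\<lambda>z. u z * \<theta> z * (\<kappa>' n z * F' n (fst z)))" for n
    using R by (intro continuous_bounded_support[where R=R] continuous_intros u c\<theta> \<kappa>'_continuous F'c) auto
  have eq: "(\<integral>z. (1 - \<kappa> n z) * (u z * ?D z) \<partial>lebesgue) + b n
      = - (\<integral>z. (1 - \<kappa> n z) * (\<theta> z * g1 z) \<partial>lebesgue)" for n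
  proof -
    have "(\<integral>z. u z * frechet_derivative (\<lambda>z. \<theta> z * (1 - \<kappa> n z)) (at z) (1, 0) \<partial>lebesgue)
        = - (\<integral>z. (\<theta> z * (1 - \<kappa> n z)) * g1 z \<partial>lebesgue)"
      using wp1 cutoff_test_function(1)[OF \<theta> \<Gamma>, of n] by (auto simp: weak_partial_def)
    then show ?thesis
      unfolding cutoff_test_function(2)[OF \<theta> \<Gamma>] b_def
        Bochner_Integration.integral_add[OF integral_1_minus_\<kappa>_tendsto(1)[OF iD] ib, symmetric]
      by (simp add: algebra_simps)
  qed
  define H where "H z = indicator (cball 0 R) z * \<bar>g2 z\<bar> powr p + indicator (cball 0 R) z" for z
  have iH: "integrable lebesgue H"
    unfolding H_def using g2 by (intro Bochner_Integration.integrable_add cball_lborel_integrable)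
        (auto simp: locally_Lp_def)
  note wp = weak_partial_vertical[OF u g2 p1 \<Gamma> wp2]
  have b: "\<bar>b n\<bar> \<le> B * (\<integral>z. \<kappa> n z * H z \<partial>lebesgue) + B * (2 * (20 * R * (\<sigma> n powr q * \<omega> n)))" for n
  proof -
    let ?\<Theta> = "\<lambda>z. \<theta> z * (F' n (fst z) * \<kappa> n z)"
    have s: "smooth (\<lambda>z::real\<times>real. F' n (fst z))"
      by (rule smooth_compose[OF F'_smooth smooth_linear[OF bounded_linear_fst]])
    then have s\<Theta>: "smooth ?\<Theta>"
      by (intro smooth_mult sm smooth_\<kappa>)
    have t: "?\<Theta> \<in> test_functions UNIV"
      by (rule test_functionsI[where R=R and C=UNIV, OF s\<Theta>]) (use R(2) not_less in auto)
    have "((\<lambda>z. F' n (fst z)) has_derivative (\<lambda>v. deriv (F' n) (fst z) * fst v)) (at z)" for z ::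
        "real \<times> real"
      using has_derivative_compose[OF bounded_linear_imp_has_derivative[OF bounded_linear_fst]
        smooth_deriv(2)[OF F'_smooth, unfolded has_field_derivative_def], of n z] by simp
    then have d2: "(?\<Theta> has_derivative (\<lambda>v. \<theta> z * (F' n (fst z) * frechet_derivative (\<kappa> n) (at z) v
         + deriv (F' n) (fst z) * fst v * \<kappa> n z)
         + frechet_derivative \<theta> (at z) v * (F' n (fst z) * \<kappa> n z))) (at z)" for z
      by (intro has_derivative_mult smooth_has_derivative sm smooth_\<kappa>)
    have dt: "frechet_derivative ?\<Theta> (at z) (0, 1) = F' n (fst z) * (?E z * \<kappa> n z + \<theta> z * \<kappa>' n z)" for z
      by (simp add: frechet_derivative_at[OF d2, symmetric] \<kappa>_frechet algebra_simps)
    have "(\<integral>z. u z * frechet_derivative ?\<Theta> (at z) (0, 1) \<partial>lebesgue) = - (\<integral>z. ?\<Theta> z * g2 z \<partial>lebesgue)"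
      using wp t by (auto simp: weak_partial_def)
    moreover have i1: "integrable lebesgue (\<lambda>z. \<kappa> n z * (F' n (fst z) * (u z * ?E z)))"
      using R by (intro continuous_bounded_support[where R=R] continuous_intros cuE c\<kappa> F'c) auto
    have "(\<integral>z. u z * frechet_derivative ?\<Theta> (at z) (0, 1) \<partial>lebesgue)
       = (\<integral>z. \<kappa> n z * (F' n (fst z) * (u z * ?E z)) \<partial>lebesgue) + b n"
      unfolding b_def dt Bochner_Integration.integral_add[OF i1 ib, symmetric]
      by (simp add: algebra_simps)
    moreover have ig2: "integrable lebesgue (\<lambda>z. ?\<Theta> z * g2 z)"
    proof -
      have c: "continuous_on UNIV ?\<Theta>"
        by (rule smooth_continuous[OF s\<Theta>])
      obtain B' where B': "\<And>z. \<bar>?\<Theta> z\<bar> \<le> B'"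
        using continuous_bounded_support(1)[OF c, of R] R(2) by (metis mult_zero_left)
      show ?thesis
        by (rule integrable_mult_locally_Lp[OF g2 p1 borel_measurable_continuous_onI[OF c] B', where
            R=R]) (use R(2) in auto)
    qed
    ultimately have "b n = - (\<integral>z. ?\<Theta> z * g2 z + \<kappa> n z * (F' n (fst z) * (u z * ?E z)) \<partial>lebesgue)"
      using Bochner_Integration.integral_add[OF ig2 i1] by simp
    then have "\<bar>b n\<bar> = norm (\<integral>z. ?\<Theta> z * g2 z + \<kappa> n z * (F' n (fst z) * (u z * ?E z)) \<partial>lebesgue)"
      by simp
    also have "\<dots> \<le> (\<integral>z. norm (?\<Theta> z * g2 z + \<kappa> n z * (F' n (fst z) * (u z * ?E z))) \<partial>lebesgue)"
      by (rule integral_norm_bound)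
    also have "\<dots> \<le> (\<integral>z. B * (\<kappa> n z * H z) + B * (2 * \<sigma> n powr q) * (\<kappa> n z * indicator (cball 0 R) z)
        \<partial>lebesgue)"
    proof (rule Bochner_Integration.integral_mono')
      show "integrable lebesgue (\<lambda>z. B * (\<kappa> n z * H z) + B * (2 * \<sigma> n powr q) * (\<kappa> n z * indicator
          (cball 0 R) z))"
        by (intro Bochner_Integration.integrable_add integrable_mult_right integral_\<kappa>_tendsto_0(1)
            iH cball_lborel_integrable)
      fix z
      have B0: "B \<ge> 0"
        using B(1)[of z] by linarith
      show "0 \<le> B * (\<kappa> n z * H z) + B * (2 * \<sigma> n powr q) * (\<kappa> n z * indicator (cball 0 R) z)"
        using B0 \<kappa>_bounds[of n z] by (auto simp: H_def)
      show "norm (?\<Theta> z * g2 z + \<kappa> n z * (F' n (fst z) * (u z * ?E z)))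
        \<le> B * (\<kappa> n z * H z) + B * (2 * \<sigma> n powr q) * (\<kappa> n z * indicator (cball 0 R) z)"
      proof (cases "norm z > R")
        case True
        then show ?thesis using R by (simp add: H_def)
      next
        case False
        have sg: "\<sigma> n \<ge> 0"
          using F'_bound[of n 0] by linarith
        have young: "\<sigma> n * a \<le> \<sigma> n powr q + a powr p" if "a \<ge> 0" for a
        proof -
          have "a * \<sigma> n \<le> a powr p / p + \<sigma> n powr q / q"
            by (rule Youngs_inequality) (use that sg p q in auto)
          also have "\<dots> \<le> a powr p / 1 + \<sigma> n powr q / 1"
            using p q by (intro add_mono divide_left_mono) auto
          finally show ?thesis by (simp add: mult.commute)
        qed
        have "?\<Theta> z * g2 z + \<kappa> n z * (F' n (fst z) * (u z * ?E z))
           = \<kappa> n z * F' n (fst z) * (\<theta> z * g2 z + u z * ?E z)"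
          by (simp add: algebra_simps)
        then have "norm (?\<Theta> z * g2 z + \<kappa> n z * (F' n (fst z) * (u z * ?E z)))
           = \<kappa> n z * \<bar>F' n (fst z)\<bar> * \<bar>\<theta> z * g2 z + u z * ?E z\<bar>"
          using \<kappa>_bounds[of n z] by (simp only: real_norm_def abs_mult abs_of_nonneg)
        also have "\<dots> \<le> \<kappa> n z * \<sigma> n * (B * \<bar>g2 z\<bar> + B)"
        proof (intro mult_mono order_trans[OF abs_triangle_ineq] add_mono B)
          show "\<bar>\<theta> z * g2 z\<bar> \<le> B * \<bar>g2 z\<bar>"
            unfolding abs_mult by (intro mult_right_mono B) auto
        qed (use \<kappa>_bounds[of n z] F'_bound[of n "fst z"] sg in auto)
        also have "\<dots> = \<kappa> n z * B * (\<sigma> n * \<bar>g2 z\<bar> + \<sigma> n * 1)"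
          by (simp add: algebra_simps)
        also have "\<dots> \<le> \<kappa> n z * B * ((\<sigma> n powr q + \<bar>g2 z\<bar> powr p) + (\<sigma> n powr q + 1 powr p))"
          using \<kappa>_bounds[of n z] B0 by (intro mult_left_mono add_mono young) auto
        also have "\<dots> = B * (\<kappa> n z * H z) + B * (2 * \<sigma> n powr q) * (\<kappa> n z * indicator (cball 0 R) z)"
          using False by (simp add: H_def algebra_simps)
        finally show ?thesis .
      qed
    qed
    also have "\<dots> = B * (\<integral>z. \<kappa> n z * H z \<partial>lebesgue) + B * (2 * \<sigma> n powr q) * (\<integral>z. \<kappa> n z * indicator
        (cball 0 R) z \<partial>lebesgue)"
      by (subst Bochner_Integration.integral_add)
        (intro integrable_mult_right integral_\<kappa>_tendsto_0(1) iH cball_lborel_integrable,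
         intro integrable_mult_right integral_\<kappa>_tendsto_0(1) iH cball_lborel_integrable, simp)
    also have "\<dots> \<le> B * (\<integral>z. \<kappa> n z * H z \<partial>lebesgue) + B * (2 * \<sigma> n powr q) * (20 * R * \<omega> n)"
      using B(1)[of 0] by (intro add_left_mono mult_left_mono integral_\<kappa>_ball_le R) auto
    finally show ?thesis
      by (simp add: algebra_simps)
  qed
  have "(\<lambda>n. B * (\<integral>z. \<kappa> n z * H z \<partial>lebesgue) + B * (2 * (20 * R * (\<sigma> n powr q * \<omega> n)))) \<longlonglongrightarrow> B * 0 + B
      * (2 * (20 * R * 0))"
    by (intro tendsto_intros integral_\<kappa>_tendsto_0 iH lim)
  then have "b \<longlonglongrightarrow> 0"
    by (intro Lim_null_comparison[of b, OF always_eventually])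
      (simp_all only: real_norm_def b mult_zero_right add_0_right simp_thms)
  then have "(\<lambda>n. (\<integral>z. (1 - \<kappa> n z) * (u z * ?D z) \<partial>lebesgue) + b n) \<longlonglongrightarrow> (\<integral>z. u z * ?D z \<partial>lebesgue) + 0"
    by (intro tendsto_add integral_1_minus_\<kappa>_tendsto iD)
  moreover have "(\<lambda>n. - (\<integral>z. (1 - \<kappa> n z) * (\<theta> z * g1 z) \<partial>lebesgue)) \<longlonglongrightarrow> - (\<integral>z. \<theta> z * g1 z \<partial>lebesgue)"
    by (intro tendsto_minus integral_1_minus_\<kappa>_tendsto ig1)
  ultimately show "(\<integral>z. u z * ?D z \<partial>lebesgue) = - (\<integral>z. \<theta> z * g1 z \<partial>lebesgue)"
    unfolding eq using LIMSEQ_unique by fastforce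
qed

end

section \<open>Removable graphs\<close>

text \<open>The modulus of continuity of \<open>f\<close> on the unit interval is fine enough: there are scales \<open>\<delta>\<close> at which the
  oscillation is at most \<open>w\<close>, such that \<open>w\<close> and \<open>(w / \<delta>)\<^sup>q w\<close> are arbitrarily small. Both integrability of
  \<open>(t / h\<^sup>-\<^sup>1 t)\<^sup>q\<close> and a Hoelder exponent above \<open>q / (1 + q)\<close> imply this.\<close>

definition fine_modulus :: "real \<Rightarrow> (real \<Rightarrow> real) \<Rightarrow> bool" where
  "fine_modulus q f \<longleftrightarrow> (\<forall>e>0. \<exists>\<delta> w. 0 < \<delta> \<and> \<delta> \<le> 1 \<and> 0 < w \<and> w < e \<and> (w / \<delta>) powr q * w < e \<and>
     (\<forall>x\<in>{0..1}. \<forall>y\<in>{0..1}. \<bar>x - y\<bar> \<le> \<delta> \<longrightarrow> \<bar>f x - f y\<bar> \<le> w))"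

lemma fine_modulus_continuous:
  assumes "fine_modulus q f"
  shows "continuous_on {0..1} f"
  unfolding continuous_on_iff
proof (intro ballI allI impI)
  fix x e :: real assume "x \<in> {0..1}" "e > 0"
  with assms obtain \<delta> w where "0 < \<delta>" "w < e"
      "\<forall>x\<in>{0..1}. \<forall>y\<in>{0..1}. \<bar>x - y\<bar> \<le> \<delta> \<longrightarrow> \<bar>f x - f y\<bar> \<le> w"
    unfolding fine_modulus_def by metis
  with \<open>x \<in> {0..1}\<close> show "\<exists>d>0. \<forall>x'\<in>{0..1}. dist x' x < d \<longrightarrow> dist (f x') (f x) < e"
    by (intro exI[of _ \<delta>]) (force simp: dist_real_def)
qed

text \<open>With the interpolant of mesh about \<open>\<delta>\<close>, the approximation error is about \<open>w\<close> and the slope about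
  \<open>w / \<delta>\<close>, so \<open>weak_partial_vertical\<close> and \<open>weak_partial_horizontal\<close> apply along a sequence of scales.\<close>

lemma weak_partial_across_graph:
  assumes p: "p > 1" "1 / p + 1 / q = 1" and fm: "fine_modulus q f"
    and u: "continuous_on UNIV u" and g1: "locally_Lp p g1" and g2: "locally_Lp p g2"
    and wp1: "weak_partial (- unit_graph f) (1, 0) u g1"
    and wp2: "weak_partial (- unit_graph f) (0, 1) u g2"
  shows "weak_partial UNIV (1, 0) u g1" "weak_partial UNIV (0, 1) u g2"
proof -
  note q = conjugate_exponent_gt_1[OF p]
  obtain M where M: "M \<ge> 0" and MI: "\<forall>(f::real \<Rightarrow> real) (N::nat) \<omega>. N > 0 \<longrightarrow>
     (\<forall>x\<in>{0..1}. \<forall>y\<in>{0..1}. \<bar>x - y\<bar> \<le> 1 / N \<longrightarrow> \<bar>f x - f y\<bar> \<le> \<omega>) \<longrightarrow>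
     (\<exists>F F'. smooth F \<and> (\<forall>x. (F has_real_derivative F' x) (at x)) \<and>
        (\<forall>x. \<bar>F x - f (clamp01 x)\<bar> \<le> 2 * \<omega>) \<and> (\<forall>x. \<bar>F' x\<bar> \<le> M * N * \<omega>))"
    using smooth_interpolation by blast
  have "\<exists>F F' w s. smooth F \<and> (\<forall>x. (F has_real_derivative F' x) (at x)) \<and>
        (\<forall>x. \<bar>F x - f (clamp01 x)\<bar> \<le> 2 * w) \<and> (\<forall>x. \<bar>F' x\<bar> \<le> s) \<and> 0 < w \<and> w < 1 / Suc n \<and>
        0 \<le> s \<and> s powr q * (2 * w) \<le> (2 * M) powr q * 2 * (1 / Suc n)" for n
  proof -
    obtain \<delta> w where d: "0 < \<delta>" "\<delta> \<le> 1" "0 < w" "w < 1 / Suc n" "(w / \<delta>) powr q * w < 1 / Suc n"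
      "\<forall>x\<in>{0..1}. \<forall>y\<in>{0..1}. \<bar>x - y\<bar> \<le> \<delta> \<longrightarrow> \<bar>f x - f y\<bar> \<le> w"
      using fm[unfolded fine_modulus_def, rule_format, of "1 / Suc n"] by auto
    define N where "N = nat \<lceil>1 / \<delta>\<rceil>"
    have "1 / \<delta> \<le> N" "N \<le> 1 / \<delta> + 1"
      using d(1) unfolding N_def by (auto simp: real_nat_ceiling_ge intro: less_imp_le)
    moreover have "1 \<le> 1 / \<delta>"
      using d by simp
    ultimately have N: "N > 0" "N \<le> 2 / \<delta>" and "1 / \<delta> \<le> N"
      by linarith+
    from this have N': "1 / N \<le> \<delta>"
      using d(1) by (simp add: field_simps)
    have "\<forall>x\<in>{0..1}. \<forall>y\<in>{0..1}. \<bar>x - y\<bar> \<le> 1 / N \<longrightarrow> \<bar>f x - f y\<bar> \<le> w"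
      using d(6) N' by (meson order_trans)
    then have "\<exists>F F'. smooth F \<and> (\<forall>x. (F has_real_derivative F' x) (at x)) \<and>
        (\<forall>x. \<bar>F x - f (clamp01 x)\<bar> \<le> 2 * w) \<and> (\<forall>x. \<bar>F' x\<bar> \<le> M * N * w)"
      by (intro MI[THEN spec, THEN spec, THEN spec, THEN mp, THEN mp]) (use N(1) in auto)
    then obtain F F' where F: "smooth F" "\<forall>x. (F has_real_derivative F' x) (at x)"
        "\<forall>x. \<bar>F x - f (clamp01 x)\<bar> \<le> 2 * w" "\<forall>x. \<bar>F' x\<bar> \<le> M * N * w"
      by blast
    have "M * N * w \<le> 2 * M * (w / \<delta>)"
    proof -
      have "M * w * N \<le> M * w * (2 / \<delta>)"
        using M d N by (intro mult_left_mono) auto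
      then show ?thesis by (simp add: algebra_simps)
    qed
    then have "(M * N * w) powr q * (2 * w) \<le> (2 * M * (w / \<delta>)) powr q * (2 * w)"
      using M d q by (intro mult_right_mono powr_mono2) auto
    also have "\<dots> = (2 * M) powr q * 2 * ((w / \<delta>) powr q * w)"
      by (subst powr_mult) (use M d in auto)
    also have "\<dots> \<le> (2 * M) powr q * 2 * (1 / Suc n)"
      using d(5) by (intro mult_left_mono) auto
    finally show ?thesis
      using F d M by (intro exI[of _ F] exI[of _ F'] exI[of _ w] exI[of _ "M * N * w"]) auto
  qed
  then obtain F F' w s where F: "\<And>n. smooth (F n)" "\<And>n x. (F n has_real_derivative F' n x) (at x)"
        "\<And>n x. \<bar>F n x - f (clamp01 x)\<bar> \<le> 2 * w n" "\<And>n x. \<bar>F' n x\<bar> \<le> s n"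
     and w: "\<And>n. 0 < w n" "\<And>n. w n < 1 / Suc n"
     and s: "\<And>n. s n powr q * (2 * w n) \<le> (2 * M) powr q * 2 * (1 / Suc n)"
    by metis
  obtain \<eta> :: "real \<Rightarrow> real" where \<eta>: "smooth \<eta>" "\<And>s. \<bar>s\<bar> \<le> 1 \<Longrightarrow> \<eta> s = 1" "\<And>s. \<bar>s\<bar> \<ge> 2 \<Longrightarrow> \<eta> s = 0" "\<And>s.
      0 \<le> \<eta> s" "\<And>s. \<eta> s \<le> (1::real)"
    by (rule smooth_bump) blast
  have wl: "w \<longlonglongrightarrow> 0"
    by (rule Lim_null_comparison[OF _ LIMSEQ_inverse_real_of_nat])
      (use w in \<open>auto intro!: always_eventually less_imp_le simp: abs_of_pos inverse_eq_divide\<close>)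
  interpret graph_cutoff "\<lambda>x. f (clamp01 x)" F F' "\<lambda>n. 2 * w n" s \<eta>
  proof
    show "continuous_on UNIV (\<lambda>x. f (clamp01 x))"
      unfolding clamp01_def
      by (rule continuous_on_compose2[OF fine_modulus_continuous[OF fm]]) (auto intro!: continuous_intros)
    show "(\<lambda>n. 2 * w n) \<longlonglongrightarrow> 0"
      using tendsto_mult_right_zero[OF wl] .
  qed (use F w \<eta> in auto)
  have \<Gamma>: "unit_graph f \<subseteq> {(x, f (clamp01 x)) |x. True}"
    by (auto simp: unit_graph_def clamp01_def intro!: exI)
  have lim: "(\<lambda>n. s n powr q * (2 * w n)) \<longlonglongrightarrow> 0"
  proof (rule Lim_null_comparison)
    show "\<forall>\<^sub>F n in sequentially. norm (s n powr q * (2 * w n)) \<le> (2 * M) powr q * 2 * (inverse (Suc n))"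
      using s w by (intro always_eventually) (auto simp: abs_mult abs_of_pos inverse_eq_divide)
    show "(\<lambda>n. (2 * M) powr q * 2 * (inverse (Suc n))) \<longlonglongrightarrow> 0"
      by (intro tendsto_mult_right_zero LIMSEQ_inverse_real_of_nat)
  qed
  show "weak_partial UNIV (1, 0) u g1"
    by (rule weak_partial_horizontal[OF u g1 g2 p lim \<Gamma> wp1 wp2])
  show "weak_partial UNIV (0, 1) u g2"
    by (rule weak_partial_vertical[OF u g2 _ \<Gamma> wp2]) (use p in simp)
qed

lemma unit_graph_compact_null:
  assumes "continuous_on {0..1} f"
  shows "compact (unit_graph f)" "unit_graph f \<in> null_sets lborel"
proof -
  have "unit_graph f = (\<lambda>x. (x, f x)) ` {0..1}"
    by (auto simp: unit_graph_def)
  then show c: "compact (unit_graph f)"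
    using assms by (auto intro!: compact_continuous_image continuous_intros)
  have "continuous_on UNIV (\<lambda>x. f (clamp01 x))"
    unfolding clamp01_def
    by (rule continuous_on_compose2[OF assms]) (auto intro!: continuous_intros)
  from graph_null[OF this] have "AE z in lborel. z \<notin> unit_graph f"
    by eventually_elim (auto simp: unit_graph_def clamp01_def)
  then show "unit_graph f \<in> null_sets lborel"
    using compact_imp_closed[OF c] by (subst AE_iff_null_sets) auto
qed

text \<open>The weak derivatives off the graph, extended by zero, are weak derivatives on the plane; the graph
  being null, no integral changes.\<close>

lemma W1p_removable_unit_graph:
  assumes p: "p > 1" "1 / p + 1 / q = 1" and fm: "fine_modulus q f"
  shows "W1p_removable p (unit_graph f)"
  unfolding W1p_removable_def
proof (intro conjI allI impI)
  note G = unit_graph_compact_null[OF fine_modulus_continuous[OF fm]]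
  show "compact (unit_graph f)"
    by (rule G)
  let ?O = "- unit_graph f"
  have O: "?O \<in> sets lebesgue" "open ?O"
    using compact_imp_closed[OF G(1)] by (auto simp: open_Compl)
  have ae: "AE z in lebesgue. z \<in> ?O"
    using AE_not_in[OF G(2)] by (simp add: AE_completion_iff)
  fix u :: "real \<times> real \<Rightarrow> real" assume u: "continuous_on UNIV u" and W: "u \<in> W1p p ?O"
  have um: "u \<in> borel_measurable lebesgue"
    by (rule borel_measurable_lebesgueI[OF borel_measurable_continuous_onI[OF u]])
  have int: "integrable lebesgue h" if "integrable (lebesgue_on ?O) h" "h \<in> borel_measurable lebesgue"
    for h :: "real \<times> real \<Rightarrow> real"
  proof -
    have "integrable lebesgue (\<lambda>z. indicator ?O z *\<^sub>R h z)"
      using that O by (simp add: integrable_restrict_space)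
    then show ?thesis
      by (rule Bochner_Integration.integrable_cong_AE_imp[OF _ that(2)])
        (use ae in eventually_elim, auto)
  qed
  have LI: "(LINT z|lebesgue_on ?O. h z) = (LINT z|lebesgue. h z)" if "h \<in> borel_measurable lebesgue"
    for h :: "real \<times> real \<Rightarrow> real"
  proof -
    have "(LINT z|lebesgue_on ?O. h z) = (LINT z|lebesgue. indicator ?O z *\<^sub>R h z)"
      using O by (simp add: integral_restrict_space)
    also have "\<dots> = (LINT z|lebesgue. h z)"
    proof (rule integral_cong_AE)
      show "(\<lambda>z. indicator ?O z *\<^sub>R h z) \<in> borel_measurable lebesgue"
        by (intro borel_measurable_scaleR borel_measurable_indicator O that)
      show "AE z in lebesgue. indicator ?O z *\<^sub>R h z = h z"
        using ae by eventually_elim simp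
    qed (rule that)
    finally show ?thesis .
  qed
  have Lp: "u \<in> Lp p UNIV"
    using W um unfolding W1p_def Lp_def lebesgue_on_UNIV_eq by (auto intro!: int)
  have ex: "\<exists>g. locally_Lp p g \<and> g \<in> Lp p UNIV \<and> weak_partial ?O b u g" if "b \<in> Basis" for b
  proof -
    obtain g where g: "g \<in> Lp p ?O" "\<forall>\<psi>\<in>test_functions ?O.
      (LINT x|lebesgue_on ?O. u x * frechet_derivative \<psi> (at x) b)
        = - (LINT x|lebesgue_on ?O. \<psi> x * g x)"
      using W \<open>b \<in> Basis\<close> unfolding W1p_def by blast
    define g' where "g' z = (if z \<in> ?O then g z else 0)" for z
    have m: "g' \<in> borel_measurable lebesgue"
      using borel_measurable_if_I[OF _ O(1), of g] g(1) by (simp add: Lp_def g'_def[abs_def])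
    have "integrable (lebesgue_on ?O) (\<lambda>z. \<bar>g' z\<bar> powr p)"
      using g(1) by (subst Bochner_Integration.integrable_cong[OF refl, where g="\<lambda>z. \<bar>g z\<bar> powr p"])
        (auto simp: Lp_def g'_def)
    then have i: "integrable lebesgue (\<lambda>z. \<bar>g' z\<bar> powr p)"
      by (rule int) (use m in measurable)
    have "integrable lebesgue (\<lambda>z. indicator (cball 0 R) z *\<^sub>R \<bar>g' z\<bar> powr p)" for R
      by (rule integrable_mult_indicator[OF _ i]) auto
    then have "locally_Lp p g'"
      using m by (simp add: locally_Lp_def)
    moreover have "g' \<in> Lp p UNIV"
      using m i by (simp add: Lp_def lebesgue_on_UNIV_eq)
    moreover have "weak_partial ?O b u g'"
      unfolding weak_partial_def
    proof
      fix \<psi> assume \<psi>: "\<psi> \<in> test_functions ?O"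
      then have sm: "smooth \<psi>"
        by (auto simp: test_functions_def smooth_def)
      have \<psi>m: "\<psi> \<in> borel_measurable lebesgue"
        by (rule borel_measurable_lebesgueI[OF borel_measurable_continuous_onI[OF
            smooth_continuous[OF sm]]])
      have "(LINT x|lebesgue. u x * frechet_derivative \<psi> (at x) b) = (LINT x|lebesgue_on ?O. u x *
          frechet_derivative \<psi> (at x) b)"
        by (rule LI[symmetric], rule borel_measurable_lebesgueI, rule borel_measurable_continuous_onI)
          (intro continuous_intros u smooth_continuous smooth_frechet sm)
      also have "\<dots> = - (LINT x|lebesgue_on ?O. \<psi> x * g x)"
        using g(2) \<psi> by blast
      also have "(LINT x|lebesgue_on ?O. \<psi> x * g x) = (LINT x|lebesgue_on ?O. \<psi> x * g' x)"
        by (rule Bochner_Integration.integral_cong) (auto simp: g'_def)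
      also have "\<dots> = (LINT x|lebesgue. \<psi> x * g' x)"
        by (rule LI) (use \<psi>m m in measurable)
      finally show "(LINT x|lebesgue. u x * frechet_derivative \<psi> (at x) b) = - (LINT x|lebesgue. \<psi> x
          * g' x)" .
    qed
    ultimately show ?thesis by blast
  qed
  obtain g1 where g1: "locally_Lp p g1" "g1 \<in> Lp p UNIV" "weak_partial ?O (1, 0) u g1"
    using ex[of "(1, 0)"] by (auto simp: Basis_prod_def)
  obtain g2 where g2: "locally_Lp p g2" "g2 \<in> Lp p UNIV" "weak_partial ?O (0, 1) u g2"
    using ex[of "(0, 1)"] by (auto simp: Basis_prod_def)
  note wp = weak_partial_across_graph[OF p fm u g1(1) g2(1) g1(3) g2(3)]
  show "u \<in> W1p p UNIV"
    unfolding W1p_def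
  proof (intro CollectI conjI Lp ballI)
    fix b :: "real \<times> real" assume "b \<in> Basis"
    then consider "b = (1, 0)" | "b = (0, 1)"
      by (auto simp: Basis_prod_def)
    then show "\<exists>g\<in>Lp p UNIV. \<forall>\<psi>\<in>test_functions UNIV.
      (LINT x|lebesgue_on UNIV. u x * frechet_derivative \<psi> (at x) b) = - (LINT x|lebesgue_on UNIV. \<psi>
          x * g x)"
      using wp g1(2) g2(2) unfolding weak_partial_def lebesgue_on_UNIV_eq by cases blast+
  qed
qed

section \<open>Moduli of continuity\<close>

lemma fine_modulus_Holder:
  assumes q: "0 < q" "q < \<alpha> * (1 + q)"
    and f: "\<And>x y. x \<in> {0..1} \<Longrightarrow> y \<in> {0..1} \<Longrightarrow> \<bar>f x - f y\<bar> \<le> C * \<bar>x - y\<bar> powr \<alpha>"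
  shows "fine_modulus q f"
  unfolding fine_modulus_def
proof (intro allI impI)
  fix e :: real assume e: "e > 0"
  define D where "D = max C 1"
  have D: "D > 0" "C \<le> D"
    by (auto simp: D_def)
  have "0 < \<alpha> * (1 + q)"
    using q by linarith
  then have \<alpha>: "0 < \<alpha>"
    using q by (simp add: zero_less_mult_iff)
  have exponent: "0 < (\<alpha> - 1) * q + \<alpha>"
    using q by (simp add: algebra_simps)
  have id: "((\<lambda>\<delta>::real. \<delta>) \<longlongrightarrow> 0) (at_right 0)"
    by (rule tendsto_ident_at)
  have z: "((\<lambda>\<delta>::real. \<delta> powr c) \<longlongrightarrow> 0) (at_right 0)" if "c > 0" for c
    by (rule tendsto_zero_powrI[OF id tendsto_const _ that]) (simp add: eventually_at_filter)
  have "((\<lambda>\<delta>. D * \<delta> powr \<alpha>) \<longlongrightarrow> 0) (at_right 0)"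
    by (rule tendsto_mult_right_zero[OF z[OF \<alpha>]])
  then have 1: "\<forall>\<^sub>F \<delta> in at_right 0. D * \<delta> powr \<alpha> < e"
    by (rule order_tendstoD) (rule e)
  have "((\<lambda>\<delta>. D powr q * D * \<delta> powr ((\<alpha> - 1) * q + \<alpha>)) \<longlongrightarrow> 0) (at_right 0)"
    by (rule tendsto_mult_right_zero[OF z[OF exponent]])
  then have 2: "\<forall>\<^sub>F \<delta> in at_right 0. D powr q * D * \<delta> powr ((\<alpha> - 1) * q + \<alpha>) < e"
    by (rule order_tendstoD) (rule e)
  have 3: "\<forall>\<^sub>F \<delta> in at_right 0. 0 < \<delta> \<and> \<delta> < (1::real)"
    by (auto simp: eventually_at_right[of 0 1] intro: exI[of _ 1])
  obtain \<delta> where \<delta>: "D * \<delta> powr \<alpha> < e" "D powr q * D * \<delta> powr ((\<alpha> - 1) * q + \<alpha>) < e" "0 < \<delta>" "\<delta> < 1"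
    using eventually_happens'[OF _ eventually_conj[OF 1 eventually_conj[OF 2 3]]] by auto
  let ?w = "D * \<delta> powr \<alpha>"
  have "(?w / \<delta>) powr q * ?w = (D * \<delta> powr (\<alpha> - 1)) powr q * ?w"
    using \<delta> by (simp add: powr_diff)
  also have "\<dots> = D powr q * D * \<delta> powr ((\<alpha> - 1) * q + \<alpha>)"
    using \<delta> D by (simp add: powr_mult powr_powr powr_add)
  also have "\<dots> < e"
    by (rule \<delta>)
  finally have "(?w / \<delta>) powr q * ?w < e" .
  moreover have "\<bar>f x - f y\<bar> \<le> ?w" if "x \<in> {0..1}" "y \<in> {0..1}" "\<bar>x - y\<bar> \<le> \<delta>" for x y
  proof -
    have "C * \<bar>x - y\<bar> powr \<alpha> \<le> D * \<delta> powr \<alpha>"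
      using D that \<alpha> by (intro mult_mono powr_mono2) auto
    with f[OF that(1,2)] show ?thesis by linarith
  qed
  ultimately show "\<exists>\<delta> w. 0 < \<delta> \<and> \<delta> \<le> 1 \<and> 0 < w \<and> w < e \<and> (w / \<delta>) powr q * w < e \<and>
     (\<forall>x\<in>{0..1}. \<forall>y\<in>{0..1}. \<bar>x - y\<bar> \<le> \<delta> \<longrightarrow> \<bar>f x - f y\<bar> \<le> w)"
    using \<delta> D by (intro exI[of _ \<delta>] exI[of _ ?w]) auto
qed

lemma nn_integral_reciprocal_eq_top:
  assumes "0 < t" "0 < c"
  shows "(\<integral>\<^sup>+x\<in>{0<..t}. ennreal (c / x) \<partial>lborel) = \<infinity>"
proof (rule ccontr)
  assume "(\<integral>\<^sup>+x\<in>{0<..t}. ennreal (c / x) \<partial>lborel) \<noteq> \<infinity>"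
  then obtain K where K: "(\<integral>\<^sup>+x\<in>{0<..t}. ennreal (c / x) \<partial>lborel) = ennreal K" "K \<ge> 0"
    using ennreal_cases by (metis infinity_ennreal_def)
  define a where "a = t * exp (- ((K + 1) / c))"
  have a: "0 < a" "a \<le> t"
    using assms K by (auto simp: a_def)
  have "(\<integral>\<^sup>+x. ennreal (c / x) * indicator {a..t} x \<partial>lborel) = ennreal (c * ln t - c * ln a)"
    by (rule nn_integral_FTC_Icc) (use a assms in \<open>auto intro!: derivative_eq_intros\<close>)
  also have "c * ln t - c * ln a = K + 1"
  proof -
    have "ln a = ln t - (K + 1) / c"
      using assms by (simp add: a_def ln_mult)
    then show ?thesis
      using assms by (simp add: right_diff_distrib)
  qed
  finally have "ennreal (K + 1) = (\<integral>\<^sup>+x. ennreal (c / x) * indicator {a..t} x \<partial>lborel)"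
    by simp
  also have "\<dots> \<le> (\<integral>\<^sup>+x\<in>{0<..t}. ennreal (c / x) \<partial>lborel)"
    using a by (intro nn_integral_mono) (auto simp: indicator_def)
  finally have "ennreal (K + 1) \<le> ennreal K"
    using K by simp
  then show False
    using K by simp
qed

lemma homeomorphism_half_line_mono:
  fixes h k :: "real \<Rightarrow> real"
  assumes hom: "homeomorphism {0..} {0..} h k" and h0: "h 0 = 0" and xy: "0 \<le> x" "x \<le> y"
  shows "h x \<le> h y"
proof (rule ccontr)
  assume c: "\<not> h x \<le> h y"
  have h: "continuous_on {0..} h" "\<And>x. x \<ge> 0 \<Longrightarrow> h x \<ge> 0" "\<And>x. x \<ge> 0 \<Longrightarrow> k (h x) = x"
    using hom by (auto simp: homeomorphism_def)
  have "\<exists>z. 0 \<le> z \<and> z \<le> x \<and> h z = h y"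
    by (rule IVT') (use c xy h h0 in \<open>auto intro: continuous_on_subset\<close>)
  then obtain z where z: "0 \<le> z" "z \<le> x" "h z = h y" by blast
  have "k (h z) = z" "k (h y) = y"
    using h(3) z(1) xy by auto
  then have "z = y"
    unfolding z(3) by simp
  then have "x = y"
    using z xy by simp
  then show False
    using c by simp
qed

text \<open>If \<open>(t / h\<^sup>-\<^sup>1 t)\<^sup>q t \<ge> e\<close> for all small \<open>t\<close>, then the integrand dominates \<open>e / t\<close> near zero and the
  integral diverges. Hence the required smallness holds at \<open>w = t\<close> and \<open>\<delta> = h\<^sup>-\<^sup>1 t\<close> for suitable \<open>t\<close>.\<close>

lemma fine_modulus_homeomorphism:
  fixes h k :: "real \<Rightarrow> real"
  assumes hom: "homeomorphism {0..} {0..} h k" and h0: "h 0 = 0" and q: "0 < q"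
    and fin: "(\<integral>\<^sup>+t\<in>{0..1}. ennreal ((t / k t) powr q) \<partial>lebesgue) < \<infinity>"
    and f: "\<And>x y. x \<in> {0..1} \<Longrightarrow> y \<in> {0..1} \<Longrightarrow> \<bar>f x - f y\<bar> \<le> h \<bar>x - y\<bar>"
  shows "fine_modulus q f"
  unfolding fine_modulus_def
proof (intro allI impI)
  fix e :: real assume e: "e > 0"
  have k: "continuous_on {0..} k" "\<And>x. x \<ge> 0 \<Longrightarrow> k x \<ge> 0" "\<And>x. x \<ge> 0 \<Longrightarrow> h (k x) = x"
    and k0: "k 0 = 0"
    using hom h0 unfolding homeomorphism_def by (auto, metis atLeast_iff order_refl)
  have kpos: "k t > 0" if "t > 0" for t
    using k(2,3)[of t] h0 that by (cases "k t = 0") auto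
  obtain d where d: "d > 0" "\<And>t. t \<ge> 0 \<Longrightarrow> t < d \<Longrightarrow> k t < 1"
  proof -
    obtain d where "d > 0" "\<forall>t\<in>{0..}. dist t 0 < d \<longrightarrow> dist (k t) (k 0) < 1"
      using k(1)[unfolded continuous_on_iff, rule_format, of 0 1] by auto
    then show ?thesis
      using k0 by (intro that[of d]) (auto simp: dist_real_def)
  qed
  define t0 where "t0 = min (min (d / 2) (e / 2)) 1"
  have t0: "0 < t0" "t0 < d" "t0 < e" "t0 \<le> 1"
    using d e by (auto simp: t0_def)
  have "\<exists>t. 0 < t \<and> t \<le> t0 \<and> (t / k t) powr q * t < e"
  proof (rule ccontr)
    assume "\<not> ?thesis"
    then have ge: "e / t \<le> (t / k t) powr q" if "0 < t" "t \<le> t0" for t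
      using that by (force simp: field_simps)
    have "\<infinity> = (\<integral>\<^sup>+x\<in>{0<..t0}. ennreal (e / x) \<partial>lborel)"
      using nn_integral_reciprocal_eq_top[OF t0(1) e] by simp
    also have "\<dots> = (\<integral>\<^sup>+x\<in>{0<..t0}. ennreal (e / x) \<partial>lebesgue)"
      by (rule nn_integral_completion[symmetric])
    also have "\<dots> \<le> (\<integral>\<^sup>+t\<in>{0..1}. ennreal ((t / k t) powr q) \<partial>lebesgue)"
      using ge t0 by (intro nn_integral_mono) (auto simp: indicator_def intro!: ennreal_leI)
    finally show False
      using fin by auto
  qed
  then obtain t where t: "0 < t" "t \<le> t0" "(t / k t) powr q * t < e"
    by blast
  have "\<bar>f x - f y\<bar> \<le> t" if "x \<in> {0..1}" "y \<in> {0..1}" "\<bar>x - y\<bar> \<le> k t" for x y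
    using f[OF that(1,2)] homeomorphism_half_line_mono[OF hom h0 _ that(3)] k(3)[of t] t(1) by simp
  then show "\<exists>\<delta> w. 0 < \<delta> \<and> \<delta> \<le> 1 \<and> 0 < w \<and> w < e \<and> (w / \<delta>) powr q * w < e \<and>
     (\<forall>x\<in>{0..1}. \<forall>y\<in>{0..1}. \<bar>x - y\<bar> \<le> \<delta> \<longrightarrow> \<bar>f x - f y\<bar> \<le> w)"
    using t t0 d(2)[of t] kpos[of t] by (intro exI[of _ "k t"] exI[of _ t]) auto
qed

section \<open>Absolutely continuous functions on intervals\<close>

lemma sum_content_division_le_measure:
  fixes D :: "real set set"
  assumes D: "D division_of \<Union>D" and U: "\<Union>D \<subseteq> U" "U \<in> lmeasurable"
  shows "(\<Sum>I\<in>D. measure lborel I) \<le> measure lebesgue U"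
proof -
  have "compact (\<Union>D)"
    using division_ofD(1,4)[OF D] by (metis compact_Union compact_cbox)
  then have m: "\<Union>D \<in> lmeasurable"
    by (rule lmeasurable_compact)
  have "(\<Sum>I\<in>D. measure lborel I) = (\<Sum>I\<in>D. integral I (\<lambda>x. 1))"
  proof (rule sum.cong[OF refl])
    fix I assume "I \<in> D"
    then obtain a b where "I = cbox a b"
      using D by (meson cbox_division_memE)
    then show "measure lborel I = integral I (\<lambda>x. 1)"
      by simp
  qed
  also have "\<dots> = integral (\<Union>D) (\<lambda>x. 1)"
    by (rule integral_combine_division_topdown[symmetric, OF integrable_on_const[OF m] D])
  also have "\<dots> = measure lebesgue (\<Union>D)"
    using lmeasure_integral[OF m] by simp
  also have "\<dots> \<le> measure lebesgue U"
    using U m by (intro measure_mono_fmeasurable) auto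
  finally show ?thesis .
qed

text \<open>A gauge proof. At tags off the null set \<open>N\<close> the derivative controls the increments; the intervals
  with tags in \<open>N\<close> lie in an open set of small measure, and absolute continuity makes their total
  increment small.\<close>

lemma fundamental_theorem_abs_continuous:
  fixes w w' :: "real \<Rightarrow> real"
  assumes ab: "a \<le> b" and ac: "abs_continuous_on {a..b} w"
    and N: "N \<in> null_sets lebesgue"
    and deriv: "\<And>x. x \<in> {a..b} \<Longrightarrow> x \<notin> N \<Longrightarrow> (w has_real_derivative w' x) (at x)"
  shows "(w' has_integral (w b - w a)) {a..b}"
proof -
  define v where "v x = (if x \<in> N then 0 else w' x)" for x
  have "(v has_integral (w b - w a)) {a..b}"
    unfolding has_integral_real
  proof (intro allI impI)
    fix e :: real assume e: "e > 0"
    obtain \<delta> where \<delta>: "\<delta> > 0" "\<And>D. D division_of (\<Union>D) \<Longrightarrow> \<Union>D \<subseteq> {a..b} \<Longrightarrow>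
        (\<Sum>I\<in>D. measure lborel I) < \<delta> \<Longrightarrow> (\<Sum>I\<in>D. dist (w (Inf I)) (w (Sup I))) < e / 2"
      using ac[unfolded abs_continuous_on_def, rule_format, of "e / 2"] e by auto
    obtain U where U: "open U" "N \<subseteq> U" "emeasure lebesgue (U - N) < ennreal \<delta>" "U - N \<in> lmeasurable"
      using sets_lebesgue_outer_open[of N \<delta>] N \<delta>(1) by (metis null_setsD2)
    have Nm: "N \<in> lmeasurable" "measure lebesgue N = 0"
      using N by (auto simp: fmeasurable_def null_setsD1 null_setsD2 measure_eq_0_null_sets)
    have Ueq: "U = (U - N) \<union> N"
      using U by auto
    have Um: "U \<in> lmeasurable"
      by (subst Ueq) (intro fmeasurable.Un U Nm)
    have "measure lebesgue U \<le> measure lebesgue (U - N) + measure lebesgue N"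
      by (subst Ueq) (rule measure_Un_le, use U Nm in auto)
    moreover have "measure lebesgue (U - N) < \<delta>"
      using U(3,4) \<delta>(1) by (simp add: emeasure_eq_measure2 ennreal_less_iff)
    ultimately have U\<delta>: "measure lebesgue U < \<delta>"
      using Nm by simp
    define e' where "e' = e / (2 * (b - a + 1))"
    have e': "e' > 0"
      using e ab by (auto simp: e'_def)
    have "\<exists>d>0. \<forall>y. \<bar>y - x\<bar> < d \<longrightarrow> \<bar>w y - w x - w' x * (y - x)\<bar> \<le> e' * \<bar>y - x\<bar>"
      if "x \<in> {a..b}" "x \<notin> N" for x
    proof -
      have "(w has_derivative (*) (w' x)) (at x)"
        using deriv[OF that] by (simp add: has_field_derivative_def)
      then show ?thesis
        using e' unfolding has_derivative_at_alt by (auto simp: real_norm_def)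
    qed
    then obtain d where d: "\<And>x. x \<in> {a..b} \<Longrightarrow> x \<notin> N \<Longrightarrow> d x > 0"
       "\<And>x y. x \<in> {a..b} \<Longrightarrow> x \<notin> N \<Longrightarrow> \<bar>y - x\<bar> < d x \<Longrightarrow> \<bar>w y - w x - w' x * (y - x)\<bar> \<le> e' * \<bar>y - x\<bar>"
      by metis
    define \<gamma> where "\<gamma> x = (if x \<in> N then U else if x \<in> {a..b} then ball x (d x) else UNIV)" for x
    have g: "gauge \<gamma>"
      unfolding gauge_def \<gamma>_def using U d(1) by auto
    have big: "norm ((\<Sum>(x, k)\<in>P. measure lborel k *\<^sub>R v x) - (w b - w a)) < e"
      if P: "P tagged_division_of {a..b}" "\<gamma> fine P" for P
    proof -
      note PD = tagged_division_ofD[OF P(1)]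
      define \<Phi> where "\<Phi> = (\<lambda>(x, K). measure lborel K *\<^sub>R v x - (w (Sup K) - w (Inf K)))"
      define PN where "PN = {z \<in> P. fst z \<in> N}"
      have fin: "finite P" "finite PN" "PN \<subseteq> P"
        using PD(1) by (auto simp: PN_def)
      have "(\<Sum>(x, k)\<in>P. measure lborel k *\<^sub>R v x) - (w b - w a) = (\<Sum>z\<in>P. \<Phi> z)"
        using additive_tagged_division_1[OF ab P(1), of w]
        by (simp add: \<Phi>_def split_beta sum_subtractf)
      also have "\<dots> = (\<Sum>z\<in>P - PN. \<Phi> z) + (\<Sum>z\<in>PN. \<Phi> z)"
        by (rule sum.subset_diff) (use fin in auto)
      finally have eq: "(\<Sum>(x, k)\<in>P. measure lborel k *\<^sub>R v x) - (w b - w a) = (\<Sum>z\<in>P - PN. \<Phi> z) +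
          (\<Sum>z\<in>PN. \<Phi> z)" .
      have "\<bar>\<Sum>z\<in>P - PN. \<Phi> z\<bar> \<le> (\<Sum>z\<in>P - PN. e' * measure lborel (snd z))"
      proof (rule order_trans[OF sum_abs sum_mono])
        fix z assume z: "z \<in> P - PN"
        obtain x K where xK: "z = (x, K)" by (cases z)
        obtain l u where lu: "K = {l..u}"
          using PD(4)[of x K] z xK by auto
        have x: "x \<in> K" "K \<subseteq> {a..b}" "x \<notin> N"
          using PD(2,3)[of x K] z xK by (auto simp: PN_def)
        then have xab: "x \<in> {a..b}" by auto
        have "K \<subseteq> ball x (d x)"
          using P(2) z xK x xab unfolding fine_def \<gamma>_def by fastforce
        moreover have "l \<in> K" "u \<in> K" and lxu: "l \<le> x" "x \<le> u"
          using x lu by auto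
        ultimately have "\<bar>l - x\<bar> < d x" "\<bar>u - x\<bar> < d x"
          by (auto simp: dist_real_def subset_iff abs_minus_commute)
        then have "\<bar>w l - w x - w' x * (l - x)\<bar> \<le> e' * (x - l)" "\<bar>w u - w x - w' x * (u - x)\<bar> \<le> e' *
            (u - x)"
          using d(2)[OF xab x(3), of l] d(2)[OF xab x(3), of u] lxu by auto
        then have "\<bar>(w u - w l) - w' x * (u - l)\<bar> \<le> e' * (u - l)"
          by (simp add: algebra_simps abs_le_iff)
        then show "\<bar>\<Phi> z\<bar> \<le> e' * measure lborel (snd z)"
          using x lu xK lxu by (simp add: \<Phi>_def v_def abs_minus_commute mult.commute)
      qed
      also have "\<dots> \<le> (\<Sum>z\<in>P. e' * measure lborel (snd z))"
        using e' fin by (intro sum_mono2) auto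
      also have "\<dots> = e' * (b - a)"
        using additive_content_tagged_division[of P a b] P(1) ab
        by (simp add: split_beta flip: sum_distrib_left)
      also have "\<dots> < e / 2"
        using e ab by (simp add: e'_def field_simps)
      finally have 1: "\<bar>\<Sum>z\<in>P - PN. \<Phi> z\<bar> < e / 2" .
      have tp: "PN tagged_partial_division_of {a..b}"
        using tagged_partial_division_subset[OF _ fin(3)] P(1) by (auto simp: tagged_division_of_def)
      have div: "snd ` PN division_of \<Union>(snd ` PN)"
        by (rule partial_division_of_tagged_division[OF tp])
      have ne: "(x, {}) \<notin> P" for x
        using PD(2)[of x "{}"] by auto
      have "\<bar>\<Sum>z\<in>PN. \<Phi> z\<bar> \<le> (\<Sum>z\<in>PN. \<bar>\<Phi> z\<bar>)"
        by (rule sum_abs)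
      also have "\<dots> = (\<Sum>(x, K)\<in>PN. if K = {} then 0 else dist (w (Inf K)) (w (Sup K)))"
        by (rule sum.cong) (auto simp: PN_def \<Phi>_def v_def dist_real_def ne)
      also have "\<dots> = (\<Sum>K\<in>snd ` PN. if K = {} then 0 else dist (w (Inf K)) (w (Sup K)))"
      proof (rule sum.over_tagged_division_lemma[OF tagged_partial_division_of_Union_self[OF tp]])
        fix l u :: real assume "box l u = {}"
        then have "u \<le> l" by (simp add: box_eq_empty)
        then show "(if cbox l u = {} then 0 else dist (w (Inf (cbox l u))) (w (Sup (cbox l u)))) = 0"
          by (cases "u = l") auto
      qed
      also have "\<dots> \<le> (\<Sum>K\<in>snd ` PN. dist (w (Inf K)) (w (Sup K)))"
        by (rule sum_mono) auto
      also have "\<dots> < e / 2"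
      proof (rule \<delta>(2)[OF div])
        show "\<Union>(snd ` PN) \<subseteq> {a..b}"
          using PD(3) fin(3) by fastforce
        have "\<Union>(snd ` PN) \<subseteq> U"
          using P(2) unfolding fine_def \<gamma>_def PN_def by fastforce
        from sum_content_division_le_measure[OF div this Um] U\<delta>
        show "(\<Sum>I\<in>snd ` PN. measure lborel I) < \<delta>" by linarith
      qed
      finally show ?thesis
        unfolding eq using 1 by auto
    qed
    show "\<exists>\<gamma>. gauge \<gamma> \<and> (\<forall>\<D>. \<D> tagged_division_of {a..b} \<and> \<gamma> fine \<D> \<longrightarrow>
        norm ((\<Sum>(x, k)\<in>\<D>. measure lborel k *\<^sub>R v x) - (w b - w a)) < e)"
      by (intro exI[of _ \<gamma>] conjI allI impI g big) auto
  qed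
  moreover have "negligible N"
    using N by (simp add: negligible_iff_null_sets)
  ultimately show ?thesis
    by (rule has_integral_spike[rotated 2]) (auto simp: v_def)
qed

lemma abs_continuous_on_mult:
  fixes u \<psi> :: "real \<Rightarrow> real"
  assumes u: "abs_continuous_on {a..b} u" and ub: "\<And>x. x \<in> {a..b} \<Longrightarrow> \<bar>u x\<bar> \<le> A"
    and \<psi>: "\<And>x. x \<in> {a..b} \<Longrightarrow> \<bar>\<psi> x\<bar> \<le> B" "\<And>x y. x \<in> {a..b} \<Longrightarrow> y \<in> {a..b} \<Longrightarrow> \<bar>\<psi> x - \<psi> y\<bar> \<le> L * \<bar>x - y\<bar>"
    and nonneg: "0 \<le> A" "0 \<le> B" "0 \<le> L"
  shows "abs_continuous_on {a..b} (\<lambda>x. u x * \<psi> x)"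
  unfolding abs_continuous_on_def
proof (intro allI impI)
  fix e :: real assume e: "e > 0"
  define e1 where "e1 = e / (2 * (B + 1))"
  define d1 where "d1 = e / (2 * (A * L + 1))"
  have AL: "A * L \<ge> 0"
    using nonneg by simp
  have pos: "e1 > 0" "d1 > 0"
    using e nonneg(2) AL add_nonneg_pos[OF AL zero_less_one]
    by (auto simp: e1_def d1_def simp del: distrib_left_numeral)
  obtain \<delta> where \<delta>: "\<delta> > 0" "\<And>D. D division_of (\<Union>D) \<Longrightarrow> \<Union>D \<subseteq> {a..b} \<Longrightarrow>
      (\<Sum>I\<in>D. measure lborel I) < \<delta> \<Longrightarrow> (\<Sum>I\<in>D. dist (u (Inf I)) (u (Sup I))) < e1"
    using u[unfolded abs_continuous_on_def, rule_format, OF pos(1)] by blast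
  show "\<exists>\<delta>>0. \<forall>D. D division_of (\<Union>D) \<longrightarrow> \<Union>D \<subseteq> {a..b} \<longrightarrow> (\<Sum>I\<in>D. measure lborel I) < \<delta> \<longrightarrow>
        (\<Sum>I\<in>D. dist (u (Inf I) * \<psi> (Inf I)) (u (Sup I) * \<psi> (Sup I))) < e"
  proof (intro exI[of _ "min \<delta> d1"] conjI allI impI)
    show "0 < min \<delta> d1"
      using \<delta>(1) pos by simp
    fix D assume D: "D division_of (\<Union>D)" "\<Union>D \<subseteq> {a..b}" "(\<Sum>I\<in>D. measure lborel I) < min \<delta> d1"
    have "(\<Sum>I\<in>D. dist (u (Inf I) * \<psi> (Inf I)) (u (Sup I) * \<psi> (Sup I)))
       \<le> (\<Sum>I\<in>D. B * dist (u (Inf I)) (u (Sup I)) + A * L * measure lborel I)"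
    proof (rule sum_mono)
      fix I assume I: "I \<in> D"
      then obtain l r where lr: "I = {l..r}" "l \<le> r"
        using division_ofD(3,4)[OF D(1) I] by fastforce
      have "{l..r} \<subseteq> {a..b}"
        using order_trans[OF Union_upper[OF I] D(2)] lr by simp
      then have mem: "l \<in> {a..b}" "r \<in> {a..b}"
        using lr by auto
      have "u l * \<psi> l - u r * \<psi> r = (u l - u r) * \<psi> l + u r * (\<psi> l - \<psi> r)"
        by (simp add: algebra_simps)
      then have "\<bar>u l * \<psi> l - u r * \<psi> r\<bar> \<le> \<bar>u l - u r\<bar> * \<bar>\<psi> l\<bar> + \<bar>u r\<bar> * \<bar>\<psi> l - \<psi> r\<bar>"
        by (metis abs_mult abs_triangle_ineq)
      also have "\<dots> \<le> \<bar>u l - u r\<bar> * B + A * (L * \<bar>l - r\<bar>)"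
        using mem nonneg by (intro add_mono mult_mono ub \<psi>) auto
      finally show "dist (u (Inf I) * \<psi> (Inf I)) (u (Sup I) * \<psi> (Sup I))
          \<le> B * dist (u (Inf I)) (u (Sup I)) + A * L * measure lborel I"
        using lr by (simp add: dist_real_def algebra_simps)
    qed
    also have "\<dots> = B * (\<Sum>I\<in>D. dist (u (Inf I)) (u (Sup I))) + A * L * (\<Sum>I\<in>D. measure lborel I)"
      by (simp add: sum.distrib sum_distrib_left)
    also have "\<dots> \<le> B * e1 + A * L * d1"
      using \<delta>(2)[OF D(1,2)] D(3) nonneg AL by (intro add_mono mult_left_mono) auto
    also have "\<dots> < (B + 1) * e1 + (A * L + 1) * d1"
      using pos by (simp add: algebra_simps)
    also have "\<dots> = e"
    proof -
      have nz: "B + 1 \<noteq> 0" "A * L + 1 \<noteq> 0"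
        using nonneg(2) AL by linarith+
      have half: "c * (e / (2 * c)) = e / 2" if "c \<noteq> 0" for c
        using that by simp
      show ?thesis
        unfolding e1_def d1_def half[OF nz(1)] half[OF nz(2)] by simp
    qed
    finally show "(\<Sum>I\<in>D. dist (u (Inf I) * \<psi> (Inf I)) (u (Sup I) * \<psi> (Sup I))) < e" .
  qed
qed

section \<open>Absolute continuity on lines implies weak differentiability\<close>

lemma deriv_zero_off_closed:
  fixes \<phi> :: "real \<Rightarrow> real"
  assumes "closed K" "\<And>x. x \<notin> K \<Longrightarrow> \<phi> x = 0" "(\<phi> has_real_derivative D) (at x)" "x \<notin> K"
  shows "D = 0"
proof -
  have "(\<phi> has_real_derivative 0) (at x)"
    by (rule has_field_derivative_transform_within_open[where S="- K" and f="\<lambda>_. 0"])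
      (use assms in \<open>auto simp: open_Compl\<close>)
  with assms(3) show ?thesis
    by (rule DERIV_unique)
qed

text \<open>The product \<open>v \<phi>\<close> is absolutely continuous near every point of the support \<open>K\<close> of \<open>\<phi>\<close> and zero near every
  other point; by bisection the fundamental theorem holds for it on all intervals.\<close>

lemma line_integral_product_derivative:
  fixes v \<phi> v' \<phi>' :: "real \<Rightarrow> real"
  assumes ac: "\<And>a b. {a..b} \<subseteq> \<Omega> \<Longrightarrow> abs_continuous_on {a..b} v"
    and v: "continuous_on UNIV v" and \<Omega>: "open \<Omega>" and K: "compact K" "K \<subseteq> \<Omega>"
    and \<phi>: "\<And>x. x \<notin> K \<Longrightarrow> \<phi> x = 0" "\<And>x. (\<phi> has_real_derivative \<phi>' x) (at x)" "continuous_on UNIV \<phi>'"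
    and N: "N \<in> null_sets lebesgue" and v': "\<And>x. x \<in> \<Omega> \<Longrightarrow> x \<notin> N \<Longrightarrow> (v has_real_derivative v' x) (at x)"
  shows "((\<lambda>x. v x * \<phi>' x + \<phi> x * v' x) has_integral 0) UNIV"
proof -
  let ?G = "\<lambda>x. v x * \<phi>' x + \<phi> x * v' x" and ?w = "\<lambda>x. v x * \<phi> x"
  have \<phi>'0: "\<phi>' x = 0" if "x \<notin> K" for x
    by (rule deriv_zero_off_closed[OF compact_imp_closed[OF K(1)] \<phi>(1,2) that])
  have \<phi>c: "continuous_on UNIV \<phi>"
    using \<phi>(2) by (intro continuous_at_imp_continuous_on ballI DERIV_isCont) auto
  obtain R0 where R0: "\<And>x. x \<in> K \<Longrightarrow> norm x \<le> R0"
    using compact_imp_bounded[OF K(1)] by (auto simp: bounded_iff)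
  define R where "R = max (R0 + 1) 1"
  have R: "norm x < R" if "x \<in> K" for x
    using R0[of x] that by (auto simp: R_def)
  have out: "\<phi> x = 0" "\<phi>' x = 0" if "norm x \<ge> R" for x
  proof -
    have "x \<notin> K"
      using R[of x] that by auto
    then show "\<phi> x = 0" "\<phi>' x = 0"
      by (simp_all add: \<phi>(1) \<phi>'0)
  qed
  obtain L where L: "L \<ge> 0" "\<And>x. \<bar>\<phi>' x\<bar> \<le> L"
    using continuous_bounded_support(1)[OF \<phi>(3) out(2)[OF less_imp_le]] by blast
  obtain B where B: "B \<ge> 0" "\<And>x. \<bar>\<phi> x\<bar> \<le> B"
    using continuous_bounded_support(1)[OF \<phi>c out(1)[OF less_imp_le]] by blast
  have Lip: "\<bar>\<phi> x - \<phi> y\<bar> \<le> L * \<bar>x - y\<bar>" for x y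
    using field_differentiable_bound[of UNIV \<phi> \<phi>' L x y] \<phi>(2) L by auto
  have R_pos: "R > 0"
    by (simp add: R_def)
  then have "-R \<le> R"
    by simp
  then have "-R \<le> R \<longrightarrow> (?G has_integral (?w R - ?w (-R))) {-R..R}"
  proof (rule Bolzano)
    fix a b c :: real
    assume "a \<le> b \<longrightarrow> (?G has_integral (?w b - ?w a)) {a..b}" "b \<le> c \<longrightarrow> (?G has_integral (?w c - ?w b)) {b..c}"
       and le: "a \<le> b" "b \<le> c"
    then have "(?G has_integral (?w b - ?w a) + (?w c - ?w b)) {a..c}"
      by (intro has_integral_combine[OF le]) auto
    then show "a \<le> c \<longrightarrow> (?G has_integral (?w c - ?w a)) {a..c}"
      by simp
  next
    fix x :: real
    show "\<exists>d>0. \<forall>a b. a \<le> x \<and> x \<le> b \<and> b - a < d \<longrightarrow> a \<le> b \<longrightarrow> (?G has_integral (?w b - ?w a)) {a..b}"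
    proof (cases "x \<in> K")
      case True
      then obtain d where d: "d > 0" "ball x d \<subseteq> \<Omega>"
        using K \<Omega> by (meson open_contains_ball subsetD)
      have "(?G has_integral (?w b - ?w a)) {a..b}" if ab: "a \<le> x" "x \<le> b" "b - a < d" for a b
      proof (rule fundamental_theorem_abs_continuous[OF _ _ N])
        show "a \<le> b" using ab by simp
        have sub: "{a..b} \<subseteq> \<Omega>"
          using ab d(2) by (force simp: dist_real_def)
        have "compact (v ` {a..b})"
          by (intro compact_continuous_image continuous_on_subset[OF v]) auto
        from compact_imp_bounded[OF this] obtain A where "\<forall>y\<in>v ` {a..b}. norm y \<le> A"
          unfolding bounded_iff by blast
        then have A: "\<bar>v x\<bar> \<le> A" if "x \<in> {a..b}" for x
          using that by simp
        moreover have "A \<ge> 0"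
          using A[of a] ab by auto
        ultimately show "abs_continuous_on {a..b} ?w"
          using Lip L B by (intro abs_continuous_on_mult[where A=A and B=B and L=L] ac sub) auto
        show "(?w has_real_derivative ?G x) (at x)" if "x \<in> {a..b}" "x \<notin> N" for x
          using DERIV_mult[OF v'[of x] \<phi>(2)[of x]] sub that by (auto simp: algebra_simps)
      qed
      with d(1) show ?thesis by blast
    next
      case False
      then obtain d where d: "d > 0" "ball x d \<subseteq> - K"
        using compact_imp_closed[OF K(1)] by (meson open_contains_ball open_Compl ComplI)
      have "(?G has_integral (?w b - ?w a)) {a..b}" if ab: "a \<le> x" "x \<le> b" "b - a < d" for a b
      proof -
        have sub: "y \<notin> K" if "y \<in> {a..b}" for y
          using ab d(2) that by (force simp: dist_real_def)
        then have "(?G has_integral 0) {a..b}"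
          by (intro has_integral_is_0) (simp add: \<phi>(1) \<phi>'0)
        moreover have "\<phi> a = 0" "\<phi> b = 0"
          using sub[of a] sub[of b] ab by (auto simp: \<phi>(1))
        ultimately show ?thesis by simp
      qed
      with d(1) show ?thesis by blast
    qed
  qed
  with R_pos out[of R] out[of "-R"] have "(?G has_integral 0) {-R..R}"
    by auto
  then show ?thesis
    by (rule has_integral_on_superset) (use out in \<open>force simp: abs_le_iff not_le\<close>)+
qed

lemma AE_lborel_swap:
  fixes P :: "real \<times> real \<Rightarrow> bool"
  assumes "AE z in lborel. P z"
  shows "AE z in lborel. P (snd z, fst z)"
proof -
  have eq: "distr (lborel \<Otimes>\<^sub>M lborel) (lborel \<Otimes>\<^sub>M lborel) (\<lambda>(x, y). (y, x)) = (lborel :: (real \<times>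
      real) measure)"
    by (subst lborel_pair.distr_pair_swap[symmetric]) (rule lborel_prod)
  have "AE z in distr (lborel \<Otimes>\<^sub>M lborel) (lborel \<Otimes>\<^sub>M lborel) (\<lambda>(x, y). (y, x)). P z"
    unfolding eq by (rule assms)
  from AE_distrD[OF measurable_pair_swap' this] show ?thesis
    unfolding lborel_prod by (simp add: split_beta)
qed

lemma AE_lborel_sections:
  fixes P :: "real \<times> real \<Rightarrow> bool"
  assumes "AE z in lborel. P z"
  shows "AE y in lborel. AE x in lborel. P (x, y)"
  using lborel_pair.AE_pair[unfolded lborel_prod, OF AE_lborel_swap[OF assms]] by simp

lemma ACL_imp_weak_derivative:
  fixes u g \<psi> \<psi>' :: "real \<times> real \<Rightarrow> real"
  assumes u: "continuous_on UNIV u" and g: "g \<in> borel_measurable borel" and \<Omega>: "open \<Omega>"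
    and deriv: "AE z in lborel. z \<in> \<Omega> \<longrightarrow> ((\<lambda>x. u (x, snd z)) has_real_derivative g z) (at (fst z))"
    and acl: "AE y in lborel. \<forall>a b. {a..b} \<times> {y} \<subseteq> \<Omega> \<longrightarrow> abs_continuous_on {a..b} (\<lambda>x. u (x, y))"
    and \<psi>: "continuous_on UNIV \<psi>'" "\<And>x y. ((\<lambda>x. \<psi> (x, y)) has_real_derivative \<psi>' (x, y)) (at x)"
    and K: "compact K" "K \<subseteq> \<Omega>" "\<And>z. z \<notin> K \<Longrightarrow> \<psi> z = 0"
    and int: "integrable lborel (\<lambda>z. \<psi> z * g z)"
  shows "(\<integral>z. u z * \<psi>' z \<partial>lborel) = - (\<integral>z. \<psi> z * g z \<partial>lborel)"
proof -
  have Ky: "compact {x. (x, y) \<in> K}" for y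
  proof -
    have "compact (fst ` (K \<inter> UNIV \<times> {y}))"
      by (intro compact_continuous_image compact_Int_closed K continuous_intros closed_Times)
    also have "fst ` (K \<inter> UNIV \<times> {y}) = {x. (x, y) \<in> K}"
      by force
    finally show ?thesis .
  qed
  have \<Omega>y: "open {x. (x, y) \<in> \<Omega>}" for y
  proof -
    have "open ((\<lambda>x. (x, y)) -` \<Omega>)"
      by (rule open_vimage[OF \<Omega>]) (intro continuous_intros)
    then show ?thesis by (simp add: vimage_def)
  qed
  have \<psi>'0: "\<psi>' z = 0" if "z \<notin> K" for z
    using deriv_zero_off_closed[OF compact_imp_closed[OF Ky[of "snd z"]] _ \<psi>(2)[of "snd z" "fst z"]]
        K(3) that
    by auto
  obtain R where R: "\<And>z. z \<in> K \<Longrightarrow> norm z \<le> R"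
    using compact_imp_bounded[OF K(1)] unfolding bounded_iff by blast
  have int': "integrable lborel (\<lambda>z. u z * \<psi>' z)"
    using R \<psi>'0 not_le by (intro continuous_bounded_support[where R=R] continuous_intros u \<psi>) fastforce
  define H where "H z = u z * \<psi>' z + \<psi> z * g z" for z
  have iH: "integrable lborel H"
    unfolding H_def by (intro Bochner_Integration.integrable_add int int')
  then have iH2: "integrable (lborel \<Otimes>\<^sub>M lborel) (case_prod (\<lambda>x y. H (x, y)))"
    by (simp add: lborel_prod)
  have "AE y in lborel. (\<integral>x. H (x, y) \<partial>lborel) = 0"
    using acl AE_lborel_sections[OF deriv] lborel_pair.AE_integrable_snd[OF iH2]
  proof eventually_elim
    case (elim y)
    then obtain N where N: "N \<in> null_sets lborel"
       "\<And>x. x \<notin> N \<Longrightarrow> (x, y) \<in> \<Omega> \<Longrightarrow> ((\<lambda>x. u (x, y)) has_real_derivative g (x, y)) (at x)"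
      unfolding eventually_ae_filter by auto
    have "((\<lambda>x. H (x, y)) has_integral 0) UNIV"
      unfolding H_def
    proof (rule line_integral_product_derivative[OF _ _ \<Omega>y Ky])
      show "abs_continuous_on {a..b} (\<lambda>x. u (x, y))" if "{a..b} \<subseteq> {x. (x, y) \<in> \<Omega>}" for a b
        using elim(1) that by auto
      show "continuous_on UNIV (\<lambda>x. u (x, y))" "continuous_on UNIV (\<lambda>x. \<psi>' (x, y))"
        by (auto intro!: continuous_on_compose2[OF u] continuous_on_compose2[OF \<psi>(1)] continuous_intros)
      show "{x. (x, y) \<in> K} \<subseteq> {x. (x, y) \<in> \<Omega>}"
        using K by auto
      show "N \<in> null_sets lebesgue"
        using N(1) by (rule null_sets_completionI)
    qed (use \<psi> K N in auto)
    with has_integral_integral_lborel[OF elim(3)] show "(\<integral>x. H (x, y) \<partial>lborel) = 0"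
      using has_integral_unique by blast
  qed
  then have "(\<integral>y. (\<integral>x. H (x, y) \<partial>lborel) \<partial>lborel) = 0"
    by (rule integral_eq_zero_AE)
  then have "(\<integral>z. H z \<partial>lborel) = 0"
    using lborel_pair.integral_snd[OF iH2] by (simp add: lborel_prod)
  then show ?thesis
    unfolding H_def using Bochner_Integration.integral_add[OF int' int] by simp
qed

section \<open>Weak differentiability implies absolute continuity on lines\<close>

lemma AE_zero_if_interval_integrals_zero:
  fixes k :: "real \<Rightarrow> real"
  assumes int: "\<And>c d. integrable lborel (\<lambda>y. indicator {c<..d} y * k y)" and k: "k \<in> borel_measurable borel"
    and zero: "\<And>c d. c \<le> d \<Longrightarrow> (\<integral>y. indicator {c<..d} y * k y \<partial>lborel) = 0"
  shows "AE y in lborel. k y = 0"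
proof -
  have "AE y in lborel. y \<in> {-real m<..real m} \<longrightarrow> k y = 0" for m :: nat
  proof -
    define j where "j y = indicator {-real m<..real m} y * k y" for y
    have jm[measurable]: "j \<in> borel_measurable borel"
      unfolding j_def using k by measurable
    have ji: "integrable lborel j"
      using int unfolding j_def .
    have half: "(\<integral>y. indicator {c<..} y * j y \<partial>lborel) = 0" for c
    proof -
      have eq: "(\<lambda>y. indicator {c<..} y * j y) = (\<lambda>y. indicator {max c (-real m)<..real m} y * k y)"
        by (auto simp: j_def indicator_def)
      show ?thesis
        unfolding eq using zero[of "max c (-real m)" "real m"]
        by (cases "max c (-real m) \<le> real m") simp_all
    qed
    define M where "M s = density lborel (\<lambda>y. ennreal (max 0 (s * j y)))" for s
    have em: "emeasure (M s) {c<..} = ennreal (\<integral>y. indicator {c<..} y * max 0 (s * j y) \<partial>lborel)"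
      and ii: "integrable lborel (\<lambda>y. indicator {c<..} y * max 0 (s * j y))" for s c
    proof -
      have i0: "integrable lborel (\<lambda>y. max 0 (s * j y))"
        by (intro integrable_max integrable_mult_right ji integrable_zero)
      have "integrable lborel (\<lambda>y. indicator {c<..} y *\<^sub>R max 0 (s * j y))"
        by (rule integrable_mult_indicator[OF _ i0]) auto
      then show ii: "integrable lborel (\<lambda>y. indicator {c<..} y * max 0 (s * j y))" by simp
      have "emeasure (M s) {c<..} = (\<integral>\<^sup>+y. ennreal (max 0 (s * j y)) * indicator {c<..} y \<partial>lborel)"
        unfolding M_def by (rule emeasure_density) auto
      also have "\<dots> = (\<integral>\<^sup>+y. ennreal (indicator {c<..} y * max 0 (s * j y)) \<partial>lborel)"
        by (intro nn_integral_cong) (auto simp: indicator_def)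
      also have "\<dots> = ennreal (\<integral>y. indicator {c<..} y * max 0 (s * j y) \<partial>lborel)"
        by (rule nn_integral_eq_integral[OF ii]) auto
      finally show "emeasure (M s) {c<..} = ennreal (\<integral>y. indicator {c<..} y * max 0 (s * j y) \<partial>lborel)" .
    qed
    have "M 1 = M (-1)"
    proof (rule measure_eqI_lessThan)
      fix c
      have "(\<integral>y. indicator {c<..} y * max 0 (1 * j y) \<partial>lborel) - (\<integral>y. indicator {c<..} y * max 0 (-1
          * j y) \<partial>lborel)
         = (\<integral>y. indicator {c<..} y * max 0 (1 * j y) - indicator {c<..} y * max 0 (-1 * j y) \<partial>lborel)"
        by (rule Bochner_Integration.integral_diff[OF ii ii, symmetric])
      also have "(\<lambda>y. indicator {c<..} y * max 0 (1 * j y) - indicator {c<..} y * max 0 (-1 * j y))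
          = (\<lambda>y. indicator {c<..} y * j y)"
        by (auto simp: fun_eq_iff indicator_def max_def)
      also note half
      finally have "(\<integral>y. indicator {c<..} y * max 0 (1 * j y) \<partial>lborel) = (\<integral>y. indicator {c<..} y *
          max 0 (-1 * j y) \<partial>lborel)"
        by (rule eq_iff_diff_eq_0[THEN iffD2])
      then show "emeasure (M 1) {c<..} = emeasure (M (-1)) {c<..}"
        by (simp only: em)
      show "emeasure (M 1) {c<..} < \<infinity>"
        unfolding em by simp
    qed (simp_all add: M_def)
    then have "AE y in lborel. ennreal (max 0 (1 * j y)) = ennreal (max 0 (-1 * j y))"
      unfolding M_def
    proof (subst (asm) finite_density_unique)
      have "integrable lborel (\<lambda>y. max 0 (1 * j y))"
        by (intro integrable_max integrable_mult_right ji integrable_zero)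
      then show "(\<integral>\<^sup>+ y. ennreal (max 0 (1 * j y)) \<partial>lborel) \<noteq> \<infinity>"
        by (subst nn_integral_eq_integral) auto
    qed auto
    then show ?thesis
    proof eventually_elim
      case (elim y)
      then have "max 0 (1 * j y) = max 0 (-1 * j y)"
        by (subst (asm) ennreal_inj) auto
      then have "j y = 0" by (auto simp: max_def split: if_splits)
      then show ?case by (auto simp: j_def indicator_def split: if_splits)
    qed
  qed
  then have "AE y in lborel. \<forall>m::nat. y \<in> {-real m<..real m} \<longrightarrow> k y = 0"
    by (intro AE_all_countable[THEN iffD2] allI)
  then show ?thesis
  proof eventually_elim
    case (elim y)
    obtain m :: nat where "\<bar>y\<bar> < m" using reals_Archimedean2 by blast
    then have "y \<in> {-real m<..real m}" by auto
    then show ?case using elim by blast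
  qed
qed

text \<open>The half-open versions of the intervals of a division are disjoint, so the sum \<open>s\<close> of their
  indicators is at most 1. Truncation of the integrand at a height \<open>M\<close> bounds the total increment by
  \<open>M \<integral> s\<close> plus a small tail.\<close>

lemma abs_continuous_on_indefinite_integral:
  fixes U G :: "real \<Rightarrow> real"
  assumes G: "integrable lborel (\<lambda>x. indicator {a..b} x * G x)"
    and U: "\<And>s t. a \<le> s \<Longrightarrow> s \<le> t \<Longrightarrow> t \<le> b \<Longrightarrow> U t - U s = (\<integral>x. indicator {s<..t} x * G x \<partial>lborel)"
  shows "abs_continuous_on {a..b} U"
  unfolding abs_continuous_on_def
proof (intro allI impI)
  fix e :: real assume e: "e > 0"
  define g where "g x = \<bar>indicator {a..b} x * G x\<bar>" for x
  have gi: "integrable lborel g"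
    unfolding g_def using G by (rule integrable_abs)
  have gm: "g \<in> borel_measurable lborel"
    using gi by (rule borel_measurable_integrable)
  have exm: "(\<lambda>x. max 0 (g x - real M)) \<in> borel_measurable lborel" for M
    using gm by measurable
  have exi: "integrable lborel (\<lambda>x. max 0 (g x - real M))" for M
    by (rule Bochner_Integration.integrable_bound[OF gi exm]) (auto simp: g_def)
  have "(\<lambda>M. \<integral>x. max 0 (g x - real M) \<partial>lborel) \<longlonglongrightarrow> (\<integral>x. 0 \<partial>(lborel :: real measure))"
  proof (rule integral_dominated_convergence[where w=g])
    show "AE x in lborel. (\<lambda>M. max 0 (g x - real M)) \<longlonglongrightarrow> 0"
    proof (rule AE_I2)
      fix x
      obtain M0 where "g x < real M0"
        using reals_Archimedean2 by blast
      have "\<forall>\<^sub>F M in sequentially. 0 = max 0 (g x - real M)"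
        using eventually_ge_at_top[of M0]
      proof eventually_elim
        case (elim M)
        then have "g x - real M \<le> 0"
          using \<open>g x < real M0\<close> by linarith
        then show ?case
          by simp
      qed
      then show "(\<lambda>M. max 0 (g x - real M)) \<longlonglongrightarrow> 0"
        by (rule Lim_transform_eventually[OF tendsto_const])
    qed
  qed (use gi exm in \<open>auto simp: g_def\<close>)
  then have "\<forall>\<^sub>F M in sequentially. (\<integral>x. max 0 (g x - real M) \<partial>lborel) < e / 2"
    by (intro order_tendstoD) (use e in auto)
  then obtain M where M: "(\<integral>x. max 0 (g x - real M) \<partial>lborel) < e / 2"
    by (rule eventually_happens'[OF sequentially_bot, THEN exE])
  show "\<exists>\<delta>>0. \<forall>D. D division_of (\<Union>D) \<longrightarrow> \<Union>D \<subseteq> {a..b} \<longrightarrow> (\<Sum>I\<in>D. measure lborel I) < \<delta> \<longrightarrow>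
        (\<Sum>I\<in>D. dist (U (Inf I)) (U (Sup I))) < e"
  proof (intro exI[of _ "e / (2 * (real M + 1))"] conjI allI impI)
    show "0 < e / (2 * (real M + 1))"
      using e by simp
    fix D assume D: "D division_of (\<Union>D)" "\<Union>D \<subseteq> {a..b}" "(\<Sum>I\<in>D. measure lborel I) < e / (2 * (real M + 1))"
    note fin = division_ofD(1)[OF D(1)]
    have lr: "\<exists>l r. I = {l..r} \<and> l \<le> r \<and> a \<le> l \<and> r \<le> b" if I: "I \<in> D" for I
    proof -
      obtain l r where lr: "I = {l..r}" "l \<le> r"
        using division_ofD(3,4)[OF D(1) I] by fastforce
      have "{l..r} \<subseteq> {a..b}"
        using order_trans[OF Union_upper[OF I] D(2)] lr by simp
      then show ?thesis
        using lr by auto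
    qed
    define J where "J I = {Inf I<..Sup I :: real}" for I
    define s where "s x = (\<Sum>I\<in>D. indicator (J I) x :: real)" for x
    have s1: "s x \<le> 1" "0 \<le> s x" for x
    proof -
      show "0 \<le> s x" unfolding s_def by (intro sum_nonneg) auto
      have uniq: "I = I'" if II: "I \<in> D" "I' \<in> D" "x \<in> J I" "x \<in> J I'" for I I'
      proof (rule ccontr)
        assume "I \<noteq> I'"
        then have dis: "interior I \<inter> interior I' = {}"
          using division_ofD(5)[OF D(1)] that by blast
        obtain l r where "I = {l..r}" "l \<le> r"
          using lr[OF II(1)] by blast
        moreover obtain l' r' where "I' = {l'..r'}" "l' \<le> r'"
          using lr[OF II(2)] by blast
        ultimately have I: "I = {l..r}" "l \<le> r" "I' = {l'..r'}" "l' \<le> r'"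
          by blast+
        have "max l l' < x" "x \<le> min r r'"
          using that I by (auto simp: J_def)
        then have "(max l l' + x) / 2 \<in> {l<..<r} \<inter> {l'<..<r'}"
          by auto
        then show False
          using dis I by (auto simp: interior_atLeastAtMost_real)
      qed
      show "s x \<le> 1"
      proof (cases "\<exists>I\<in>D. x \<in> J I")
        case True
        then obtain I where I: "I \<in> D" "x \<in> J I" by blast
        have "s x = indicator (J I) x + (\<Sum>I'\<in>D - {I}. indicator (J I') x)"
          unfolding s_def by (rule sum.remove[OF fin I(1)])
        also have "(\<Sum>I'\<in>D - {I}. indicator (J I') x) = (0::real)"
          using uniq I by (intro sum.neutral) (auto simp: indicator_def)
        finally show ?thesis using I by simp
      next
        case False
        then have "s x = 0" unfolding s_def by (intro sum.neutral) (auto simp: indicator_def)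
        then show ?thesis by simp
      qed
    qed
    have Ji: "integrable lborel (\<lambda>x. indicator (J I) x :: real)" for I
    proof -
      have "bounded (J I)"
        unfolding J_def by (rule bounded_subset[of "{Inf I..Sup I}"]) auto
      from emeasure_bounded_finite[OF this] show ?thesis
        by (intro integrable_real_indicator) (auto simp: J_def)
    qed
    then have si: "integrable lborel s"
      unfolding s_def by (intro Bochner_Integration.integrable_sum)
    have Jg: "integrable lborel (\<lambda>x. indicator (J I) x * g x)" for I
      using integrable_mult_indicator[OF _ gi, of "J I"] by (simp add: J_def)
    have "(\<Sum>I\<in>D. dist (U (Inf I)) (U (Sup I))) \<le> (\<Sum>I\<in>D. \<integral>x. indicator (J I) x * g x \<partial>lborel)"
    proof (rule sum_mono)
      fix I assume "I \<in> D"
      then obtain l r where I: "I = {l..r}" "l \<le> r" "a \<le> l" "r \<le> b"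
        using lr by blast
      then have "dist (U (Inf I)) (U (Sup I)) = norm (\<integral>x. indicator (J I) x * G x \<partial>lborel)"
        using U[of l r] by (simp add: dist_real_def J_def abs_minus_commute)
      also have "\<dots> \<le> (\<integral>x. norm (indicator (J I) x * G x) \<partial>lborel)"
        by (rule integral_norm_bound)
      also have "(\<lambda>x. norm (indicator (J I) x * G x)) = (\<lambda>x. indicator (J I) x * g x)"
        using I by (auto simp: fun_eq_iff J_def g_def indicator_def)
      finally show "dist (U (Inf I)) (U (Sup I)) \<le> (\<integral>x. indicator (J I) x * g x \<partial>lborel)" .
    qed
    also have "\<dots> = (\<integral>x. (\<Sum>I\<in>D. indicator (J I) x * g x) \<partial>lborel)"
      by (rule Bochner_Integration.integral_sum[symmetric]) (rule Jg)
    also have "\<dots> \<le> (\<integral>x. real M * s x + max 0 (g x - real M) \<partial>lborel)"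
    proof (rule integral_mono)
      show "integrable lborel (\<lambda>x. \<Sum>I\<in>D. indicator (J I) x * g x)"
        by (intro Bochner_Integration.integrable_sum Jg)
      show "integrable lborel (\<lambda>x. real M * s x + max 0 (g x - real M))"
        by (intro Bochner_Integration.integrable_add integrable_mult_right si exi)
      fix x
      have "(\<Sum>I\<in>D. indicator (J I) x * g x) = s x * g x"
        by (simp add: s_def sum_distrib_right)
      also have "\<dots> \<le> s x * (real M + max 0 (g x - real M))"
        using s1[of x] by (intro mult_left_mono) auto
      also have "\<dots> \<le> real M * s x + 1 * max 0 (g x - real M)"
        using s1[of x] mult_right_mono[OF s1(1)[of x], of "max 0 (g x - real M)"]
        by (simp add: algebra_simps)
      finally show "(\<Sum>I\<in>D. indicator (J I) x * g x) \<le> real M * s x + max 0 (g x - real M)"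
        by simp
    qed
    also have "\<dots> = real M * (\<integral>x. s x \<partial>lborel) + (\<integral>x. max 0 (g x - real M) \<partial>lborel)"
      by (subst Bochner_Integration.integral_add[OF integrable_mult_right[OF si] exi]) simp
    also have "(\<integral>x. s x \<partial>lborel) = (\<Sum>I\<in>D. measure lborel I)"
    proof -
      have "(\<integral>x. s x \<partial>lborel) = (\<Sum>I\<in>D. \<integral>x. indicator (J I) x \<partial>lborel)"
        unfolding s_def by (rule Bochner_Integration.integral_sum) (rule Ji)
      also have "\<dots> = (\<Sum>I\<in>D. measure lborel I)"
        by (rule sum.cong[OF refl]) (use lr in \<open>fastforce simp: J_def\<close>)
      finally show ?thesis .
    qed
    also have "real M * (\<Sum>I\<in>D. measure lborel I) \<le> real M * (e / (2 * (real M + 1)))"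
      using D(3) by (intro mult_left_mono) auto
    also have "\<dots> \<le> e / 2"
      using e by (simp add: field_simps)
    finally show "(\<Sum>I\<in>D. dist (U (Inf I)) (U (Sup I))) < e"
      using M by linarith
  qed
qed

text \<open>The weak identity for test functions that approximate the indicator of a rectangle.\<close>

lemma weak_partial_imp_rectangle_integral:
  fixes u g :: "real \<times> real \<Rightarrow> real"
  assumes u: "continuous_on UNIV u" and g: "g \<in> borel_measurable borel"
    and gi: "\<And>R. integrable lborel (\<lambda>z. indicator (cball 0 R) z * g z)"
    and wp: "weak_partial UNIV (1, 0) u g" and ab: "a \<le> b" and cd: "c \<le> d"
  shows "(\<integral>y. indicator {c<..d} y * (u (b, y) - u (a, y)) \<partial>lborel)
     = (\<integral>z. indicator {a<..b} (fst z) * indicator {c<..d} (snd z) * g z \<partial>lborel)"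
proof -
  obtain S S' :: "real \<Rightarrow> real" and M where S: "smooth S" "\<And>x. x \<le> 0 \<Longrightarrow> S x = 0" "\<And>x. x \<ge> 1 \<Longrightarrow> S x = 1"
      "\<And>x. 0 \<le> S x" "\<And>x. S x \<le> 1"
    and S': "\<And>x. (S has_real_derivative S' x) (at x)" "\<And>x. x \<le> 0 \<or> 1 \<le> x \<Longrightarrow> S' x = 0"
      "\<And>x. \<bar>S' x\<bar> \<le> M"
    by (rule smooth_step) blast
  have S'eq: "S' = deriv S"
    using DERIV_imp_deriv[OF S'(1)] by auto
  have S'c: "continuous_on A S'" for A
    unfolding S'eq by (rule smooth_continuous[OF smooth_deriv(1)[OF S(1)]])
  have S'out: "S' x = 0" if "norm x > 1" for x
    using that by (intro S'(2)) (auto simp: abs_if split: if_splits)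
  have S'i: "integrable lborel S'"
    by (rule continuous_bounded_support(2)[OF S'c S'out])
  have S'1: "(\<integral>x. S' x \<partial>lborel) = 1"
  proof -
    have "(\<integral>x. S' x * indicator {0..1} x \<partial>lborel) = S 1 - S 0"
      by (rule integral_FTC_Icc_real) (use S'(1) S'c[of UNIV] in \<open>auto simp:
          continuous_on_eq_continuous_at\<close>)
    moreover have "S' x * indicator {0..1} x = S' x" for x
      using S'(2)[of x] by (cases "x \<le> 0 \<or> 1 \<le> x") auto
    ultimately show ?thesis
      by (simp add: S)
  qed
  \<comment> \<open>smooth approximations, supported in \<open>[p, r + 1]\<close>, of the indicator of \<open>(p, r]\<close>\<close>
  define A where "A p r n x = S (real (Suc n) * x + (- real (Suc n) * p)) - S (real (Suc n) * x + (-
      real (Suc n) * r))"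
    for p r :: real and n :: nat and x :: real
  define A' where "A' p r n x = S' (real (Suc n) * x + (- real (Suc n) * p)) * real (Suc n) - S'
      (real (Suc n) * x + (- real (Suc n) * r)) * real (Suc n)"
    for p r :: real and n :: nat and x :: real
  have As: "smooth (A p r n)" for p r n
    unfolding A_def by (intro smooth_diff smooth_compose[OF S(1) smooth_affine])
  have Ad: "(A p r n has_real_derivative A' p r n x) (at x)" for p r n x
  proof -
    have "((\<lambda>x. S (real (Suc n) * x + q)) has_real_derivative S' (real (Suc n) * x + q) * real (Suc
        n)) (at x)" for q
      by (rule DERIV_chain2[OF S'(1)]) (auto intro!: derivative_eq_intros)
    then show ?thesis
      unfolding A_def A'_def by (intro DERIV_diff)
  qed
  have A'c: "continuous_on B (A' p r n)" for B p r n
    unfolding A'_def by (intro continuous_intros continuous_on_compose2[OF S'c[of UNIV]]) auto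
  have aff: "real (Suc n) * x + (- real (Suc n) * p) = real (Suc n) * (x - p)" for n x p
    by (simp add: algebra_simps)
  have step1: "S (real (Suc n) * x + (- real (Suc n) * p)) = 0" if "x \<le> p" for n x p
    using mult_left_mono[OF that, of "real (Suc n)"] by (intro S(2)) (simp only: mult_minus_left, linarith)
  have step2: "S (real (Suc n) * x + (- real (Suc n) * p)) = 1" if "x \<ge> p + 1" for n x p
  proof (rule S(3))
    have "1 * 1 \<le> real (Suc n) * (x - p)"
      using that by (intro mult_mono) auto
    then show "1 \<le> real (Suc n) * x + (- real (Suc n) * p)"
      unfolding aff by simp
  qed
  have A0: "A p r n x = 0" if "x \<le> p \<or> x > r + 1" "p \<le> r" for p r n x
    using that step1[of x p n] step1[of x r n] step2[of p x n] step2[of r x n] by (auto simp: A_def)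
  have A1: "\<bar>A p r n x\<bar> \<le> 1" for p r n x
    unfolding A_def using S(4,5) by (smt (verit))
  have steplim: "(\<lambda>n. S (real (Suc n) * x + (- real (Suc n) * p))) \<longlonglongrightarrow> indicator {p<..} x" for x p
  proof (cases "x \<le> p")
    case True
    then show ?thesis using step1[OF True] by simp
  next
    case False
    obtain n0 :: nat where n0: "1 / (x - p) < real n0"
      using reals_Archimedean2 by blast
    have "\<forall>\<^sub>F n in sequentially. 1 = S (real (Suc n) * x + (- real (Suc n) * p))"
      using eventually_ge_at_top[of n0]
    proof eventually_elim
      case (elim n)
      then have "1 / (x - p) \<le> real (Suc n)"
        using n0 by linarith
      then have "1 \<le> real (Suc n) * (x - p)"
        using False by (simp add: field_simps)
      then show ?case
        unfolding aff by (intro S(3)[symmetric])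
    qed
    then have "(\<lambda>n. S (real (Suc n) * x + (- real (Suc n) * p))) \<longlonglongrightarrow> 1"
      by (rule Lim_transform_eventually[OF tendsto_const])
    then show ?thesis using False by simp
  qed
  have Alim: "(\<lambda>n. A p r n x) \<longlonglongrightarrow> indicator {p<..r} x" if "p \<le> r" for p r x
  proof -
    have "(\<lambda>n. A p r n x) \<longlonglongrightarrow> indicator {p<..} x - indicator {r<..} x"
      unfolding A_def by (intro tendsto_diff steplim)
    also have "indicator {p<..} x - indicator {r<..} x = (indicator {p<..r} x :: real)"
      using that by (auto simp: indicator_def)
    finally show ?thesis .
  qed
  define R where "R = \<bar>a\<bar> + \<bar>b\<bar> + \<bar>c\<bar> + \<bar>d\<bar> + 2"
  define \<psi> where "\<psi> n z = A a b n (fst z) * A c d n (snd z)" for n z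
  have supp: "norm (x, y) \<le> R" if "a \<le> x" "x \<le> b + 1" "c \<le> y" "y \<le> d + 1" for x y :: real
    using norm_Pair_le[of x y] that by (auto simp: R_def)
  have \<psi>0: "\<psi> n z = 0" if "norm z > R" for n z
    using supp[of "fst z" "snd z"] that A0[of "fst z" a b n] A0[of "snd z" c d n] ab cd
    by (force simp: \<psi>_def not_le)
  have s\<psi>: "smooth (\<psi> n)" for n
    unfolding \<psi>_def
    by (rule smooth_mult; rule smooth_compose[OF As smooth_linear]; rule bounded_linear_fst
        bounded_linear_snd)
  have nz: "norm z \<le> R" if "\<psi> n z \<noteq> 0" for n z
    using \<psi>0[of z n] that by (meson not_le)
  have t\<psi>: "\<psi> n \<in> test_functions UNIV" for n
    by (rule test_functionsI[where R=R and C=UNIV, OF s\<psi>]) (simp_all add: nz)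
  have d\<psi>: "frechet_derivative (\<psi> n) (at z) (1, 0) = A' a b n (fst z) * A c d n (snd z)" for n z
  proof -
    have 1: "((\<lambda>z. A a b n (fst z)) has_derivative (\<lambda>v. A' a b n (fst z) * fst v)) (at z)"
      using has_derivative_compose[OF bounded_linear_imp_has_derivative[OF bounded_linear_fst]
        Ad[unfolded has_field_derivative_def], of a b n z] by simp
    have 2: "((\<lambda>z. A c d n (snd z)) has_derivative (\<lambda>v. A' c d n (snd z) * snd v)) (at z)"
      using has_derivative_compose[OF bounded_linear_imp_has_derivative[OF bounded_linear_snd]
        Ad[unfolded has_field_derivative_def], of c d n z] by simp
    show ?thesis
      unfolding \<psi>_def by (simp add: frechet_derivative_at[OF has_derivative_mult[OF 1 2], symmetric])
  qed
  \<comment> \<open>the test functions converge boundedly to the indicator of the rectangle\<close>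
  have gR: "integrable lborel (\<lambda>z. \<bar>indicator (cball 0 R) z * g z\<bar>)"
    by (rule integrable_abs[OF gi])
  have \<psi>m[measurable]: "\<psi> n \<in> borel_measurable borel" for n
    by (rule borel_measurable_continuous_onI[OF smooth_continuous[OF s\<psi>]])
  have \<psi>1: "\<bar>\<psi> n z\<bar> \<le> 1" for n z
    unfolding \<psi>_def abs_mult by (intro mult_le_one A1) auto
  have rhs: "(\<lambda>n. \<integral>z. \<psi> n z * g z \<partial>lborel)
     \<longlonglongrightarrow> (\<integral>z. indicator {a<..b} (fst z) * indicator {c<..d} (snd z) * g z \<partial>lborel)"
  proof (rule integral_dominated_convergence[OF _ _ gR])
    show "(\<lambda>z. indicator {a<..b} (fst z) * indicator {c<..d} (snd z) * g z) \<in> borel_measurable lborel"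
      using g by (simp add: borel_prod[symmetric])
    show "(\<lambda>z. \<psi> n z * g z) \<in> borel_measurable lborel" for n
      using g by measurable
    show "AE z in lborel. (\<lambda>n. \<psi> n z * g z) \<longlonglongrightarrow> indicator {a<..b} (fst z) * indicator {c<..d} (snd z) * g z"
      unfolding \<psi>_def by (intro AE_I2 tendsto_mult tendsto_const Alim ab cd)
    show "AE z in lborel. norm (\<psi> n z * g z) \<le> \<bar>indicator (cball 0 R) z * g z\<bar>" for n
    proof (rule AE_I2)
      fix z
      show "norm (\<psi> n z * g z) \<le> \<bar>indicator (cball 0 R) z * g z\<bar>"
        using \<psi>0[of z n] mult_right_mono[OF \<psi>1[of n z], of "\<bar>g z\<bar>"]
        by (cases "norm z > R") (auto simp: abs_mult)
    qed
  qed
  \<comment> \<open>their derivatives in \<open>x\<close> are bumps of integral 1 and -1 that concentrate at \<open>a\<close> and \<open>b\<close>\<close>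
  have um[measurable]: "u \<in> borel_measurable borel"
    by (rule borel_measurable_continuous_onI[OF u])
  have S'm[measurable]: "S' \<in> borel_measurable borel"
    by (rule borel_measurable_continuous_onI[OF S'c])
  define Q where "Q = {- (\<bar>a\<bar> + \<bar>b\<bar> + 1)..\<bar>a\<bar> + \<bar>b\<bar> + 1} \<times> {c..d + 1}"
  have "compact (u ` Q)"
    unfolding Q_def by (intro compact_continuous_image continuous_on_subset[OF u] compact_Times) auto
  from compact_imp_bounded[OF this] obtain B0 where "\<forall>x\<in>u ` Q. norm x \<le> B0"
    unfolding bounded_iff by blast
  then have B0: "\<bar>u z\<bar> \<le> B0" if "z \<in> Q" for z
    using that by simp
  have uc: "isCont u z" for z
    using u continuous_on_eq_continuous_at[OF open_UNIV] by blast
  define I where "I n y = (\<integral>s. (u (a + s / real (Suc n), y) - u (b + s / real (Suc n), y)) * S' s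
      \<partial>lborel)" for n y
  have inv: "(\<lambda>n. s / real (Suc n)) \<longlonglongrightarrow> 0" for s
    using tendsto_mult_right_zero[OF LIMSEQ_inverse_real_of_nat, of s] by (simp add: divide_inverse)
  have bnd: "\<bar>(u (a + s / real (Suc n), y) - u (b + s / real (Suc n), y)) * S' s\<bar> \<le> 2 * B0 * \<bar>S' s\<bar>"
    if y: "y \<in> {c..d+1}" for n y s
  proof (cases "0 \<le> s \<and> s \<le> 1")
    case True
    then have "0 \<le> s / real (Suc n)" "s / real (Suc n) \<le> 1"
      by (auto simp: divide_simps)
    moreover have "(a + r, y) \<in> Q \<and> (b + r, y) \<in> Q" if "0 \<le> r" "r \<le> 1" for r
      using y that by (auto simp: Q_def)
    ultimately have "(a + s / real (Suc n), y) \<in> Q" "(b + s / real (Suc n), y) \<in> Q"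
      by blast+
    from B0[OF this(1)] B0[OF this(2)] show ?thesis
      unfolding abs_mult by (intro mult_right_mono) auto
  next
    case False
    then show ?thesis using S'(2)[of s] by auto
  qed
  have Ilim: "(\<lambda>n. I n y) \<longlonglongrightarrow> u (a, y) - u (b, y)" if y: "y \<in> {c..d+1}" for y
  proof -
    have "(\<lambda>n. I n y) \<longlonglongrightarrow> (\<integral>s. (u (a, y) - u (b, y)) * S' s \<partial>lborel)"
      unfolding I_def
    proof (rule integral_dominated_convergence[where w="\<lambda>s. 2 * B0 * \<bar>S' s\<bar>"])
      show "integrable lborel (\<lambda>s. 2 * B0 * \<bar>S' s\<bar>)"
        using S'i by (intro integrable_mult_right integrable_abs)
      have "(\<lambda>n. u (p + s / real (Suc n), y)) \<longlonglongrightarrow> u (p + 0, y)" for p s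
        by (rule isCont_tendsto_compose[OF uc]) (intro tendsto_intros inv)
      then show "AE s in lborel. (\<lambda>n. (u (a + s / real (Suc n), y) - u (b + s / real (Suc n), y)) * S' s)
          \<longlonglongrightarrow> (u (a, y) - u (b, y)) * S' s"
        by (intro AE_I2 tendsto_intros) simp_all
      show "AE s in lborel. norm ((u (a + s / real (Suc n), y) - u (b + s / real (Suc n), y)) * S'
          s) \<le> 2 * B0 * \<bar>S' s\<bar>" for n
        using bnd[OF y] by (intro AE_I2) simp
    qed measurable
    then show ?thesis
      by (simp add: S'1)
  qed
  define L where "L = (\<integral>s. \<bar>S' s\<bar> \<partial>lborel)"
  have Ibnd: "\<bar>I n y\<bar> \<le> 2 * B0 * L" if y: "y \<in> {c..d+1}" for n y
  proof -
    have B0': "B0 \<ge> 0"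
    proof -
      have "(a, y) \<in> Q" using y by (auto simp: Q_def)
      from B0[OF this] show ?thesis by linarith
    qed
    have "norm (I n y) \<le> (\<integral>s. norm ((u (a + s / real (Suc n), y) - u (b + s / real (Suc n), y)) * S'
        s) \<partial>lborel)"
      unfolding I_def by (rule integral_norm_bound)
    also have "\<dots> \<le> (\<integral>s. 2 * B0 * \<bar>S' s\<bar> \<partial>lborel)"
      using bnd[OF y] S'i B0' by (intro Bochner_Integration.integral_mono' integrable_mult_right
          integrable_abs) auto
    finally show ?thesis by (simp add: L_def)
  qed
  have lhs_eq: "(\<integral>z. u z * (A' a b n (fst z) * A c d n (snd z)) \<partial>lborel) = (\<integral>y. A c d n y * I n y
      \<partial>lborel)" for n
  proof -
    have S'z: "A' a b n x * A c d n y = 0" if "norm (x, y) > R" for x y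
    proof -
      have "frechet_derivative (\<psi> n) (at (x, y)) (1, 0) = 0"
      proof -
        have "(\<psi> n has_derivative (\<lambda>v. 0)) (at (x, y))"
          by (rule has_derivative_transform_within_open[OF has_derivative_const, of "{z. R < norm z}"])
            (use that \<psi>0 in \<open>auto intro!: open_Collect_less continuous_intros\<close>)
        from frechet_derivative_at[OF this] show ?thesis by metis
      qed
      then show ?thesis by (simp add: d\<psi>)
    qed
    have c: "continuous_on UNIV (\<lambda>z. u z * (A' a b n (fst z) * A c d n (snd z)))"
      by (intro continuous_intros u continuous_on_compose2[OF A'c[of UNIV]]
          continuous_on_compose2[OF smooth_continuous[OF As, of UNIV]]) auto
    have "integrable lborel (\<lambda>z. u z * (A' a b n (fst z) * A c d n (snd z)))"
      by (rule continuous_bounded_support(2)[OF c, of R]) (use S'z in auto)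
    then have int: "integrable (lborel \<Otimes>\<^sub>M lborel) (case_prod (\<lambda>x y. u (x, y) * (A' a b n x * A c d n y)))"
      by (simp add: lborel_prod case_prod_unfold)
    have "(\<integral>z. u z * (A' a b n (fst z) * A c d n (snd z)) \<partial>lborel)
        = (\<integral>y. (\<integral>x. u (x, y) * (A' a b n x * A c d n y) \<partial>lborel) \<partial>lborel)"
      using lborel_pair.integral_snd[OF int] by (simp add: lborel_prod case_prod_unfold)
    also have "\<dots> = (\<integral>y. A c d n y * I n y \<partial>lborel)"
    proof (rule Bochner_Integration.integral_cong[OF refl])
      fix y
      have one: "integrable lborel (\<lambda>x. u (x, y) * (S' (real (Suc n) * x + (- real (Suc n) * p)) *
          real (Suc n)))"
         "(\<integral>x. u (x, y) * (S' (real (Suc n) * x + (- real (Suc n) * p)) * real (Suc n)) \<partial>lborel)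
          = (\<integral>s. u (p + s / real (Suc n), y) * S' s \<partial>lborel)"
         "integrable lborel (\<lambda>s. u (p + s / real (Suc n), y) * S' s)" for p
      proof -
        have uy: "continuous_on UNIV (\<lambda>x. u (f x, y))" if "continuous_on UNIV f" for f :: "real \<Rightarrow> real"
          using that by (intro continuous_on_compose2[OF u] continuous_intros) auto
        show i3: "integrable lborel (\<lambda>s. u (p + s / real (Suc n), y) * S' s)"
          by (rule continuous_bounded_support(2)[where R=1]) (use S'out in \<open>auto intro!:
              continuous_intros uy S'c\<close>)
        have sub: "p + (real (Suc n) * x + (- real (Suc n) * p)) / real (Suc n) = x" for x
          by (simp add: divide_simps) (simp add: algebra_simps)
        have eq: "(\<lambda>x. u (x, y) * (S' (real (Suc n) * x + (- real (Suc n) * p)) * real (Suc n)))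
           = (\<lambda>x. real (Suc n) * (\<lambda>s. u (p + s / real (Suc n), y) * S' s) ((- real (Suc n) * p) +
               real (Suc n) * x))"
          using sub by (auto simp: fun_eq_iff add.commute)
        show "integrable lborel (\<lambda>x. u (x, y) * (S' (real (Suc n) * x + (- real (Suc n) * p)) * real
            (Suc n)))"
          unfolding eq by (intro integrable_mult_right lborel_integrable_real_affine[OF i3]) simp
        show "(\<integral>x. u (x, y) * (S' (real (Suc n) * x + (- real (Suc n) * p)) * real (Suc n)) \<partial>lborel)
          = (\<integral>s. u (p + s / real (Suc n), y) * S' s \<partial>lborel)"
          unfolding eq
          by (subst (2) lborel_integral_real_affine[where c="real (Suc n)" and t="- real (Suc n) * p"]) auto
      qed
      have "(\<integral>x. u (x, y) * (A' a b n x * A c d n y) \<partial>lborel) = A c d n y * (\<integral>x. u (x, y) * A' a b n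
          x \<partial>lborel)"
        by (subst integral_mult_right_zero[symmetric]) (simp add: mult_ac)
      also have "(\<integral>x. u (x, y) * A' a b n x \<partial>lborel) = I n y"
        unfolding A'_def right_diff_distrib I_def left_diff_distrib
        using one by (simp only: Bochner_Integration.integral_diff)
      finally show "(\<integral>x. u (x, y) * (A' a b n x * A c d n y) \<partial>lborel) = A c d n y * I n y" .
    qed
    finally show ?thesis .
  qed
  have lhs: "(\<lambda>n. \<integral>y. A c d n y * I n y \<partial>lborel) \<longlonglongrightarrow> (\<integral>y. indicator {c<..d} y * (u (a, y) - u (b, y))
      \<partial>lborel)"
  proof (rule integral_dominated_convergence[where w="\<lambda>y. 2 * B0 * L * indicator {c..d+1} y"])
    have ym: "(\<lambda>y. u (p, y)) \<in> borel_measurable borel" for p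
      by measurable
    show "(\<lambda>y. indicator {c<..d} y * (u (a, y) - u (b, y))) \<in> borel_measurable lborel"
      by measurable
    show "(\<lambda>y. A c d n y * I n y) \<in> borel_measurable lborel" for n
    proof -
      have [measurable]: "A c d n \<in> borel_measurable borel"
        by (rule borel_measurable_continuous_onI[OF smooth_continuous[OF As]])
      show ?thesis unfolding I_def by measurable
    qed
    show "integrable lborel (\<lambda>y. 2 * B0 * L * indicator {c..d+1} y)"
      by (intro integrable_mult_right integrable_real_indicator) (auto simp: emeasure_lborel_Icc_eq)
    show "AE y in lborel. (\<lambda>n. A c d n y * I n y) \<longlonglongrightarrow> indicator {c<..d} y * (u (a, y) - u (b, y))"
    proof (rule AE_I2)
      fix y
      show "(\<lambda>n. A c d n y * I n y) \<longlonglongrightarrow> indicator {c<..d} y * (u (a, y) - u (b, y))"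
      proof (cases "y \<in> {c..d+1}")
        case True
        then show ?thesis by (intro tendsto_mult Alim Ilim cd)
      next
        case False
        then have "A c d n y = 0" for n
          using A0[of y c d n] cd by auto
        moreover have "y \<notin> {c<..d}"
          using False by auto
        ultimately show ?thesis by simp
      qed
    qed
    show "AE y in lborel. norm (A c d n y * I n y) \<le> 2 * B0 * L * indicator {c..d+1} y" for n
    proof (rule AE_I2)
      fix y
      show "norm (A c d n y * I n y) \<le> 2 * B0 * L * indicator {c..d+1} y"
      proof (cases "y \<in> {c..d+1}")
        case True
        have "\<bar>A c d n y\<bar> * \<bar>I n y\<bar> \<le> 1 * (2 * B0 * L)"
          by (intro mult_mono A1 Ibnd True) auto
        then show ?thesis using True by (simp add: abs_mult)
      next
        case False
        then have "A c d n y = 0"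
          using A0[of y c d n] cd by auto
        then show ?thesis using False by simp
      qed
    qed
  qed
  have "(\<integral>y. A c d n y * I n y \<partial>lborel) = - (\<integral>z. \<psi> n z * g z \<partial>lborel)" for n
  proof -
    have "(\<integral>y. A c d n y * I n y \<partial>lborel) = (\<integral>z. u z * frechet_derivative (\<psi> n) (at z) (1, 0) \<partial>lborel)"
      unfolding d\<psi> lhs_eq ..
    also have "\<dots> = (\<integral>z. u z * frechet_derivative (\<psi> n) (at z) (1, 0) \<partial>lebesgue)"
      by (rule integral_completion[symmetric], unfold measurable_lborel2, rule
          borel_measurable_continuous_onI)
        (intro continuous_intros u smooth_continuous smooth_frechet s\<psi>)
    also have "\<dots> = - (\<integral>z. \<psi> n z * g z \<partial>lebesgue)"
      using wp t\<psi> by (auto simp: weak_partial_def)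
    also have "(\<integral>z. \<psi> n z * g z \<partial>lebesgue) = (\<integral>z. \<psi> n z * g z \<partial>lborel)"
      by (rule integral_completion) (use g in measurable)
    finally show ?thesis .
  qed
  then have "(\<integral>y. indicator {c<..d} y * (u (a, y) - u (b, y)) \<partial>lborel)
     = - (\<integral>z. indicator {a<..b} (fst z) * indicator {c<..d} (snd z) * g z \<partial>lborel)"
    using lhs LIMSEQ_unique tendsto_minus[OF rhs] by simp
  moreover have "(\<integral>y. indicator {c<..d} y * (u (b, y) - u (a, y)) \<partial>lborel) = - (\<integral>y. indicator
      {c<..d} y * (u (a, y) - u (b, y)) \<partial>lborel)"
    by (subst Bochner_Integration.integral_minus[symmetric]) (simp add: right_diff_distrib)
  ultimately show ?thesis by simp
qed

text \<open>For almost every \<open>y\<close> the integral formula for \<open>u (t, y) - u (-m, y)\<close> holds for all natural \<open>m\<close> and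
  rational \<open>t \<ge> -m\<close>, hence by continuity for all real \<open>t \<ge> -m\<close>.\<close>

lemma weak_partial_imp_abs_continuous:
  fixes u g :: "real \<times> real \<Rightarrow> real"
  assumes u: "continuous_on UNIV u" and g: "g \<in> borel_measurable borel"
    and gi: "\<And>R. integrable lborel (\<lambda>z. indicator (cball 0 R) z * g z)"
    and wp: "weak_partial UNIV (1, 0) u g"
  shows "AE y in lborel. \<forall>a b. abs_continuous_on {a..b} (\<lambda>x. u (x, y))"
proof -
  let ?G = "\<lambda>a b y. \<integral>x. indicator {a<..b} x * g (x, y) \<partial>lborel"
  have um[measurable]: "u \<in> borel_measurable borel"
    by (rule borel_measurable_continuous_onI[OF u])
  have gm[measurable]: "g \<in> borel_measurable (borel \<Otimes>\<^sub>M borel)"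
    using g by (simp add: borel_prod)
  have box: "integrable lborel (\<lambda>z. indicator {a<..b} (fst z) * indicator {c<..d} (snd z) * g z)"
      for a b c d
  proof (rule Bochner_Integration.integrable_bound[OF gi[of "\<bar>a\<bar> + \<bar>b\<bar> + \<bar>c\<bar> + \<bar>d\<bar>"]])
    show "(\<lambda>z. indicator {a<..b} (fst z) * indicator {c<..d} (snd z) * g z) \<in> borel_measurable lborel"
      using g by (simp add: borel_prod[symmetric])
    show "AE z in lborel. norm (indicator {a<..b} (fst z) * indicator {c<..d} (snd z) * g z)
       \<le> norm (indicator (cball 0 (\<bar>a\<bar> + \<bar>b\<bar> + \<bar>c\<bar> + \<bar>d\<bar>)) z * g z)"
    proof (rule AE_I2)
      fix z :: "real \<times> real"
      have "norm z \<le> \<bar>a\<bar> + \<bar>b\<bar> + \<bar>c\<bar> + \<bar>d\<bar>" if "fst z \<in> {a<..b}" "snd z \<in> {c<..d}"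
        using norm_Pair_le[of "fst z" "snd z"] that by auto
      then show "norm (indicator {a<..b} (fst z) * indicator {c<..d} (snd z) * g z)
         \<le> norm (indicator (cball 0 (\<bar>a\<bar> + \<bar>b\<bar> + \<bar>c\<bar> + \<bar>d\<bar>)) z * g z)"
        by (auto simp: indicator_def)
    qed
  qed
  have box': "integrable (lborel \<Otimes>\<^sub>M lborel) (case_prod (\<lambda>x y. indicator {a<..b} x * indicator
      {c<..d} y * g (x, y)))"
    for a b c d :: real
    using box[of a b c d] by (simp add: lborel_prod case_prod_unfold)
  have slice: "AE y in lborel. \<forall>m::nat. integrable lborel (\<lambda>x. indicator {-real m<..real m} x * g (x, y))"
  proof (intro AE_all_countable[THEN iffD2] allI)
    fix m :: nat
    have "AE y in lborel. \<forall>k::nat. integrable lborel (\<lambda>x. indicator {-real m<..real m} x * indicator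
        {-real k<..real k} y * g (x, y))"
      by (intro AE_all_countable[THEN iffD2] allI lborel_pair.AE_integrable_snd[OF box'])
    then show "AE y in lborel. integrable lborel (\<lambda>x. indicator {-real m<..real m} x * g (x, y))"
    proof eventually_elim
      case (elim y)
      obtain k :: nat where "\<bar>y\<bar> < k" using reals_Archimedean2 by blast
      then have "y \<in> {-real k<..real k}" by auto
      then show ?case using elim[rule_format, of k] by simp
    qed
  qed
  have eq: "AE y in lborel. u (b, y) - u (a, y) - ?G a b y = 0" if ab: "a \<le> b" for a b
  proof (rule AE_zero_if_interval_integrals_zero)
    have uc: "continuous_on UNIV (\<lambda>y. u (b, y) - u (a, y))"
      by (intro continuous_intros continuous_on_compose2[OF u]) auto
    have i1: "integrable lborel (\<lambda>y. indicator {c<..d} y * (u (b, y) - u (a, y)))" for c d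
    proof -
      have "integrable lborel (\<lambda>y. indicator {c..d} y *\<^sub>R (u (b, y) - u (a, y)))"
        by (intro borel_integrable_compact continuous_on_subset[OF uc]) auto
      from integrable_mult_indicator[OF _ this, of "{c<..d}"]
      show ?thesis
        by (rule Bochner_Integration.integrable_cong[THEN iffD1, rotated 2]) (auto simp: indicator_def)
    qed
    have i2: "integrable lborel (\<lambda>y. indicator {c<..d} y * ?G a b y)"
      "(\<integral>y. indicator {c<..d} y * ?G a b y \<partial>lborel) = (\<integral>z. indicator {a<..b} (fst z) * indicator
          {c<..d} (snd z) * g z \<partial>lborel)" for c d
    proof -
      have *: "(\<integral>x. indicator {a<..b} x * indicator {c<..d} y * g (x, y) \<partial>lborel) = indicator
          {c<..d} y * ?G a b y" for y
        by (subst integral_mult_right_zero[symmetric]) (simp add: mult_ac)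
      show "integrable lborel (\<lambda>y. indicator {c<..d} y * ?G a b y)"
        using lborel_pair.integrable_snd[OF box', of a b c d] by (simp only: *)
      show "(\<integral>y. indicator {c<..d} y * ?G a b y \<partial>lborel) = (\<integral>z. indicator {a<..b} (fst z) *
          indicator {c<..d} (snd z) * g z \<partial>lborel)"
        using lborel_pair.integral_snd[OF box', of a b c d] by (simp add: * lborel_prod case_prod_unfold)
    qed
    show "integrable lborel (\<lambda>y. indicator {c<..d} y * (u (b, y) - u (a, y) - ?G a b y))" for c d
      using Bochner_Integration.integrable_diff[OF i1 i2(1)] by (simp add: right_diff_distrib)
    show "(\<lambda>y. u (b, y) - u (a, y) - ?G a b y) \<in> borel_measurable borel"
      by measurable
    show "(\<integral>y. indicator {c<..d} y * (u (b, y) - u (a, y) - ?G a b y) \<partial>lborel) = 0" if "c \<le> d" for c d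
      unfolding right_diff_distrib[of _ "u (b, _) - u (a, _)"]
      using weak_partial_imp_rectangle_integral[OF u g gi wp ab that] i2(2)[of c d]
        Bochner_Integration.integral_diff[OF i1 i2(1), of c d c d]
      by simp
  qed
  have "AE y in lborel. \<forall>q\<in>\<rat>. \<forall>m::nat. -real m \<le> q \<longrightarrow> u (q, y) - u (-real m, y) - ?G (-real m) q y = 0"
    using eq by (intro AE_ball_countable[THEN iffD2] countable_rat ballI AE_all_countable[THEN
        iffD2] allI) auto
  with slice show ?thesis
  proof eventually_elim
    case (elim y)
    have uy: "isCont (\<lambda>x. u (x, y)) x" for x
    proof -
      have "continuous_on UNIV (\<lambda>x. u (x, y))"
        by (intro continuous_on_compose2[OF u] continuous_intros) auto
      then show ?thesis
        using continuous_on_eq_continuous_at[OF open_UNIV] by blast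
    qed
    have gy[measurable]: "(\<lambda>x. g (x, y)) \<in> borel_measurable borel"
      by measurable
    have int: "integrable lborel (\<lambda>x. indicator {s<..t} x * g (x, y))" for s t
    proof -
      obtain m :: nat where "\<bar>s\<bar> + \<bar>t\<bar> < m" using reals_Archimedean2 by blast
      then have "(\<lambda>x. indicator {s<..t} x *\<^sub>R (indicator {-real m<..real m} x * g (x, y))) = (\<lambda>x.
          indicator {s<..t} x * g (x, y))"
        by (auto simp: fun_eq_iff indicator_def)
      then show ?thesis
        using integrable_mult_indicator[OF _ elim(1)[rule_format, of m], of "{s<..t}"] by (simp
            only: sets_lborel) simp
    qed
    have real_end: "u (t, y) - u (-real m, y) = ?G (-real m) t y" if t: "-real m \<le> t" for t and m :: nat
    proof -
      have "\<exists>q\<in>\<rat>. t < q \<and> q < t + 1 / real (Suc n)" for n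
        by (intro Rats_dense_in_real) simp
      then obtain q where q: "\<And>n. q n \<in> \<rat>" "\<And>n. t < q n" "\<And>n. q n < t + 1 / real (Suc n)"
        by metis
      have "(\<lambda>n. q n - t) \<longlonglongrightarrow> 0"
        by (rule Lim_null_comparison[OF _ LIMSEQ_inverse_real_of_nat])
          (use q in \<open>auto intro!: always_eventually less_imp_le simp: abs_of_pos inverse_eq_divide
              algebra_simps\<close>)
      then have ql: "q \<longlonglongrightarrow> t"
        by (simp add: LIM_zero_iff)
      have "(\<lambda>n. u (q n, y) - u (-real m, y)) \<longlonglongrightarrow> u (t, y) - u (-real m, y)"
        by (intro tendsto_intros isCont_tendsto_compose[OF uy ql])
      moreover have "u (q n, y) - u (-real m, y) = ?G (-real m) (q n) y" for n
      proof -
        have "-real m \<le> q n"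
          using q(2)[of n] t by linarith
        from elim(2)[rule_format, OF q(1) this] show ?thesis
          by (rule eq_iff_diff_eq_0[THEN iffD2])
      qed
      moreover have "(\<lambda>n. ?G (-real m) (q n) y) \<longlonglongrightarrow> ?G (-real m) t y"
      proof (rule integral_dominated_convergence[where w="\<lambda>x. \<bar>indicator {-real m<..t + 1} x * g (x, y)\<bar>"])
        show "integrable lborel (\<lambda>x. \<bar>indicator {-real m<..t + 1} x * g (x, y)\<bar>)"
          by (intro integrable_abs int)
        show "AE x in lborel. (\<lambda>n. indicator {-real m<..q n} x * g (x, y)) \<longlonglongrightarrow> indicator {-real m<..t}
            x * g (x, y)"
        proof (intro AE_I2 tendsto_mult tendsto_const)
          fix x
          have "\<forall>\<^sub>F n in sequentially. indicator {-real m<..t} x = (indicator {-real m<..q n} x :: real)"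
          proof (cases "x \<le> t")
            case True
            then have "x \<le> q n" for n
              using q(2)[of n] by linarith
            then show ?thesis using True by (auto simp: indicator_def)
          next
            case False
            then have "\<forall>\<^sub>F n in sequentially. q n < x"
              by (intro order_tendstoD[OF ql]) auto
            then show ?thesis
              by eventually_elim (use False in \<open>auto simp: indicator_def\<close>)
          qed
          then show "(\<lambda>n. indicator {-real m<..q n} x :: real) \<longlonglongrightarrow> indicator {-real m<..t} x"
            by (rule Lim_transform_eventually[OF tendsto_const])
        qed
        have "q n \<le> t + 1" for n
        proof -
          have "1 / real (Suc n) \<le> 1" by simp
          then show ?thesis using q(3)[of n] by linarith
        qed
        then have "norm (indicator {-real m<..q n} x * g (x, y)) \<le> \<bar>indicator {-real m<..t + 1} x *
            g (x, y)\<bar>" for n x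
          using order_trans[of x "q n" "t + 1"] by (auto simp: indicator_def)
        then show "AE x in lborel. norm (indicator {-real m<..q n} x * g (x, y)) \<le> \<bar>indicator {-real
            m<..t + 1} x * g (x, y)\<bar>" for n
          by (intro AE_I2)
      qed measurable
      ultimately show ?thesis
        using LIMSEQ_unique by simp
    qed
    have ends: "u (t, y) - u (s, y) = ?G s t y" if st: "s \<le> t" for s t
    proof -
      obtain m :: nat where "\<bar>s\<bar> < m" using reals_Archimedean2 by blast
      then have m: "-real m \<le> s" by linarith
      have "?G (-real m) t y = ?G (-real m) s y + ?G s t y"
        by (subst Bochner_Integration.integral_add[OF int int, symmetric], rule
            Bochner_Integration.integral_cong)
          (use m st in \<open>auto simp: indicator_def\<close>)
      then show ?thesis
        using real_end[of m s] real_end[of m t] m st by linarith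
    qed
    show ?case
    proof (intro allI)
      fix a b
      show "abs_continuous_on {a..b} (\<lambda>x. u (x, y))"
      proof (rule abs_continuous_on_indefinite_integral)
        show "u (t, y) - u (s, y) = ?G s t y" if "s \<le> t" for s t
          by (rule ends[OF that])
        have "integrable lborel (\<lambda>x. indicator {a..b} x *\<^sub>R (indicator {a - 1<..b} x * g (x, y)))"
          by (rule integrable_mult_indicator[OF _ int]) auto
        also have "(\<lambda>x. indicator {a..b} x *\<^sub>R (indicator {a - 1<..b} x * g (x, y))) = (\<lambda>x.
            indicator {a..b} x * g (x, y))"
          by (auto simp: fun_eq_iff indicator_def)
        finally show "integrable lborel (\<lambda>x. indicator {a..b} x * g (x, y))" .
      qed
    qed
  qed
qed

section \<open>Square integrability of the derivatives of a quasiconformal map\<close>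

text \<open>The limit of difference quotients along a fixed sequence. It is defined everywhere, Borel measurable
  for continuous \<open>u\<close>, and equal to the directional derivative where \<open>u\<close> is differentiable.\<close>

definition dir_limit :: "(real \<times> real \<Rightarrow> real) \<Rightarrow> real \<times> real \<Rightarrow> real \<times> real \<Rightarrow> real" where
  "dir_limit u v z = lim (\<lambda>n. (u (z + inverse (real (Suc n)) *\<^sub>R v) - u z) * real (Suc n))"

lemma dir_limit_measurable:
  assumes u: "continuous_on UNIV u"
  shows "dir_limit u v \<in> borel_measurable borel"
proof -
  have "(\<lambda>z. (u (z + inverse (real (Suc n)) *\<^sub>R v) - u z) * real (Suc n)) \<in> borel_measurable borel" for n
    by (intro borel_measurable_continuous_onI continuous_intros continuous_on_compose2[OF u] u) auto
  then show ?thesis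
    unfolding dir_limit_def by (intro borel_measurable_lim_metric) auto
qed

lemma dir_limit_eq:
  assumes "(u has_derivative D) (at z)"
  shows "dir_limit u v z = D v" "((\<lambda>t. u (z + t *\<^sub>R v)) has_real_derivative D v) (at 0)"
proof -
  have "((\<lambda>t. z + t *\<^sub>R v) has_derivative (\<lambda>t. t *\<^sub>R v)) (at 0)"
    by (auto intro!: derivative_eq_intros)
  moreover have "(u has_derivative D) (at (z + 0 *\<^sub>R v))"
    using assms by simp
  ultimately have "((\<lambda>t. u (z + t *\<^sub>R v)) has_derivative (\<lambda>t. D (t *\<^sub>R v))) (at 0)"
    by (rule has_derivative_compose)
  also have "(\<lambda>t. D (t *\<^sub>R v)) = (*) (D v)"
    using linear_scale[OF has_derivative_linear[OF assms]] by (auto simp: fun_eq_iff)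
  finally show d: "((\<lambda>t. u (z + t *\<^sub>R v)) has_real_derivative D v) (at 0)"
    by (simp add: has_field_derivative_def)
  then have l: "((\<lambda>h. (u (z + h *\<^sub>R v) - u z) / h) \<longlongrightarrow> D v) (at 0)"
    by (simp add: DERIV_def)
  have "filterlim (\<lambda>n. inverse (real (Suc n))) (at 0) sequentially"
    by (rule filterlim_atI[OF LIMSEQ_inverse_real_of_nat]) auto
  from filterlim_compose[OF l this]
  have "(\<lambda>n. (u (z + inverse (real (Suc n)) *\<^sub>R v) - u z) * real (Suc n)) \<longlonglongrightarrow> D v"
    by (simp add: divide_inverse)
  then show "dir_limit u v z = D v"
    unfolding dir_limit_def by (rule limI)
qed

text \<open>The Jacobian determinant, built from \<open>dir_limit\<close> so that it is Borel measurable.\<close>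

definition jacobian :: "(real \<times> real \<Rightarrow> real \<times> real) \<Rightarrow> real \<times> real \<Rightarrow> real" where
  "jacobian f z = dir_limit (\<lambda>z. fst (f z)) (1, 0) z * dir_limit (\<lambda>z. snd (f z)) (0, 1) z
     - dir_limit (\<lambda>z. fst (f z)) (0, 1) z * dir_limit (\<lambda>z. snd (f z)) (1, 0) z"

lemma jacobian_eq:
  assumes "(f has_derivative D) (at z)"
  shows "jacobian f z = fst (D (1, 0)) * snd (D (0, 1)) - fst (D (0, 1)) * snd (D (1, 0))"
  unfolding jacobian_def
  by (simp add: dir_limit_eq(1)[OF has_derivative_fst[OF assms]] dir_limit_eq(1)[OF
      has_derivative_snd[OF assms]])

lemma jacobian_measurable:
  assumes "continuous_on UNIV f"
  shows "jacobian f \<in> borel_measurable borel"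
  unfolding jacobian_def
  by (intro borel_measurable_diff borel_measurable_times dir_limit_measurable continuous_intros assms)

text \<open>The change-of-variables theorem is stated for \<open>real ^ 'n\<close>; this identification with \<open>real \<times> real\<close>
  preserves Lebesgue measure.\<close>

lemma distr_vec2_lborel:
  "distr (lborel :: (real^2) measure) borel (\<lambda>x. (x $ 1, x $ 2)) = (lborel :: (real \<times> real) measure)"
proof (rule lborel_eqI[symmetric])
  let ?V = "\<lambda>x::real^2. (x $ 1, x $ 2)"
  have V: "?V \<in> borel_measurable borel"
    by (intro borel_measurable_continuous_onI continuous_intros)
  fix l u :: "real \<times> real"
  assume le: "\<And>b. b \<in> Basis \<Longrightarrow> l \<bullet> b \<le> u \<bullet> b"
  have le': "fst l \<le> fst u" "snd l \<le> snd u"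
    using le[of "(1, 0)"] le[of "(0, 1)"] by (auto simp: Basis_prod_def inner_prod_def)
  let ?W = "\<lambda>p::real \<times> real. (\<chi> i. if i = 1 then fst p else snd p) :: real^2"
  have "?V -` box l u = box (?W l) (?W u)"
    by (auto simp: mem_box Basis_prod_def Basis_vec_def inner_axis inner_prod_def forall_2)
  moreover have "emeasure lborel (box (?W l) (?W u)) = (\<Prod>b\<in>Basis. (?W u - ?W l) \<bullet> b)"
    by (rule emeasure_lborel_box) (use le' in \<open>auto simp: Basis_vec_def inner_axis\<close>)
  moreover have "(\<Prod>b\<in>Basis. (?W u - ?W l) \<bullet> b) = (\<Prod>b\<in>Basis. (u - l) \<bullet> b)"
  proof -
    have B: "(Basis :: (real^2) set) = {axis 1 1, axis 2 1}"
      by (auto simp: Basis_vec_def UNIV_2)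
    have "axis 1 1 \<noteq> (axis 2 1 :: real^2)"
      by (simp add: axis_eq_axis)
    then show ?thesis
      by (simp add: B Basis_prod_def inner_axis inner_prod_def)
  qed
  ultimately show "emeasure (distr lborel borel ?V) (box l u) = (\<Prod>b\<in>Basis. (u - l) \<bullet> b)"
    using V by (simp add: emeasure_distr)
qed simp

text \<open>The integral of the Jacobian of an injective map over a ball is at most the area of the image of the
  ball.\<close>

lemma jacobian_locally_integrable:
  assumes f: "continuous_on UNIV f" "inj f" and diff: "AE z in lborel. f differentiable (at z)"
  shows "integrable lborel (\<lambda>z. indicator (cball 0 R) z * \<bar>jacobian f z\<bar>)"
proof -
  obtain N where N: "N \<in> null_sets lborel" and fN: "\<And>z. z \<notin> N \<Longrightarrow> f differentiable (at z)"
    using diff unfolding eventually_ae_filter by auto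
  define D where "D z = frechet_derivative f (at z)" for z
  have D: "(f has_derivative D z) (at z)" if "z \<notin> N" for z
    using fN[OF that] by (simp add: D_def frechet_derivative_works)
  define S where "S = cball 0 R - N"
  have Sb: "S \<in> sets borel"
    using N by (auto simp: S_def)
  define V :: "real^2 \<Rightarrow> real \<times> real" where "V x = (x $ 1, x $ 2)" for x
  define W :: "real \<times> real \<Rightarrow> real^2" where "W p = (\<chi> i. if i = 1 then fst p else snd p)" for p
  have VW: "V (W p) = p" "W (V x) = x" for p x
    by (auto simp: V_def W_def vec_eq_iff forall_2)
  have Vl: "bounded_linear V"
    unfolding V_def by (intro bounded_linear_Pair bounded_linear_vec_nth)
  have Wl: "bounded_linear W"
    by (rule linear_conv_bounded_linear[THEN iffD1], rule linearI) (auto simp: W_def vec_eq_iff)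
  have Vm: "V \<in> borel_measurable borel"
    by (rule borel_measurable_continuous_onI[OF linear_continuous_on[OF Vl]])
  define S' where "S' = V -` S"
  have S'b: "S' \<in> sets borel"
    using measurable_sets[OF Vm Sb] by (simp add: S'_def)
  then have S'l: "S' \<in> sets lebesgue"
    by auto
  define F where "F x = W (f (V x))" for x
  have dF: "(F has_derivative (\<lambda>h. W (D (V x) (V h)))) (at x within S')" if "x \<in> S'" for x
  proof -
    have "(f has_derivative D (V x)) (at (V x))"
      using that by (intro D) (auto simp: S'_def S_def)
    from has_derivative_compose[OF bounded_linear_imp_has_derivative[OF Vl] this]
    have "((\<lambda>x. f (V x)) has_derivative (\<lambda>h. D (V x) (V h))) (at x within S')" .
    from bounded_linear.has_derivative[OF Wl this] show ?thesis
      unfolding F_def .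
  qed
  have injF: "inj_on F S'"
    using f(2) VW unfolding F_def inj_on_def by (metis UNIV_I)
  have "F ` S' \<in> sets lebesgue"
    by (rule differentiable_image_in_sets_lebesgue[OF S'l])
      (use dF in \<open>auto simp: differentiable_on_def differentiable_def\<close>)
  moreover have "bounded (F ` S')"
  proof -
    have "compact ((\<lambda>z. W (f z)) ` cball 0 R)"
      by (intro compact_continuous_image continuous_on_compose2[OF linear_continuous_on[OF Wl]]
          continuous_on_subset[OF f(1)]) auto
    moreover have "F ` S' \<subseteq> (\<lambda>z. W (f z)) ` cball 0 R"
      by (auto simp: F_def S'_def S_def)
    ultimately show ?thesis
      using bounded_subset compact_imp_bounded by blast
  qed
  ultimately have "F ` S' \<in> lmeasurable"
    by (intro bounded_set_imp_lmeasurable)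
  then have "(\<lambda>x. \<bar>det (matrix (\<lambda>h. W (D (V x) (V h))))\<bar>) absolutely_integrable_on S'"
    using measurable_differentiable_image_alt[OF S'l dF injF] by blast
  then have "integrable lebesgue (\<lambda>x. indicator S' x *\<^sub>R \<bar>det (matrix (\<lambda>h. W (D (V x) (V h))))\<bar>)"
    by (simp add: set_integrable_def)
  also have "(\<lambda>x. indicator S' x *\<^sub>R \<bar>det (matrix (\<lambda>h. W (D (V x) (V h))))\<bar>)
     = (\<lambda>x. indicator S (V x) * \<bar>jacobian f (V x)\<bar>)"
  proof
    fix x
    show "indicator S' x *\<^sub>R \<bar>det (matrix (\<lambda>h. W (D (V x) (V h))))\<bar> = indicator S (V x) * \<bar>jacobian
        f (V x)\<bar>"
    proof (cases "V x \<in> S")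
      case True
      have V1: "V (axis 1 1) = (1, 0)" "V (axis 2 1) = (0, 1)"
        by (auto simp: V_def axis_def)
      have "det (matrix (\<lambda>h. W (D (V x) (V h)))) = jacobian f (V x)"
        using True by (subst jacobian_eq[OF D]) (auto simp: S_def det_2 matrix_def V1 W_def)
      then show ?thesis using True by (simp add: S'_def)
    next
      case False
      then show ?thesis by (simp add: S'_def)
    qed
  qed
  finally have i: "integrable lebesgue (\<lambda>x. indicator S (V x) * \<bar>jacobian f (V x)\<bar>)" .
  have hm: "(\<lambda>z. indicator S z * \<bar>jacobian f z\<bar>) \<in> borel_measurable borel"
    by (intro borel_measurable_times borel_measurable_indicator Sb borel_measurable_abs
        jacobian_measurable f)
  have "integrable lborel (\<lambda>x. indicator S (V x) * \<bar>jacobian f (V x)\<bar>)"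
    using i measurable_compose[OF Vm hm] by (subst (asm) integrable_completion) auto
  then have "integrable (distr lborel borel V) (\<lambda>z. indicator S z * \<bar>jacobian f z\<bar>)"
    using Vm hm by (subst integrable_distr_eq) auto
  also have "distr lborel borel V = lborel"
    using distr_vec2_lborel unfolding V_def .
  finally show ?thesis
  proof (rule Bochner_Integration.integrable_cong_AE_imp)
    show "(\<lambda>z. indicator (cball 0 R) z * \<bar>jacobian f z\<bar>) \<in> borel_measurable lborel"
      using f by (auto intro!: borel_measurable_times borel_measurable_indicator
          borel_measurable_abs jacobian_measurable)
    show "AE z in lborel. indicator S z * \<bar>jacobian f z\<bar> = indicator (cball 0 R) z * \<bar>jacobian f z\<bar>"
      using AE_not_in[OF N] by eventually_elim (auto simp: S_def indicator_def)
  qed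
qed

text \<open>In the plane \<open>max \<bar>D v\<bar> * min \<bar>D v\<bar> = \<bar>det D\<bar>\<close> over unit vectors \<open>v\<close>; only the estimate
  \<open>(min \<bar>D v\<bar>)\<^sup>2 \<le> \<bar>det D\<bar>\<close> is needed.\<close>

lemma norm_square_le_dilatation:
  fixes D :: "real \<times> real \<Rightarrow> real \<times> real"
  assumes D: "bounded_linear D"
    and C: "(SUP v\<in>sphere 0 1. norm (D v)) \<le> C * (INF v\<in>sphere 0 1. norm (D v))"
    and e: "norm e = 1"
  shows "(norm (D e))\<^sup>2 \<le> C\<^sup>2 * \<bar>fst (D (1, 0)) * snd (D (0, 1)) - fst (D (0, 1)) * snd (D (1, 0))\<bar>"
proof -
  define m where "m = (INF v\<in>sphere 0 1. norm (D v))"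
  have ne: "sphere (0 :: real \<times> real) 1 \<noteq> {}"
    using e by (auto intro!: exI[of _ e])
  obtain K where K: "\<And>v. norm (D v) \<le> norm v * K"
    using bounded_linear.bounded[OF D] by blast
  have "bdd_above ((\<lambda>v. norm (D v)) ` sphere 0 1)"
    using K by (intro bdd_aboveI2[where M=K]) (metis mem_sphere_0 mult_1)
  then have "norm (D e) \<le> (SUP v\<in>sphere 0 1. norm (D v))"
    using e by (intro cSUP_upper) auto
  then have "norm (D e) \<le> C * m"
    using C by (simp add: m_def)
  then have "(norm (D e))\<^sup>2 \<le> (C * m)\<^sup>2"
    by (intro power_mono) auto
  also have "\<dots> = C\<^sup>2 * m\<^sup>2"
    by (simp add: power_mult_distrib)
  also have "m\<^sup>2 \<le> \<bar>fst (D (1, 0)) * snd (D (0, 1)) - fst (D (0, 1)) * snd (D (1, 0))\<bar>"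
  proof -
    have m0: "m \<ge> 0"
      unfolding m_def using ne by (intro cINF_greatest) auto
    have m1: "m \<le> norm (D v)" if "norm v = 1" for v
      unfolding m_def using that by (intro cINF_lower bdd_belowI2[where m=0]) auto
    have ml: "m * norm v \<le> norm (D v)" for v
    proof (cases "v = 0")
      case False
      have "D ((1 / norm v) *\<^sub>R v) = (1 / norm v) *\<^sub>R D v"
        by (rule linear_scale[OF bounded_linear.linear[OF D]])
      then have "m \<le> norm (D v) / norm v"
        using m1[of "(1 / norm v) *\<^sub>R v"] False by simp
      then show ?thesis
        using False by (simp add: field_simps)
    qed simp
    obtain a1 a2 where a: "D (1, 0) = (a1, a2)" by (cases "D (1, 0)")
    obtain b1 b2 where b: "D (0, 1) = (b1, b2)" by (cases "D (0, 1)")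
    define J where "J = a1 * b2 - b1 * a2"
    define A where "A = norm (a1, a2)"
    have mA: "m \<le> A"
      using m1[of "(1, 0)"] a by (simp add: A_def)
    have "m\<^sup>2 \<le> \<bar>J\<bar>"
    proof (cases "A = 0")
      case True
      then show ?thesis using m0 mA by simp
    next
      case False
      then have A: "A > 0" by (simp add: A_def)
      have A2: "A\<^sup>2 = a1\<^sup>2 + a2\<^sup>2"
        by (simp add: A_def norm_Pair)
      \<comment> \<open>\<open>D (-t, 1)\<close> is the component of \<open>D (0, 1)\<close> orthogonal to \<open>D (1, 0)\<close>\<close>
      define t where "t = (a1 * b1 + a2 * b2) / A\<^sup>2"
      have "D (- t, 1) = D ((- t) *\<^sub>R (1, 0) + (0, 1))" by simp
      also have "\<dots> = (- t) *\<^sub>R D (1, 0) + D (0, 1)"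
        using bounded_linear.linear[OF D] by (simp only: linear_add linear_scale)
      also have "\<dots> = (J / A\<^sup>2) *\<^sub>R (- a2, a1)"
      proof -
        define Q where "Q = A\<^sup>2"
        have Q: "Q \<noteq> 0" "Q = a1\<^sup>2 + a2\<^sup>2"
          using A A2 by (auto simp: Q_def)
        have "- ((a1 * b1 + a2 * b2) / Q) * a1 + b1 = J / Q * (- a2)"
          using Q(1) by (simp add: field_simps) (simp add: Q(2) J_def power2_eq_square algebra_simps)
        moreover have "- ((a1 * b1 + a2 * b2) / Q) * a2 + b2 = J / Q * a1"
          using Q(1) by (simp add: field_simps) (simp add: Q(2) J_def power2_eq_square algebra_simps)
        ultimately show ?thesis
          by (simp add: a b t_def flip: Q_def)
      qed
      finally have Dv: "D (- t, 1) = (J / A\<^sup>2) *\<^sub>R (- a2, a1)" .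
      have nA: "norm (- a2, a1) = A"
        by (simp add: A_def norm_Pair add.commute)
      have "norm (D (- t, 1)) = \<bar>J / A\<^sup>2\<bar> * norm (- a2, a1)"
        unfolding Dv by (rule norm_scaleR)
      also have "\<dots> = \<bar>J\<bar> / A"
        using A unfolding nA by (simp add: power2_eq_square)
      finally have nD: "norm (D (- t, 1)) = \<bar>J\<bar> / A" .
      have "1 \<le> norm (- t, 1 :: real)"
        using norm_snd_le[of "1::real" "- t"] by simp
      then have "m * 1 \<le> m * norm (- t, 1 :: real)"
        using m0 by (rule mult_left_mono)
      then have "m \<le> \<bar>J\<bar> / A"
        using ml[of "(- t, 1)"] nD by simp
      then have "m * A \<le> \<bar>J\<bar>"
        using A by (simp add: field_simps)
      moreover have "m * m \<le> m * A"
        using mA m0 by (rule mult_left_mono)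
      ultimately show ?thesis
        by (simp add: power2_eq_square)
    qed
    then show ?thesis
      by (simp add: a b J_def)
  qed
  finally show ?thesis
    by (simp add: mult_left_mono)
qed

section \<open>Exchange of the coordinates\<close>

lemma smooth_compose_linear:
  fixes \<psi> :: "'b::euclidean_space \<Rightarrow> real" and L :: "'a::euclidean_space \<Rightarrow> 'b"
  assumes "smooth \<psi>" and L: "bounded_linear L"
  shows "smooth (\<lambda>z. \<psi> (L z))"
  unfolding smooth_def
proof
  fix k
  have "C_k k \<psi>"
    using assms by (simp add: smooth_def)
  then show "C_k k (\<lambda>z. \<psi> (L z))"
  proof (induction k arbitrary: \<psi>)
    case 0
    then show ?case
      using continuous_on_compose2[of UNIV \<psi> UNIV L] linear_continuous_on[OF L] by simp
  next
    case (Suc k)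
    have d: "(\<psi> has_derivative frechet_derivative \<psi> (at x)) (at x)" for x
      using Suc.prems by (auto simp: frechet_derivative_works[symmetric])
    show ?case
      by (rule C_k_SucI[OF has_derivative_compose[OF bounded_linear_imp_has_derivative[OF L] d]],
          rule Suc.IH)
        (use Suc.prems in auto)
  qed
qed

lemma bounded_linear_swap: "bounded_linear (prod.swap :: real \<times> real \<Rightarrow> real \<times> real)"
proof -
  have eq: "prod.swap = (\<lambda>z::real \<times> real. (snd z, fst z))"
    by (auto simp: prod.swap_def)
  show ?thesis
    unfolding eq by (intro bounded_linear_Pair bounded_linear_fst bounded_linear_snd)
qed

lemma distr_swap_lborel:
  "distr lborel borel prod.swap = (lborel :: (real \<times> real) measure)"
proof -
  have "distr (lborel \<Otimes>\<^sub>M lborel) (lborel \<Otimes>\<^sub>M lborel) (\<lambda>(x, y). (y, x)) = (lborel :: (real \<times> real) measure)"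
    by (subst lborel_pair.distr_pair_swap[symmetric]) (rule lborel_prod)
  moreover have "(\<lambda>(x, y). (y, x)) = (prod.swap :: real \<times> real \<Rightarrow> real \<times> real)"
    by auto
  ultimately show ?thesis
    unfolding lborel_prod by (metis distr_cong sets_lborel)
qed

lemma swap_measurable: "prod.swap \<in> borel_measurable (borel :: (real \<times> real) measure)"
  by (rule borel_measurable_continuous_onI[OF linear_continuous_on[OF bounded_linear_swap]])

lemma integral_swap:
  fixes h :: "real \<times> real \<Rightarrow> real"
  assumes "h \<in> borel_measurable borel"
  shows "(\<integral>z. h (prod.swap z) \<partial>lborel) = (\<integral>z. h z \<partial>lborel)"
    "integrable lborel (\<lambda>z. h (prod.swap z)) \<longleftrightarrow> integrable lborel h"
proof -
  have m: "prod.swap \<in> measurable lborel (borel :: (real \<times> real) measure)"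
    using swap_measurable by simp
  show "(\<integral>z. h (prod.swap z) \<partial>lborel) = (\<integral>z. h z \<partial>lborel)"
    using integral_distr[OF m assms] by (simp add: distr_swap_lborel)
  show "integrable lborel (\<lambda>z. h (prod.swap z)) \<longleftrightarrow> integrable lborel h"
    using integrable_distr_eq[OF m assms] by (simp add: distr_swap_lborel)
qed

lemma lebesgue_integral_eq_lborel:
  fixes h :: "'a::euclidean_space \<Rightarrow> real"
  shows "h \<in> borel_measurable borel \<Longrightarrow> (\<integral>z. h z \<partial>lebesgue) = (\<integral>z. h z \<partial>lborel)"
  by (rule integral_completion) simp

lemma weak_partial_swap:
  fixes u g :: "real \<times> real \<Rightarrow> real"
  assumes u: "continuous_on UNIV u" and g: "g \<in> borel_measurable borel" and wp: "weak_partial \<Omega> b u g"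
  shows "weak_partial (prod.swap -` \<Omega>) (prod.swap b) (\<lambda>z. u (prod.swap z)) (\<lambda>z. g (prod.swap z))"
  unfolding weak_partial_def
proof
  fix \<psi> assume \<psi>: "\<psi> \<in> test_functions (prod.swap -` \<Omega>)"
  then have s: "smooth \<psi>"
    by (auto simp: test_functions_def smooth_def)
  define \<phi> where "\<phi> z = \<psi> (prod.swap z)" for z
  have s\<phi>: "smooth \<phi>"
    unfolding \<phi>_def by (rule smooth_compose_linear[OF s bounded_linear_swap])
  let ?K = "closure {z. \<psi> z \<noteq> 0}"
  have K: "compact ?K" "?K \<subseteq> prod.swap -` \<Omega>"
    using \<psi> by (auto simp: test_functions_def)
  obtain R where R: "\<And>z. z \<in> ?K \<Longrightarrow> norm z \<le> R"
    using compact_imp_bounded[OF K(1)] unfolding bounded_iff by blast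
  have "\<phi> \<in> test_functions \<Omega>"
  proof (rule test_functionsI[where R=R and C="prod.swap -` ?K", OF s\<phi>])
    show "closed (prod.swap -` ?K)"
      by (rule closed_vimage[OF closed_closure linear_continuous_on[OF bounded_linear_swap]])
    show "prod.swap -` ?K \<subseteq> \<Omega>"
      using K(2) by auto
    fix z assume "\<phi> z \<noteq> 0"
    then have "prod.swap z \<in> ?K"
      using closure_subset[of "{z. \<psi> z \<noteq> 0}"] by (auto simp: \<phi>_def)
    moreover have "norm (prod.swap z) = norm z"
      by (cases z) (simp add: norm_Pair add.commute)
    ultimately show "norm z \<le> R \<and> z \<in> prod.swap -` ?K"
      using R[of "prod.swap z"] by simp
  qed
  then have eq: "(\<integral>z. u z * frechet_derivative \<phi> (at z) b \<partial>lebesgue) = - (\<integral>z. \<phi> z * g z \<partial>lebesgue)"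
    using wp by (simp add: weak_partial_def)
  have fr: "frechet_derivative \<phi> (at z) b = frechet_derivative \<psi> (at (prod.swap z)) (prod.swap b)" for z
  proof -
    have "(\<phi> has_derivative (\<lambda>v. frechet_derivative \<psi> (at (prod.swap z)) (prod.swap v))) (at z)"
      unfolding \<phi>_def
      by (rule has_derivative_compose[OF bounded_linear_imp_has_derivative[OF bounded_linear_swap]
          smooth_has_derivative[OF s]])
    from frechet_derivative_at[OF this] show ?thesis by metis
  qed
  have usw: "continuous_on UNIV (\<lambda>z. u (prod.swap z))"
    by (rule continuous_on_compose2[OF u linear_continuous_on[OF bounded_linear_swap]]) auto
  have gsw: "(\<lambda>z. g (prod.swap z)) \<in> borel_measurable borel"
    by (rule measurable_compose[OF swap_measurable g])
  have m1: "(\<lambda>z. u (prod.swap z) * frechet_derivative \<psi> (at z) (prod.swap b)) \<in> borel_measurable borel"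
    by (intro borel_measurable_continuous_onI continuous_intros usw smooth_continuous smooth_frechet s)
  have m1': "(\<lambda>z. u z * frechet_derivative \<phi> (at z) b) \<in> borel_measurable borel"
    by (intro borel_measurable_continuous_onI continuous_intros u smooth_continuous smooth_frechet s\<phi>)
  have m2: "(\<lambda>z. \<psi> z * g (prod.swap z)) \<in> borel_measurable borel"
    by (intro borel_measurable_times gsw borel_measurable_continuous_onI smooth_continuous s)
  have m2': "(\<lambda>z. \<phi> z * g z) \<in> borel_measurable borel"
    by (intro borel_measurable_times g borel_measurable_continuous_onI smooth_continuous s\<phi>)
  have "(\<integral>z. u (prod.swap z) * frechet_derivative \<psi> (at z) (prod.swap b) \<partial>lborel)
      = (\<integral>z. u z * frechet_derivative \<phi> (at z) b \<partial>lborel)"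
    using integral_swap(1)[OF m1] by (simp add: fr)
  moreover have "(\<integral>z. \<psi> z * g (prod.swap z) \<partial>lborel) = (\<integral>z. \<phi> z * g z \<partial>lborel)"
    using integral_swap(1)[OF m2] by (simp add: \<phi>_def)
  ultimately show "(\<integral>z. u (prod.swap z) * frechet_derivative \<psi> (at z) (prod.swap b) \<partial>lebesgue)
     = - (\<integral>z. \<psi> z * g (prod.swap z) \<partial>lebesgue)"
    using eq by (simp add: lebesgue_integral_eq_lborel m1 m1' m2 m2')
qed

section \<open>Quasiconformal removability\<close>

lemma ACL_imp_weak_partial:
  fixes u g :: "real \<times> real \<Rightarrow> real"
  assumes u: "continuous_on UNIV u" and g: "g \<in> borel_measurable borel" "locally_Lp 2 g" and \<Omega>: "open \<Omega>"
    and deriv: "AE z in lborel. z \<in> \<Omega> \<longrightarrow> ((\<lambda>x. u (x, snd z)) has_real_derivative g z) (at (fst z))"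
    and acl: "AE y in lborel. \<forall>a b. {a..b} \<times> {y} \<subseteq> \<Omega> \<longrightarrow> abs_continuous_on {a..b} (\<lambda>x. u (x, y))"
  shows "weak_partial \<Omega> (1, 0) u g"
  unfolding weak_partial_def
proof
  fix \<psi> assume \<psi>: "\<psi> \<in> test_functions \<Omega>"
  then have s: "smooth \<psi>" and K: "compact (closure {z. \<psi> z \<noteq> 0})" "closure {z. \<psi> z \<noteq> 0} \<subseteq> \<Omega>"
    by (auto simp: test_functions_def smooth_def)
  have out: "\<psi> z = 0" if "z \<notin> closure {z. \<psi> z \<noteq> 0}" for z
    using that closure_subset[of "{z. \<psi> z \<noteq> 0}"] by blast
  have \<psi>m: "\<psi> \<in> borel_measurable borel"
    by (rule borel_measurable_continuous_onI[OF smooth_continuous[OF s]])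
  obtain R where R: "\<And>z. z \<in> closure {z. \<psi> z \<noteq> 0} \<Longrightarrow> norm z \<le> R"
    using compact_imp_bounded[OF K(1)] unfolding bounded_iff by blast
  then have R0: "\<psi> z = 0" if "norm z > R" for z
    using out[of z] that by (meson not_le)
  obtain B where B: "\<And>z. \<bar>\<psi> z\<bar> \<le> B"
    using continuous_bounded_support(1)[OF smooth_continuous[OF s] R0] by blast
  have "integrable lebesgue (\<lambda>z. \<psi> z * g z)"
    by (rule integrable_mult_locally_Lp[OF g(2) _ \<psi>m B R0]) simp
  moreover have m2: "(\<lambda>z. \<psi> z * g z) \<in> borel_measurable borel"
    by (intro borel_measurable_times \<psi>m g)
  ultimately have int: "integrable lborel (\<lambda>z. \<psi> z * g z)"
    by (subst (asm) integrable_completion) auto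
  have c: "continuous_on UNIV (\<lambda>z. frechet_derivative \<psi> (at z) (1, 0))"
    by (intro smooth_continuous smooth_frechet s)
  have d: "((\<lambda>x. \<psi> (x, y)) has_real_derivative frechet_derivative \<psi> (at (x, y)) (1, 0)) (at x)" for x y
  proof -
    have "((\<lambda>x. (x, y)) has_derivative (\<lambda>t. (t, 0))) (at x)"
      by (auto intro!: derivative_eq_intros)
    from has_derivative_compose[OF this smooth_has_derivative[OF s]]
    have "((\<lambda>x. \<psi> (x, y)) has_derivative (\<lambda>t. frechet_derivative \<psi> (at (x, y)) (t, 0))) (at x)" .
    also have "(\<lambda>t. frechet_derivative \<psi> (at (x, y)) (t, 0)) = (*) (frechet_derivative \<psi> (at (x, y))
        (1, 0))"
    proof
      fix t
      show "frechet_derivative \<psi> (at (x, y)) (t, 0) = frechet_derivative \<psi> (at (x, y)) (1, 0) * t"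
        using linear_scale[OF has_derivative_linear[OF smooth_has_derivative[OF s, of "(x, y)"]], of
            t "(1, 0)"]
        by (simp add: mult.commute)
    qed
    finally show ?thesis
      by (simp add: has_field_derivative_def)
  qed
  have "(\<integral>z. u z * frechet_derivative \<psi> (at z) (1, 0) \<partial>lborel) = - (\<integral>z. \<psi> z * g z \<partial>lborel)"
    by (rule ACL_imp_weak_derivative[OF u g(1) \<Omega> deriv acl c d K out int])
  moreover have "(\<lambda>z. u z * frechet_derivative \<psi> (at z) (1, 0)) \<in> borel_measurable borel"
    by (intro borel_measurable_continuous_onI continuous_intros u c)
  ultimately show "(\<integral>z. u z * frechet_derivative \<psi> (at z) (1, 0) \<partial>lebesgue) = - (\<integral>z. \<psi> z * g z \<partial>lebesgue)"
    by (simp add: lebesgue_integral_eq_lborel m2)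
qed

lemma locally_Lp_swap:
  fixes g :: "real \<times> real \<Rightarrow> real"
  assumes g: "g \<in> borel_measurable borel" "locally_Lp p g"
  shows "locally_Lp p (\<lambda>z. g (prod.swap z))"
proof -
  have gsw: "(\<lambda>z. g (prod.swap z)) \<in> borel_measurable borel"
    by (rule measurable_compose[OF swap_measurable g(1)])
  have m: "(\<lambda>z. indicator (cball 0 R) z * \<bar>g z\<bar> powr p) \<in> borel_measurable borel" for R
    by (intro borel_measurable_times borel_measurable_indicator) (simp, use g(1) in measurable)
  have m': "(\<lambda>z. indicator (cball 0 R) z * \<bar>g (prod.swap z)\<bar> powr p) \<in> borel_measurable borel" for R
    by (intro borel_measurable_times borel_measurable_indicator) (simp, use gsw in measurable)
  have "indicator (cball 0 R) (prod.swap z) = (indicator (cball 0 R) z :: real)" for R and z ::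
      "real \<times> real"
    by (cases z) (simp add: indicator_def norm_Pair add.commute)
  then have "integrable lborel (\<lambda>z. indicator (cball 0 R) z * \<bar>g (prod.swap z)\<bar> powr p)
     \<longleftrightarrow> integrable lborel (\<lambda>z. indicator (cball 0 R) z * \<bar>g z\<bar> powr p)" for R
    using integral_swap(2)[OF m, of R] by simp
  moreover have "integrable lborel (\<lambda>z. indicator (cball 0 R) z * \<bar>g z\<bar> powr p)" for R
    using g(2) m by (simp add: locally_Lp_def integrable_completion)
  ultimately show ?thesis
    using m' borel_measurable_lebesgueI[OF gsw] by (simp add: locally_Lp_def integrable_completion)
qed

text \<open>A function that is absolutely continuous on lines off the graph, with square integrable derivatives,
  has weak derivatives off the graph, hence on the plane, hence is absolutely continuous on lines.\<close>

lemma abs_continuous_across_graph: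
  fixes u g1 g2 :: "real \<times> real \<Rightarrow> real"
  assumes fm: "fine_modulus 2 f" and u: "continuous_on UNIV u"
    and g1: "g1 \<in> borel_measurable borel" "locally_Lp 2 g1"
    and g2: "g2 \<in> borel_measurable borel" "locally_Lp 2 g2"
    and d1: "AE z in lborel. ((\<lambda>x. u (x, snd z)) has_real_derivative g1 z) (at (fst z))"
    and d2: "AE z in lborel. ((\<lambda>y. u (fst z, y)) has_real_derivative g2 z) (at (snd z))"
    and a1: "AE y in lborel. \<forall>a b. {a..b} \<times> {y} \<subseteq> - unit_graph f \<longrightarrow> abs_continuous_on {a..b} (\<lambda>x. u (x, y))"
    and a2: "AE x in lborel. \<forall>a b. {x} \<times> {a..b} \<subseteq> - unit_graph f \<longrightarrow> abs_continuous_on {a..b} (\<lambda>y. u (x, y))"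
  shows "AE y in lborel. \<forall>a b. abs_continuous_on {a..b} (\<lambda>x. u (x, y))"
    "AE x in lborel. \<forall>a b. abs_continuous_on {a..b} (\<lambda>y. u (x, y))"
proof -
  let ?O = "- unit_graph f"
  let ?u = "\<lambda>z. u (prod.swap z)" and ?g = "\<lambda>z. g2 (prod.swap z)"
  have O: "open ?O"
    using unit_graph_compact_null(1)[OF fine_modulus_continuous[OF fm]] compact_imp_closed by (auto
        simp: open_Compl)
  have usw: "continuous_on UNIV ?u"
    by (rule continuous_on_compose2[OF u linear_continuous_on[OF bounded_linear_swap]]) auto
  have gsw: "?g \<in> borel_measurable borel"
    by (rule measurable_compose[OF swap_measurable g2(1)])
  note gL = locally_Lp_swap[OF g2]
  have wp1: "weak_partial ?O (1, 0) u g1"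
    by (rule ACL_imp_weak_partial[OF u g1 O _ a1]) (use d1 in eventually_elim, simp)
  have "weak_partial (prod.swap -` ?O) (1, 0) ?u ?g"
  proof (rule ACL_imp_weak_partial[OF usw gsw gL])
    show "open (prod.swap -` ?O)"
      by (rule open_vimage[OF O linear_continuous_on[OF bounded_linear_swap]])
    show "AE z in lborel. z \<in> prod.swap -` ?O \<longrightarrow> ((\<lambda>x. ?u (x, snd z)) has_real_derivative ?g z) (at (fst z))"
      using AE_lborel_swap[OF d2] by eventually_elim (simp add: prod.swap_def)
    show "AE y in lborel. \<forall>a b. {a..b} \<times> {y} \<subseteq> prod.swap -` ?O \<longrightarrow> abs_continuous_on {a..b} (\<lambda>x. ?u (x, y))"
      using a2
    proof eventually_elim
      case (elim y)
      show ?case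
      proof (intro allI impI)
        fix a b assume "{a..b} \<times> {y} \<subseteq> prod.swap -` ?O"
        then have "{y} \<times> {a..b} \<subseteq> ?O" by auto
        then show "abs_continuous_on {a..b} (\<lambda>x. ?u (x, y))"
          using elim by simp
      qed
    qed
  qed
  from weak_partial_swap[OF usw gsw this] have wp2: "weak_partial ?O (0, 1) u g2"
    by (simp add: vimage_def Compl_eq)
  have pq: "(2::real) > 1" "1 / (2::real) + 1 / 2 = 1" by auto
  note wp = weak_partial_across_graph[OF pq fm u g1(2) g2(2) wp1 wp2]
  have gi: "integrable lborel (\<lambda>z. indicator (cball 0 R) z * g z)"
    if "g \<in> borel_measurable borel" "locally_Lp 2 g" for g :: "real \<times> real \<Rightarrow> real" and R
  proof -
    have "integrable lebesgue (\<lambda>z. indicator (cball 0 R) z * g z)"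
      by (rule integrable_mult_locally_Lp[OF that(2), where B=1 and R=R]) (auto simp: indicator_def)
    moreover have "(\<lambda>z. indicator (cball 0 R) z * g z) \<in> borel_measurable borel"
      using that by (intro borel_measurable_times borel_measurable_indicator) auto
    ultimately show ?thesis
      by (simp add: integrable_completion)
  qed
  show "AE y in lborel. \<forall>a b. abs_continuous_on {a..b} (\<lambda>x. u (x, y))"
    by (rule weak_partial_imp_abs_continuous[OF u g1(1) gi[OF g1] wp(1)])
  have "weak_partial UNIV (1, 0) ?u ?g"
    using weak_partial_swap[OF u g2(1) wp(2)] by simp
  from weak_partial_imp_abs_continuous[OF usw gsw gi[OF gsw gL] this]
  show "AE x in lborel. \<forall>a b. abs_continuous_on {a..b} (\<lambda>y. u (x, y))"
    by simp
qed

lemma abs_continuous_on_Pair_iff: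
  fixes f :: "real \<Rightarrow> real \<times> real"
  shows "abs_continuous_on S f \<longleftrightarrow> abs_continuous_on S (\<lambda>x. fst (f x)) \<and> abs_continuous_on S (\<lambda>x. snd (f x))"
proof (intro iffI conjI)
  have *: "abs_continuous_on S k" if ac: "abs_continuous_on S f" and k: "\<And>x y. dist (k x) (k y) \<le>
      dist (f x) (f y)"
    for k :: "real \<Rightarrow> real"
    unfolding abs_continuous_on_def
  proof (intro allI impI)
    fix e :: real assume "e > 0"
    then obtain d where d: "d > 0" "\<And>D. D division_of (\<Union>D) \<Longrightarrow> \<Union>D \<subseteq> S \<Longrightarrow> (\<Sum>I\<in>D. measure lborel I) < d \<Longrightarrow>
        (\<Sum>I\<in>D. dist (f (Inf I)) (f (Sup I))) < e"
      using ac unfolding abs_continuous_on_def by blast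
    have "(\<Sum>I\<in>D. dist (k (Inf I)) (k (Sup I))) \<le> (\<Sum>I\<in>D. dist (f (Inf I)) (f (Sup I)))" for D
      by (intro sum_mono k)
    with d show "\<exists>\<delta>>0. \<forall>D. D division_of (\<Union>D) \<longrightarrow> \<Union>D \<subseteq> S \<longrightarrow> (\<Sum>I\<in>D. measure lborel I) < \<delta> \<longrightarrow>
        (\<Sum>I\<in>D. dist (k (Inf I)) (k (Sup I))) < e"
      by (intro exI[of _ d]) (meson le_less_trans)
  qed
  show "abs_continuous_on S (\<lambda>x. fst (f x))" "abs_continuous_on S (\<lambda>x. snd (f x))" if
      "abs_continuous_on S f"
    by (rule *[OF that], rule dist_fst_le dist_snd_le)+
  assume A: "abs_continuous_on S (\<lambda>x. fst (f x)) \<and> abs_continuous_on S (\<lambda>x. snd (f x))"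
  show "abs_continuous_on S f"
    unfolding abs_continuous_on_def
  proof (intro allI impI)
    fix e :: real assume "e > 0"
    then have e2: "e / 2 > 0" by simp
    obtain d1 where d1: "d1 > 0" "\<And>D. D division_of (\<Union>D) \<Longrightarrow> \<Union>D \<subseteq> S \<Longrightarrow> (\<Sum>I\<in>D. measure lborel I) < d1 \<Longrightarrow>
        (\<Sum>I\<in>D. dist (fst (f (Inf I))) (fst (f (Sup I)))) < e / 2"
      using A e2 unfolding abs_continuous_on_def by blast
    obtain d2 where d2: "d2 > 0" "\<And>D. D division_of (\<Union>D) \<Longrightarrow> \<Union>D \<subseteq> S \<Longrightarrow> (\<Sum>I\<in>D. measure lborel I) < d2 \<Longrightarrow>
        (\<Sum>I\<in>D. dist (snd (f (Inf I))) (snd (f (Sup I)))) < e / 2"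
      using A e2 unfolding abs_continuous_on_def by blast
    have dist: "dist p q \<le> dist (fst p) (fst q) + dist (snd p) (snd q)" for p q :: "real \<times> real"
      unfolding dist_prod_def by (rule real_le_lsqrt) (auto simp: power2_sum)
    show "\<exists>\<delta>>0. \<forall>D. D division_of (\<Union>D) \<longrightarrow> \<Union>D \<subseteq> S \<longrightarrow> (\<Sum>I\<in>D. measure lborel I) < \<delta> \<longrightarrow>
        (\<Sum>I\<in>D. dist (f (Inf I)) (f (Sup I))) < e"
    proof (intro exI[of _ "min d1 d2"] conjI allI impI)
      fix D assume D: "D division_of (\<Union>D)" "\<Union>D \<subseteq> S" "(\<Sum>I\<in>D. measure lborel I) < min d1 d2"
      have "(\<Sum>I\<in>D. dist (f (Inf I)) (f (Sup I)))
         \<le> (\<Sum>I\<in>D. dist (fst (f (Inf I))) (fst (f (Sup I))) + dist (snd (f (Inf I))) (snd (f (Sup I))))"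
        by (intro sum_mono dist)
      also have "\<dots> < e"
        unfolding sum.distrib using d1(2)[OF D(1,2)] d2(2)[OF D(1,2)] D(3) by linarith
      finally show "(\<Sum>I\<in>D. dist (f (Inf I)) (f (Sup I))) < e" .
    qed (use d1 d2 in auto)
  qed
qed

lemma dir_deriv_eq:
  assumes "(f has_derivative D) (at z)"
  shows "dir_deriv f z v = D v"
proof -
  have "((\<lambda>t. z + t *\<^sub>R v) has_derivative (\<lambda>t. t *\<^sub>R v)) (at 0)"
    by (auto intro!: derivative_eq_intros)
  moreover have "(f has_derivative D) (at (z + 0 *\<^sub>R v))"
    using assms by simp
  ultimately have "((\<lambda>t. f (z + t *\<^sub>R v)) has_derivative (\<lambda>t. D (t *\<^sub>R v))) (at 0)"
    by (rule has_derivative_compose)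
  also have "(\<lambda>t. D (t *\<^sub>R v)) = (\<lambda>t. t *\<^sub>R D v)"
    using linear_scale[OF has_derivative_linear[OF assms]] by (auto simp: fun_eq_iff)
  finally show ?thesis
    unfolding dir_deriv_def by (intro vector_derivative_at) (simp add: has_vector_derivative_def)
qed

text \<open>Off the null graph the map is differentiable with bounded dilatation almost everywhere, which is then
  true on the plane. What remains is absolute continuity on lines, and this is shown for each component.\<close>

lemma qc_removable_unit_graph:
  assumes fm: "fine_modulus 2 \<gamma>"
  shows "qc_removable (unit_graph \<gamma>)"
  unfolding qc_removable_def
proof (intro conjI allI impI)
  let ?O = "- unit_graph \<gamma>"
  note G = unit_graph_compact_null[OF fine_modulus_continuous[OF fm]]
  show "compact (unit_graph \<gamma>)"
    by (rule G)
  fix f assume "\<exists>g. homeomorphism UNIV UNIV f g" and qc: "quasiconformal ?O (f ` ?O) f"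
  then obtain g where hom: "homeomorphism UNIV UNIV f g" by blast
  have f: "continuous_on UNIV f" "inj f"
    using hom unfolding homeomorphism_def by (blast, metis injI UNIV_I)
  have ae: "AE z in lborel. z \<in> ?O"
    using AE_not_in[OF G(2)] by simp
  have diff: "AE z in lborel. f differentiable (at z)"
    using qc ae unfolding quasiconformal_def AE_completion_iff by (auto elim: eventually_elim2)
  obtain C where "AE x in lborel. x \<in> ?O \<longrightarrow>
        (SUP v\<in>sphere 0 1. norm (dir_deriv f x v)) \<le> C * (INF v\<in>sphere 0 1. norm (dir_deriv f x v))"
    using qc unfolding quasiconformal_def AE_completion_iff by blast
  with ae have dil: "AE x in lborel.
        (SUP v\<in>sphere 0 1. norm (dir_deriv f x v)) \<le> C * (INF v\<in>sphere 0 1. norm (dir_deriv f x v))"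
    by eventually_elim simp
  have acl1: "AE y in lborel. \<forall>a b. {a..b} \<times> {y} \<subseteq> ?O \<longrightarrow> abs_continuous_on {a..b} (\<lambda>x. f (x, y))"
   and acl2: "AE x in lborel. \<forall>a b. {x} \<times> {a..b} \<subseteq> ?O \<longrightarrow> abs_continuous_on {a..b} (\<lambda>y. f (x, y))"
    using qc unfolding quasiconformal_def ACL_def AE_completion_iff by blast+
  have comp: "(AE y in lborel. \<forall>a b. abs_continuous_on {a..b} (\<lambda>x. c (f (x, y)))) \<and>
      (AE x in lborel. \<forall>a b. abs_continuous_on {a..b} (\<lambda>y. c (f (x, y))))"
    if c: "bounded_linear c" "\<And>p. \<bar>c p\<bar> \<le> norm p"
      and acc: "\<And>S k. abs_continuous_on S k \<Longrightarrow> abs_continuous_on S (\<lambda>x. c (k x))"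
    for c :: "real \<times> real \<Rightarrow> real"
  proof -
    let ?u = "\<lambda>z. c (f z)"
    have u: "continuous_on UNIV ?u"
      by (rule continuous_on_compose2[OF linear_continuous_on[OF c(1)] f(1)]) auto
    define p where "p v = dir_limit ?u v" for v
    have pm: "p v \<in> borel_measurable borel" for v
      unfolding p_def by (rule dir_limit_measurable[OF u])
    have pL: "locally_Lp 2 (p v)" if v: "norm v = 1" for v
    proof -
      have sq: "\<bar>p v z\<bar> powr 2 = (p v z)\<^sup>2" for z
        by (simp add: powr_numeral)
      have "AE z in lborel. (p v z)\<^sup>2 \<le> C\<^sup>2 * \<bar>jacobian f z\<bar>"
        using diff dil
      proof eventually_elim
        case (elim z)
        define D where "D = frechet_derivative f (at z)"
        have D: "(f has_derivative D) (at z)"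
          using elim(1) by (simp add: D_def frechet_derivative_works)
        have "p v z = c (D v)"
          unfolding p_def by (rule dir_limit_eq(1)[OF bounded_linear.has_derivative[OF c(1) D]])
        then have "\<bar>p v z\<bar> \<le> norm (D v)"
          using c(2) by simp
        then have "(p v z)\<^sup>2 \<le> (norm (D v))\<^sup>2"
          by (metis abs_ge_zero power2_abs power_mono)
        also have "\<dots> \<le> C\<^sup>2 * \<bar>jacobian f z\<bar>"
          using norm_square_le_dilatation[OF has_derivative_bounded_linear[OF D] _ v, of C] elim(2)
          by (simp add: jacobian_eq[OF D] dir_deriv_eq[OF D])
        finally show ?case .
      qed
      then have b: "AE z in lborel. norm (indicator (cball 0 R) z * \<bar>p v z\<bar> powr 2)
         \<le> norm (C\<^sup>2 * (indicator (cball 0 R) z * \<bar>jacobian f z\<bar>))" for R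
        unfolding sq by eventually_elim (auto simp: indicator_def)
      have m: "(\<lambda>z. indicator (cball 0 R) z * \<bar>p v z\<bar> powr 2) \<in> borel_measurable borel" for R
        using pm[of v] unfolding sq by (intro borel_measurable_times borel_measurable_indicator
            borel_measurable_power) auto
      have "integrable lborel (\<lambda>z. indicator (cball 0 R) z * \<bar>p v z\<bar> powr 2)" for R
        by (rule Bochner_Integration.integrable_bound[OF integrable_mult_right[OF
            jacobian_locally_integrable[OF f diff]] _ b])
          (use m in simp)
      then show ?thesis
        using m borel_measurable_lebesgueI[OF pm] by (simp add: locally_Lp_def integrable_completion)
    qed
    have d: "AE z in lborel. ((\<lambda>t. ?u (z + t *\<^sub>R v)) has_real_derivative p v z) (at 0)" for v
      using diff
    proof eventually_elim
      case (elim z)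
      then have D: "(f has_derivative frechet_derivative f (at z)) (at z)"
        by (simp add: frechet_derivative_works)
      show ?case
        using dir_limit_eq[OF bounded_linear.has_derivative[OF c(1) D], of v] by (simp add: p_def)
    qed
    have d1: "AE z in lborel. ((\<lambda>x. ?u (x, snd z)) has_real_derivative p (1, 0) z) (at (fst z))"
      using d[of "(1, 0)"]
    proof eventually_elim
      case (elim z)
      have "(\<lambda>t. ?u (z + t *\<^sub>R (1, 0))) = (\<lambda>t. (\<lambda>x. ?u (x, snd z)) (t + fst z))"
        by (cases z) (auto simp: add.commute)
      then show ?case
        using elim DERIV_shift[of "\<lambda>x. ?u (x, snd z)" "p (1, 0) z" 0 "fst z"] by simp
    qed
    have d2: "AE z in lborel. ((\<lambda>y. ?u (fst z, y)) has_real_derivative p (0, 1) z) (at (snd z))"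
      using d[of "(0, 1)"]
    proof eventually_elim
      case (elim z)
      have "(\<lambda>t. ?u (z + t *\<^sub>R (0, 1))) = (\<lambda>t. (\<lambda>y. ?u (fst z, y)) (t + snd z))"
        by (cases z) (auto simp: add.commute)
      then show ?case
        using elim DERIV_shift[of "\<lambda>y. ?u (fst z, y)" "p (0, 1) z" 0 "snd z"] by simp
    qed
    have a1: "AE y in lborel. \<forall>a b. {a..b} \<times> {y} \<subseteq> ?O \<longrightarrow> abs_continuous_on {a..b} (\<lambda>x. ?u (x, y))"
      using acl1 by eventually_elim (use acc in blast)
    have a2: "AE x in lborel. \<forall>a b. {x} \<times> {a..b} \<subseteq> ?O \<longrightarrow> abs_continuous_on {a..b} (\<lambda>y. ?u (x, y))"
      using acl2 by eventually_elim (use acc in blast)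
    have n1: "norm (1 :: real, 0 :: real) = 1" "norm (0 :: real, 1 :: real) = 1"
      by (simp_all add: norm_Pair)
    show ?thesis
      using abs_continuous_across_graph[OF fm u pm pL[OF n1(1)] pm pL[OF n1(2)] d1 d2 a1 a2] by blast
  qed
  have nf: "\<bar>fst p\<bar> \<le> norm p" "\<bar>snd p\<bar> \<le> norm p" for p :: "real \<times> real"
    using norm_fst_le[of "fst p" "snd p"] norm_snd_le[of "snd p" "fst p"] by auto
  have c1: "(AE y in lborel. \<forall>a b. abs_continuous_on {a..b} (\<lambda>x. fst (f (x, y)))) \<and>
      (AE x in lborel. \<forall>a b. abs_continuous_on {a..b} (\<lambda>y. fst (f (x, y))))"
    by (rule comp[OF bounded_linear_fst nf(1)]) (simp add: abs_continuous_on_Pair_iff)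
  have c2: "(AE y in lborel. \<forall>a b. abs_continuous_on {a..b} (\<lambda>x. snd (f (x, y)))) \<and>
      (AE x in lborel. \<forall>a b. abs_continuous_on {a..b} (\<lambda>y. snd (f (x, y))))"
    by (rule comp[OF bounded_linear_snd nf(2)]) (simp add: abs_continuous_on_Pair_iff)
  have "AE y in lborel. \<forall>a b. abs_continuous_on {a..b} (\<lambda>x. f (x, y))"
    using c1[THEN conjunct1] c2[THEN conjunct1]
    by eventually_elim (subst abs_continuous_on_Pair_iff, blast)
  moreover have "AE x in lborel. \<forall>a b. abs_continuous_on {a..b} (\<lambda>y. f (x, y))"
    using c1[THEN conjunct2] c2[THEN conjunct2]
    by eventually_elim (subst abs_continuous_on_Pair_iff, blast)
  ultimately have "ACL UNIV f"
    unfolding ACL_def AE_completion_iff by auto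
  moreover have "AE x\<in>UNIV in lebesgue. f differentiable (at x)"
    unfolding AE_completion_iff using diff by simp
  moreover have "AE x\<in>UNIV in lebesgue.
        (SUP v\<in>sphere 0 1. norm (dir_deriv f x v)) \<le> C * (INF v\<in>sphere 0 1. norm (dir_deriv f x v))"
    unfolding AE_completion_iff using dil by simp
  ultimately show "quasiconformal UNIV UNIV f"
    unfolding quasiconformal_def using hom by blast
qed

lemma fine_modulus_holder_graph:
  fixes p \<alpha> :: real
  assumes p: "1 < p" "p / (2 * p - 1) < \<alpha>" and \<Gamma>: "holder_graph \<alpha> \<Gamma>"
  shows "\<exists>f. \<Gamma> = unit_graph f \<and> fine_modulus (p / (p - 1)) f"
proof -
  obtain f C where f: "\<Gamma> = unit_graph f" "\<forall>x\<in>{0..1}. \<forall>y\<in>{0..1}. \<bar>f x - f y\<bar> \<le> C * \<bar>x - y\<bar> powr \<alpha>"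
    using \<Gamma> unfolding holder_graph_def by blast
  have "p < \<alpha> * (2 * p - 1)"
    using p by (simp add: divide_less_eq)
  then have "p / (p - 1) < \<alpha> * (2 * p - 1) / (p - 1)"
    using p by (intro divide_strict_right_mono) auto
  also have "\<dots> = \<alpha> * (1 + p / (p - 1))"
    using p by (simp add: field_simps)
  finally have "fine_modulus (p / (p - 1)) f"
    using p f(2) by (intro fine_modulus_Holder[where C=C]) auto
  then show ?thesis
    using f(1) by blast
qed

theorem theorem3:
  shows
   "(\<forall>(p::real) (p'::real) (h::real \<Rightarrow> real) (h_inv::real \<Rightarrow> real).
       1 < p \<longrightarrow> 1 / p + 1 / p' = 1 \<longrightarrow>
       homeomorphism {0..} {0..} h h_inv \<longrightarrow> h 0 = 0 \<longrightarrow>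
       (\<integral>\<^sup>+t\<in>{0..1}. ennreal ((t / h_inv t) powr p') \<partial>lebesgue) < \<infinity> \<longrightarrow>
       (\<forall>\<Gamma>. holder_fun_graph h \<Gamma> \<longrightarrow> W1p_removable p \<Gamma>))
  \<and> (\<forall>(p::real) (\<alpha>::real). 1 < p \<longrightarrow> p / (2 * p - 1) < \<alpha> \<longrightarrow>
       (\<forall>\<Gamma>. holder_graph \<alpha> \<Gamma> \<longrightarrow> W1p_removable p \<Gamma>))
  \<and> (\<forall>\<alpha>::real. 2 / 3 < \<alpha> \<longrightarrow>
       (\<forall>\<Gamma>. holder_graph \<alpha> \<Gamma> \<longrightarrow> W1p_removable 2 \<Gamma> \<and> qc_removable \<Gamma>))"
proof (intro conjI allI impI)
  fix p p' :: real and h h_inv :: "real \<Rightarrow> real" and \<Gamma>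
  assume p: "1 < p" "1 / p + 1 / p' = 1" and h: "homeomorphism {0..} {0..} h h_inv" "h 0 = 0"
    and fin: "(\<integral>\<^sup>+t\<in>{0..1}. ennreal ((t / h_inv t) powr p') \<partial>lebesgue) < \<infinity>"
    and "holder_fun_graph h \<Gamma>"
  then obtain f where f: "\<Gamma> = unit_graph f" "\<forall>x\<in>{0..1}. \<forall>y\<in>{0..1}. \<bar>f x - f y\<bar> \<le> h \<bar>x - y\<bar>"
    unfolding holder_fun_graph_def by blast
  have "1 / p < 1"
    using p by simp
  then have "0 < 1 / p'"
    using p(2) by linarith
  then have "0 < p'"
    by simp
  then have "fine_modulus p' f"
    using f(2) by (intro fine_modulus_homeomorphism[OF h _ fin]) auto
  then show "W1p_removable p \<Gamma>"
    unfolding f(1) by (rule W1p_removable_unit_graph[OF p])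
next
  fix p \<alpha> :: real and \<Gamma>
  assume p: "1 < p" "p / (2 * p - 1) < \<alpha>" and "holder_graph \<alpha> \<Gamma>"
  then obtain f where f: "\<Gamma> = unit_graph f" "fine_modulus (p / (p - 1)) f"
    using fine_modulus_holder_graph by blast
  have "1 / p + 1 / (p / (p - 1)) = 1"
    using p by (simp add: field_simps)
  then show "W1p_removable p \<Gamma>"
    unfolding f(1) by (rule W1p_removable_unit_graph[OF p(1) _ f(2)])
next
  fix \<alpha> :: real and \<Gamma>
  assume "2 / 3 < \<alpha>" "holder_graph \<alpha> \<Gamma>"
  then obtain f where f: "\<Gamma> = unit_graph f" "fine_modulus 2 f"
    using fine_modulus_holder_graph[of 2 \<alpha> \<Gamma>] by auto
  show "W1p_removable 2 \<Gamma>"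
    unfolding f(1) by (rule W1p_removable_unit_graph[OF _ _ f(2)]) simp_all
  show "qc_removable \<Gamma>"
    unfolding f(1) by (rule qc_removable_unit_graph[OF f(2)])
qed

end
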